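(* Let $(T,\preceq,\Sigma,\mathcal S,\mathcal M)$ be an $(\mathcal S,\mathcal M)$-tree and let $\mathcal R$ be the space of infinite fat subtrees with the Ellentuck topology. Then every subset of $\mathcal R$ with the property of Baire is Ramsey, and every meager subset of $\mathcal R$ is Ramsey null.
   Context: A tree is a partially ordered set $(T,\preceq)$ such that for every $a\in T$ the set $\{b\in T:b\prec a\}$ is finite and linearly ordered by $\preceq$. The level of $a$ is $\ell(a)=|\{b\in T:b\prec a\}|$; $T(n)=\{a\in T:\ell(a)=n\}$, and $T(\le n)$, $T(<n)$ are defined analogously. A node $b$ is an immediate successor of $a$ if $a\prec b$ and there is no $c$ with $a\prec c\prec b$. An $\mathcal S$-tree is a quadruple $(T,\preceq,\Sigma,\mathcal S)$ where $(T,\preceq)$ is a countable tree in which every node has finitely many immediate successors and $T(0)$ is finite, $\Sigma$ is a set, and $\mathcal S\colon T\times T^{<\omega}\times\Sigma\to T$ is a partial function such that: (S1) if $\mathcal S(a,\bar p,c)$ is defined then it is an immediate successor of $a$ and every entry of $\bar p$ has level at most $\ell(a)-1$; (S2) if $\mathcal S(a,\bar p,c)=\mathcal S(b,\bar q,d)$ then $a=b$, $\bar p=\bar q$ and $c=d$; (S3) for every $a\in T$ and every immediate successor $b$ of $a$ there are $\bar p\in T^{<\omega}$ and $c\in\Sigma$ with $b=\mathcal S(a,\bar p,c)$. For $S\subseteq T$, a map $f\colon S\to T$ is level-preserving if $\ell(a)=\ell(b)$ implies $\ell(f(a))=\ell(f(b))$; then $\tilde f(n)$ denotes $\ell(f(a))$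 for any $a\in S$ with $\ell(a)=n$. An injection $F\colon T\to T$ is shape-preserving if (i) it is level-preserving; (ii) whenever $\mathcal S(a,\bar p,c)$ is defined, $\mathcal S(F(a),F(\bar p),c)$ is defined and $\mathcal S(F(a),F(\bar p),c)\preceq F(\mathcal S(a,\bar p,c))$, where $F(\bar p)$ is the tuple of images of the entries of $\bar p$; (iii) for every $a\in T(0)$ and $b\in T$ with $a\preceq b$ we have $a\preceq F(b)$. A shape-preserving $F$ skips level $m$ if $m\notin\tilde F[\omega]$, and skips only level $m$ if $\tilde F[\omega]=\omega\setminus\{m\}$. An $(\mathcal S,\mathcal M)$-tree is a quintuple $(T,\preceq,\Sigma,\mathcal S,\mathcal M)$ where $(T,\preceq,\Sigma,\mathcal S)$ is an $\mathcal S$-tree and $\mathcal M$ is a set of shape-preserving functions $T\to T$ such that: (M1) $\mathrm{Id}_T\in\mathcal M$, $\mathcal M$ is closed under composition, and whenever $(F_i)_{i\in\omega}$ is a sequence in $\mathcal M$ with $F_i\restriction T(\le i)=F_{i+1}\restriction T(\le i)$ for all $i$, there is $F_\infty\in\mathcal M$ with $F_\infty\restriction T(\le i)=F_i\restriction T(\le i)$ for all $i$; (M2) for every $n\in\omega$ and every $F\in\mathcal M$ with $\tilde F(n)>0$ which skips level $\tilde F(n)-1$, there are $F_1,F_2\in\mathcal M$ such that $F_2$ skips only level $\tilde F(n)-1$ and $(F_2\circ F_1)\restriction T(\le n)=F\restriction T(\le n)$; (M3) for all $n<m$ in $\omega$ there is $F^n_m\in\mathcal M$ skipping only level $m$ such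 that $F^n_m(b)=\mathcal S(b,\bar p,c)$ whenever $a\in T(n)$, $b\in T(m)$, $\bar p\in T^{<\omega}$, $c\in\Sigma$, $\mathcal S(a,\bar p,c)$ is defined and $\mathcal S(a,\bar p,c)\preceq b$. Notation: $\mathcal M^n=\{F\in\mathcal M: F\restriction T(<n)\text{ is the identity}\}$; $\mathcal{AM}=\{F\restriction T(<k): F\in\mathcal M,\ k>0\}$; $\mathcal{AM}^n_k=\{F\restriction T(<n+k):F\in\mathcal M^n\}$; $\mathcal{AM}^n_k(m)=\{f\in\mathcal{AM}^n_k:\tilde f(n+k-1)=m\}$. For $f\in\mathcal{AM}$ with domain $T(\le n)$, its canonical extension $f^+$ is the unique $f^+\in\mathcal M$ with $f^+\restriction T(\le n)=f$ and $\ell\in\tilde{f^+}[\omega]$ for all $\ell\ge\tilde f(n)$ (it exists and is unique). Fat subtrees: for $n\in\omega+1$, a fat subtree of height $n$ is a sequence $\mathbf U=(u_i)_{i\in n}$ of elements of $\mathcal{AM}$ for which there is a (necessarily unique) cut function $c_{\mathbf U}\colon\min(n+1,\omega)\to\omega$ with $c_{\mathbf U}(0)=0$ and $u_\ell\in\mathcal{AM}^{c_{\mathbf U}(\ell)}_1(c_{\mathbf U}(\ell+1)-1)$ for every $\ell<n$. For levels $0\le\ell\le k\le n$ (with $k<\omega$) and nonempty $X\subseteq T(c_{\mathbf U}(\ell))$, the lift $\mathrm{Lift}_{\mathbf U}(X,\ell,k)\subseteq T(c_{\mathbf U}(k))$ is defined recursively: it is $X$ if $\ell=k$, and if $\ell<k$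 it is $\mathrm{Lift}_{\mathbf U}(u_\ell^+[N],\ell+1,k)$, where $N$ is the set of all immediate successors of nodes of $X$. Write $\mathrm{Lift}_{\mathbf U}(\ell,k)=\mathrm{Lift}_{\mathbf U}(T(c_{\mathbf U}(\ell)),\ell,k)$. For fat subtrees $\mathbf V=(v_i)_{i\in m}$ and $\mathbf U=(u_i)_{i\in m'}$, $\mathbf V\le\mathbf U$ means there is $\varphi\colon\min(m+1,\omega)\to\min(m'+1,\omega)$ such that for every $\ell<m$: $c_{\mathbf V}(\ell)=c_{\mathbf U}(\varphi(\ell))$ and $\mathrm{Lift}_{\mathbf V}(\ell,\ell+1)\subseteq\mathrm{Lift}_{\mathbf U}(\varphi(\ell),\varphi(\ell+1))$. $\mathcal R$ is the set of fat subtrees of height $\omega$ and $\mathcal{AR}$ the set of fat subtrees of finite height. The Ellentuck topology on $\mathcal R$ is generated by the basic sets $[\mathbf x,\mathbf U]=\{\mathbf V\in\mathcal R:\mathbf V\le\mathbf U\text{ and }\mathbf x\text{ is an initial segment of }\mathbf V\}$ for $\mathbf x\in\mathcal{AR}$, $\mathbf U\in\mathcal R$. For $n\in\omega$, $[n,\mathbf U]=[\mathbf U\restriction n,\mathbf U]$ where $\mathbf U\restriction n$ is the initial segment of length $n$. For $\mathbf x\in\mathcal{AR}$ of height $|\mathbf x|$, $\mathrm{depth}_{\mathbf U}(\mathbf x)$ is the unique $n$ with $c_{\mathbf U}(n)=c_{\mathbf x}(|\mathbf x|)$ if $\mathbf x\le\mathbf U$, and $\omega$ otherwise. A set $\mathcal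 X\subseteq\mathcal R$ is Ramsey if for every nonempty $[\mathbf x,\mathbf U]$ there is $\mathbf U'\in[\mathrm{depth}_{\mathbf U}(\mathbf x),\mathbf U]$ with $[\mathbf x,\mathbf U']\subseteq\mathcal X$ or $[\mathbf x,\mathbf U']\cap\mathcal X=\emptyset$; it is Ramsey null if always the second alternative can be achieved. *)

theory Defs
  imports "HOL-Analysis.Analysis"
begin

text \<open>Trees. The node set T of the tree is the whole (countable) type 'a;
  the tree order is le (written \<preceq> in the paper).\<close>

definition lt :: "('a \<Rightarrow> 'a \<Rightarrow> bool) \<Rightarrow> 'a \<Rightarrow> 'a \<Rightarrow> bool" where
  "lt le a b \<longleftrightarrow> le a b \<and> a \<noteq> b"

definition is_tree :: "('a \<Rightarrow> 'a \<Rightarrow> bool) \<Rightarrow> bool" where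
  "is_tree le \<longleftrightarrow>
     (\<forall>a. le a a) \<and> (\<forall>a b. le a b \<and> le b a \<longrightarrow> a = b) \<and>
     (\<forall>a b c. le a b \<and> le b c \<longrightarrow> le a c) \<and>
     (\<forall>a. finite {b. lt le b a} \<and> (\<forall>b c. lt le b a \<and> lt le c a \<longrightarrow> le b c \<or> le c b))"

definition lev :: "('a \<Rightarrow> 'a \<Rightarrow> bool) \<Rightarrow> 'a \<Rightarrow> nat" where
  "lev le a = card {b. lt le b a}"

definition levset :: "('a \<Rightarrow> 'a \<Rightarrow> bool) \<Rightarrow> nat \<Rightarrow> 'a set" where
  "levset le n = {a. lev le a = n}"

definition immsucc :: "('a \<Rightarrow> 'a \<Rightarrow> bool) \<Rightarrow> 'a \<Rightarrow> 'a \<Rightarrow> bool" where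
  "immsucc le a b \<longleftrightarrow> lt le a b \<and> \<not> (\<exists>c. lt le a c \<and> lt le c b)"

definition succs :: "('a \<Rightarrow> 'a \<Rightarrow> bool) \<Rightarrow> 'a set \<Rightarrow> 'a set" where
  "succs le X = {b. \<exists>a\<in>X. immsucc le a b}"

text \<open>S-trees: Sigma is the type 'c; the partial function S is option-valued.\<close>

definition is_S_tree :: "('a::countable \<Rightarrow> 'a \<Rightarrow> bool) \<Rightarrow> ('a \<Rightarrow> 'a list \<Rightarrow> 'c \<Rightarrow> 'a option) \<Rightarrow> bool" where
  "is_S_tree le S \<longleftrightarrow>
     is_tree le \<and> (\<forall>a. finite {b. immsucc le a b}) \<and> finite (levset le 0) \<and>
     (\<forall>a p c b. S a p c = Some b \<longrightarrow> immsucc le a b \<and> (\<forall>x\<in>set p. lev le x + 1 \<le> lev le a)) \<and>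
     (\<forall>a p c b q d x. S a p c = Some x \<and> S b q d = Some x \<longrightarrow> a = b \<and> p = q \<and> c = d) \<and>
     (\<forall>a b. immsucc le a b \<longrightarrow> (\<exists>p c. S a p c = Some b))"

definition level_pres :: "('a \<Rightarrow> 'a \<Rightarrow> bool) \<Rightarrow> ('a \<Rightarrow> 'a) \<Rightarrow> bool" where
  "level_pres le F \<longleftrightarrow> (\<forall>a b. lev le a = lev le b \<longrightarrow> lev le (F a) = lev le (F b))"

definition tildeF :: "('a \<Rightarrow> 'a \<Rightarrow> bool) \<Rightarrow> ('a \<Rightarrow> 'a) \<Rightarrow> nat \<Rightarrow> nat" where
  "tildeF le F n = lev le (F (SOME a. lev le a = n))"

definition limg :: "('a \<Rightarrow> 'a \<Rightarrow> bool) \<Rightarrow> ('a \<Rightarrow> 'a) \<Rightarrow> nat set" where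
  "limg le F = (\<lambda>a. lev le (F a)) ` UNIV"

definition shape_pres :: "('a \<Rightarrow> 'a \<Rightarrow> bool) \<Rightarrow> ('a \<Rightarrow> 'a list \<Rightarrow> 'c \<Rightarrow> 'a option) \<Rightarrow> ('a \<Rightarrow> 'a) \<Rightarrow> bool" where
  "shape_pres le S F \<longleftrightarrow>
     inj F \<and> level_pres le F \<and>
     (\<forall>a p c b. S a p c = Some b \<longrightarrow>
        (\<exists>b'. S (F a) (map F p) c = Some b' \<and> le b' (F b))) \<and>
     (\<forall>a b. lev le a = 0 \<and> le a b \<longrightarrow> le a (F b))"

definition is_SM_tree :: "('a::countable \<Rightarrow> 'a \<Rightarrow> bool) \<Rightarrow> ('a \<Rightarrow> 'a list \<Rightarrow> 'c \<Rightarrow> 'a option) \<Rightarrow> ('a \<Rightarrow> 'a) set \<Rightarrow> bool" where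
  "is_SM_tree le S M \<longleftrightarrow>
     is_S_tree le S \<and> (\<forall>F\<in>M. shape_pres le S F) \<and>
     \<comment> \<open>(M1)\<close>
     id \<in> M \<and> (\<forall>F\<in>M. \<forall>G\<in>M. F \<circ> G \<in> M) \<and>
     (\<forall>Fs :: nat \<Rightarrow> 'a \<Rightarrow> 'a.
        (\<forall>i. Fs i \<in> M) \<and> (\<forall>i a. lev le a \<le> i \<longrightarrow> Fs i a = Fs (Suc i) a) \<longrightarrow>
        (\<exists>G\<in>M. \<forall>i a. lev le a \<le> i \<longrightarrow> G a = Fs i a)) \<and>
     \<comment> \<open>(M2)\<close>
     (\<forall>n. \<forall>F\<in>M. tildeF le F n > 0 \<and> tildeF le F n - 1 \<notin> limg le F \<longrightarrow>
        (\<exists>F1\<in>M. \<exists>F2\<in>M. limg le F2 = UNIV - {tildeF le F n - 1} \<and>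
           (\<forall>a. lev le a \<le> n \<longrightarrow> F2 (F1 a) = F a))) \<and>
     \<comment> \<open>(M3)\<close>
     (\<forall>n m. n < m \<longrightarrow>
        (\<exists>F\<in>M. limg le F = UNIV - {m} \<and>
           (\<forall>a b p c x. lev le a = n \<and> lev le b = m \<and> S a p c = Some x \<and> le x b \<longrightarrow>
              S b p c = Some (F b))))"

definition restr :: "('a \<Rightarrow> 'a \<Rightarrow> bool) \<Rightarrow> ('a \<Rightarrow> 'a) \<Rightarrow> nat \<Rightarrow> ('a \<Rightarrow> 'a option)" where
  "restr le F k = (\<lambda>a. if lev le a < k then Some (F a) else None)"

definition AM :: "('a \<Rightarrow> 'a \<Rightarrow> bool) \<Rightarrow> ('a \<Rightarrow> 'a) set \<Rightarrow> ('a \<Rightarrow> 'a option) set" where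
  "AM le M = {restr le F k | F k. F \<in> M \<and> 0 < k}"

definition Mn :: "('a \<Rightarrow> 'a \<Rightarrow> bool) \<Rightarrow> ('a \<Rightarrow> 'a) set \<Rightarrow> nat \<Rightarrow> ('a \<Rightarrow> 'a) set" where
  "Mn le M n = {F \<in> M. \<forall>a. lev le a < n \<longrightarrow> F a = a}"

definition AMnk :: "('a \<Rightarrow> 'a \<Rightarrow> bool) \<Rightarrow> ('a \<Rightarrow> 'a) set \<Rightarrow> nat \<Rightarrow> nat \<Rightarrow> ('a \<Rightarrow> 'a option) set" where
  "AMnk le M n k = {restr le F (n + k) | F. F \<in> Mn le M n}"

definition tildep :: "('a \<Rightarrow> 'a \<Rightarrow> bool) \<Rightarrow> ('a \<Rightarrow> 'a option) \<Rightarrow> nat \<Rightarrow> nat" where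
  "tildep le f n = lev le (the (f (SOME a. lev le a = n)))"

definition AMnkm :: "('a \<Rightarrow> 'a \<Rightarrow> bool) \<Rightarrow> ('a \<Rightarrow> 'a) set \<Rightarrow> nat \<Rightarrow> nat \<Rightarrow> nat \<Rightarrow> ('a \<Rightarrow> 'a option) set" where
  "AMnkm le M n k m = {f \<in> AMnk le M n k. tildep le f (n + k - 1) = m}"

definition canon :: "('a \<Rightarrow> 'a \<Rightarrow> bool) \<Rightarrow> ('a \<Rightarrow> 'a) set \<Rightarrow> ('a \<Rightarrow> 'a option) \<Rightarrow> nat \<Rightarrow> ('a \<Rightarrow> 'a)" where
  "canon le M f n = (THE F. F \<in> M \<and> restr le F (Suc n) = f \<and> (\<forall>l\<ge>tildep le f n. l \<in> limg le F))"

text \<open>Fat subtrees: a fat subtree of height h (h = \<infinity> for \<omega>) is given by the sequence u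
  (only the entries u l with l < h matter); c is a cut function (only c l, l \<le> h, matter).\<close>

definition is_cut :: "('a \<Rightarrow> 'a \<Rightarrow> bool) \<Rightarrow> ('a \<Rightarrow> 'a) set \<Rightarrow> enat \<Rightarrow> (nat \<Rightarrow> ('a \<Rightarrow> 'a option)) \<Rightarrow> (nat \<Rightarrow> nat) \<Rightarrow> bool" where
  "is_cut le M h u c \<longleftrightarrow> c 0 = 0 \<and>
     (\<forall>l. enat l < h \<longrightarrow> 0 < c (Suc l) \<and> u l \<in> AMnkm le M (c l) 1 (c (Suc l) - 1))"

definition fat :: "('a \<Rightarrow> 'a \<Rightarrow> bool) \<Rightarrow> ('a \<Rightarrow> 'a) set \<Rightarrow> enat \<Rightarrow> (nat \<Rightarrow> ('a \<Rightarrow> 'a option)) \<Rightarrow> bool" where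
  "fat le M h u \<longleftrightarrow> (\<exists>c. is_cut le M h u c)"

definition cutf :: "('a \<Rightarrow> 'a \<Rightarrow> bool) \<Rightarrow> ('a \<Rightarrow> 'a) set \<Rightarrow> enat \<Rightarrow> (nat \<Rightarrow> ('a \<Rightarrow> 'a option)) \<Rightarrow> nat \<Rightarrow> nat" where
  "cutf le M h u = (SOME c. is_cut le M h u c)"

fun liftd :: "('a \<Rightarrow> 'a \<Rightarrow> bool) \<Rightarrow> ('a \<Rightarrow> 'a) set \<Rightarrow> (nat \<Rightarrow> ('a \<Rightarrow> 'a option)) \<Rightarrow> (nat \<Rightarrow> nat)
    \<Rightarrow> 'a set \<Rightarrow> nat \<Rightarrow> nat \<Rightarrow> 'a set" where
  "liftd le M u c X l 0 = X"
| "liftd le M u c X l (Suc d) = liftd le M u c (canon le M (u l) (c l) ` succs le X) (Suc l) d"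

definition Lift :: "('a \<Rightarrow> 'a \<Rightarrow> bool) \<Rightarrow> ('a \<Rightarrow> 'a) set \<Rightarrow> (nat \<Rightarrow> ('a \<Rightarrow> 'a option)) \<Rightarrow> (nat \<Rightarrow> nat)
    \<Rightarrow> 'a set \<Rightarrow> nat \<Rightarrow> nat \<Rightarrow> 'a set" where
  "Lift le M u c X l k = liftd le M u c X l (k - l)"

definition LiftL :: "('a \<Rightarrow> 'a \<Rightarrow> bool) \<Rightarrow> ('a \<Rightarrow> 'a) set \<Rightarrow> (nat \<Rightarrow> ('a \<Rightarrow> 'a option)) \<Rightarrow> (nat \<Rightarrow> nat)
    \<Rightarrow> nat \<Rightarrow> nat \<Rightarrow> 'a set" where
  "LiftL le M u c l k = Lift le M u c (levset le (c l)) l k"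

definition fat_le :: "('a \<Rightarrow> 'a \<Rightarrow> bool) \<Rightarrow> ('a \<Rightarrow> 'a) set \<Rightarrow> enat \<times> (nat \<Rightarrow> ('a \<Rightarrow> 'a option))
    \<Rightarrow> enat \<times> (nat \<Rightarrow> ('a \<Rightarrow> 'a option)) \<Rightarrow> bool" where
  "fat_le le M V U \<longleftrightarrow>
     (let hV = fst V; v = snd V; hU = fst U; u = snd U;
          cV = cutf le M hV v; cU = cutf le M hU u in
      \<exists>\<phi> :: nat \<Rightarrow> nat.
        (\<forall>l. enat l \<le> hV \<longrightarrow> enat (\<phi> l) \<le> hU) \<and>
        (\<forall>l. enat l < hV \<longrightarrow>
           \<phi> l \<le> \<phi> (Suc l) \<and> cV l = cU (\<phi> l) \<and>
           LiftL le M v cV l (Suc l) \<subseteq> LiftL le M u cU (\<phi> l) (\<phi> (Suc l))))"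

definition Rset :: "('a \<Rightarrow> 'a \<Rightarrow> bool) \<Rightarrow> ('a \<Rightarrow> 'a) set \<Rightarrow> (nat \<Rightarrow> ('a \<Rightarrow> 'a option)) set" where
  "Rset le M = {u. fat le M \<infinity> u}"

definition ARset :: "('a \<Rightarrow> 'a \<Rightarrow> bool) \<Rightarrow> ('a \<Rightarrow> 'a) set \<Rightarrow> ('a \<Rightarrow> 'a option) list set" where
  "ARset le M = {xs. fat le M (enat (length xs)) (nth xs)}"

definition basic :: "('a \<Rightarrow> 'a \<Rightarrow> bool) \<Rightarrow> ('a \<Rightarrow> 'a) set \<Rightarrow> ('a \<Rightarrow> 'a option) list
    \<Rightarrow> (nat \<Rightarrow> ('a \<Rightarrow> 'a option)) \<Rightarrow> (nat \<Rightarrow> ('a \<Rightarrow> 'a option)) set" where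
  "basic le M x U = {V \<in> Rset le M. fat_le le M (\<infinity>, V) (\<infinity>, U) \<and> (\<forall>i<length x. x ! i = V i)}"

definition Ellentuck :: "('a \<Rightarrow> 'a \<Rightarrow> bool) \<Rightarrow> ('a \<Rightarrow> 'a) set \<Rightarrow> (nat \<Rightarrow> ('a \<Rightarrow> 'a option)) topology" where
  "Ellentuck le M = topology_generated_by {basic le M x U | x U. x \<in> ARset le M \<and> U \<in> Rset le M}"

definition depth :: "('a \<Rightarrow> 'a \<Rightarrow> bool) \<Rightarrow> ('a \<Rightarrow> 'a) set \<Rightarrow> ('a \<Rightarrow> 'a option) list
    \<Rightarrow> (nat \<Rightarrow> ('a \<Rightarrow> 'a option)) \<Rightarrow> enat" where
  "depth le M x U =
     (if fat_le le M (enat (length x), nth x) (\<infinity>, U)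
      then enat (THE n. cutf le M \<infinity> U n = cutf le M (enat (length x)) (nth x) (length x))
      else \<infinity>)"

text \<open>[n, U] = [U|n, U]; for n = \<omega> we read U|\<omega> as U itself.\<close>

definition basic_n :: "('a \<Rightarrow> 'a \<Rightarrow> bool) \<Rightarrow> ('a \<Rightarrow> 'a) set \<Rightarrow> enat
    \<Rightarrow> (nat \<Rightarrow> ('a \<Rightarrow> 'a option)) \<Rightarrow> (nat \<Rightarrow> ('a \<Rightarrow> 'a option)) set" where
  "basic_n le M n U = (case n of
       enat k \<Rightarrow> basic le M (map U [0..<k]) U
     | \<infinity> \<Rightarrow> {V \<in> Rset le M. fat_le le M (\<infinity>, V) (\<infinity>, U) \<and> V = U})"

definition Ramsey :: "('a \<Rightarrow> 'a \<Rightarrow> bool) \<Rightarrow> ('a \<Rightarrow> 'a) set \<Rightarrow> (nat \<Rightarrow> ('a \<Rightarrow> 'a option)) set \<Rightarrow> bool" where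
  "Ramsey le M X \<longleftrightarrow>
     (\<forall>x\<in>ARset le M. \<forall>U\<in>Rset le M. basic le M x U \<noteq> {} \<longrightarrow>
        (\<exists>U'\<in>basic_n le M (depth le M x U) U.
           basic le M x U' \<subseteq> X \<or> basic le M x U' \<inter> X = {}))"

definition Ramsey_null :: "('a \<Rightarrow> 'a \<Rightarrow> bool) \<Rightarrow> ('a \<Rightarrow> 'a) set \<Rightarrow> (nat \<Rightarrow> ('a \<Rightarrow> 'a option)) set \<Rightarrow> bool" where
  "Ramsey_null le M X \<longleftrightarrow>
     (\<forall>x\<in>ARset le M. \<forall>U\<in>Rset le M. basic le M x U \<noteq> {} \<longrightarrow>
        (\<exists>U'\<in>basic_n le M (depth le M x U) U. basic le M x U' \<inter> X = {}))"

definition nowhere_dense :: "'x topology \<Rightarrow> 'x set \<Rightarrow> bool" where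
  "nowhere_dense Tp A \<longleftrightarrow> A \<subseteq> topspace Tp \<and> Tp interior_of (Tp closure_of A) = {}"

definition meager :: "'x topology \<Rightarrow> 'x set \<Rightarrow> bool" where
  "meager Tp A \<longleftrightarrow> A \<subseteq> topspace Tp \<and>
     (\<exists>N :: nat \<Rightarrow> 'x set. (\<forall>n. nowhere_dense Tp (N n)) \<and> A \<subseteq> (\<Union>n. N n))"

definition Baire_property :: "'x topology \<Rightarrow> 'x set \<Rightarrow> bool" where
  "Baire_property Tp A \<longleftrightarrow> A \<subseteq> topspace Tp \<and>
     (\<exists>G. openin Tp G \<and> meager Tp ((A - G) \<union> (G - A)))"

end

theory Submission
  imports Defs
begin

text \<open>
  A fat subtree \<open>V\<close> lies below \<open>U\<close> iff every entry of \<open>V\<close> fits into a segment of \<open>U\<close>. For a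
  fitting relation that is reflexive, transitive and has finitely many solutions, fusion is
  automatic, since subtrees are just sequences. A pigeonhole principle for single entries then
  yields the theorem by the usual accept/reject argument: open sets are Ramsey, closed sets with
  empty interior are Ramsey null, and a fusion handles countable unions.

  The pigeonhole principle is proved in the manner of the Carlson-Simpson theorem. A set of entries
  is large below \<open>U\<close> if it meets every subtree of \<open>U\<close>. A large set is syndetic, so entries are
  finitely coloured by the prefix that carries them into the set. By (M3) the letter standing at an
  earlier level can be repeated at any later one, so words over the earlier levels act on the tree,
  and the Hales-Jewett theorem, sharpened to a left-variable line with monochromatic prefix,
  provides a member of the set all of whose one-step extensions can be carried into the set. A
  further fusion keeps the set of these continuations large, and iteration gives a subtree all of
  whose entries lie in the set.
\<close>

section \<open>A left-variable Hales-Jewett theorem\<close>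

text \<open>An entry moves a whole level at once, so a one-step extension is a simultaneous choice
  of successors, one above each node, whereas the maps of (M3) repeat only what is already visible
  at one earlier level. The alphabet of the words is therefore a set of levels, not of labels. It
  has to be finite and fixed before the colouring is defined; for this an entry \<open>z\<close> is
  taken whose values already display, at levels below their own, every choice that can occur above
  it. The variable has to come directly after the constant prefix because the step made there is the
  arbitrary one-step extension. The later occurrences of the variable can then refer to the level of
  that step, which is the same for all extensions, and a single continuation serves them all. At
  level 0 there is no earlier level to copy from. If no admissible map moves level \<open>n\<close>
  to level \<open>n + 1\<close>, the only entry at \<open>n\<close> is the identity and the
  pigeonhole principle is trivial; otherwise such a map replaces copying in the first step.\<close>

definition fill :: "nat \<Rightarrow> nat option list \<Rightarrow> nat list" where
  "fill a v = map (\<lambda>x. case x of None \<Rightarrow> a | Some b \<Rightarrow> b) v"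

definition words :: "nat \<Rightarrow> nat \<Rightarrow> nat list set" where
  "words k N = {w. set w \<subseteq> {..<k} \<and> length w = N}"

definition words_le :: "nat \<Rightarrow> nat \<Rightarrow> nat list set" where
  "words_le k N = {w. set w \<subseteq> {..<k} \<and> length w \<le> N}"

text \<open>Letters are numbers because they will be levels of the tree; \<open>None\<close> is the
  variable.\<close>

definition vletters :: "nat \<Rightarrow> nat option set" where
  "vletters k = insert None (Some ` {..<k})"

definition lines :: "nat \<Rightarrow> nat \<Rightarrow> nat option list set" where
  "lines k N = {v. set v \<subseteq> vletters k \<and> None \<in> set v \<and> length v = N}"

definition HJ :: "nat \<Rightarrow> nat \<Rightarrow> nat \<Rightarrow> bool" where
  "HJ k r N \<longleftrightarrow> (\<forall>col :: nat list \<Rightarrow> nat. (\<forall>w\<in>words k N. col w < r) \<longrightarrow>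
     (\<exists>v\<in>lines k N. \<forall>a<k. col (fill a v) = col (fill 0 v)))"

section \<open>Hales-Jewett by product colourings and colour focusing\<close>

lemma HJ_D: "HJ k r N \<Longrightarrow> (\<And>w. w \<in> words k N \<Longrightarrow> col w < r) \<Longrightarrow>
    \<exists>v\<in>lines k N. \<forall>a<k. col (fill a v) = col (fill 0 v)"
  by (simp add: HJ_def)

lemma fill_simps [simp]: "fill a [] = []" "fill a (v @ w) = fill a v @ fill a w"
  "fill a (None # v) = a # fill a v" "fill a (Some b # v) = b # fill a v" "fill a (map Some y) = y"
  "length (fill a v) = length v"
  by (simp_all add: fill_def comp_def)

lemma fill_letters: "set v \<subseteq> vletters k \<Longrightarrow> a < k \<Longrightarrow> set (fill a v) \<subseteq> {..<k}"
  by (auto simp: fill_def vletters_def)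

lemma fill_line_words: "v \<in> lines k N \<Longrightarrow> a < k \<Longrightarrow> fill a v \<in> words k N"
  using fill_letters[of v k a] by (auto simp: lines_def words_def)

lemma finite_words [simp]: "finite (words k N)" "finite (words_le k N)"
  using finite_lists_length_eq[of "{..<k}" N] finite_lists_length_le[of "{..<k}" N]
  by (simp_all add: words_def words_le_def)

lemma words_append:
  "w \<in> words k N \<Longrightarrow> y \<in> words k N' \<Longrightarrow> w @ y \<in> words k (N + N')"
  "w \<in> words k N \<Longrightarrow> y \<in> words_le k N' \<Longrightarrow> w @ y \<in> words_le k (N + N')"
  by (auto simp: words_def words_le_def)

text \<open>Only the number of colours that occur matters: numbering the image of the words reduces
  an arbitrary colour type to numbers below \<open>r\<close>.\<close>

lemma HJ_colouring:
  fixes col :: "nat list \<Rightarrow> 'c"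
  assumes "HJ k r N" and "card (col ` words k N) \<le> r" and "0 < k"
  shows "\<exists>v\<in>lines k N. \<forall>a<k. col (fill a v) = col (fill 0 v)"
proof -
  have "finite (col ` words k N)" by simp
  then obtain g where g: "bij_betw g (col ` words k N) {0..<card (col ` words k N)}"
    using ex_bij_betw_finite_nat by blast
  have "g (col w) < r" if "w \<in> words k N" for w
    using bij_betwE[OF g] assms(2) that by fastforce
  then have "\<exists>v\<in>lines k N. \<forall>a<k. g (col (fill a v)) = g (col (fill 0 v))"
    by (rule HJ_D[OF assms(1)])
  then obtain v where v: "v \<in> lines k N" and v2: "\<forall>a<k. g (col (fill a v)) = g (col (fill 0 v))" ..
  have "col (fill a v) = col (fill 0 v)" if "a < k" for a
    using v2[rule_format, OF that] fill_line_words[OF v that] fill_line_words[OF v assms(3)]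
    by (intro inj_onD[OF bij_betw_imp_inj_on[OF g]] imageI)
  with v show ?thesis by (intro bexI[of _ v] allI impI)
qed

text \<open>The product colouring sends \<open>w\<close> to the function \<open>col w\<close> on
  \<open>Y\<close>. There are at most \<open>card C ^ card Y\<close> such functions, and a line
  monochromatic for it works for all \<open>y\<close> at once.\<close>

lemma HJ_uniform:
  fixes col :: "nat list \<Rightarrow> nat list \<Rightarrow> 'c"
  assumes "HJ k (card C ^ card Y) N" "finite C" "finite Y" "0 < k"
    and "\<And>w y. w \<in> words k N \<Longrightarrow> y \<in> Y \<Longrightarrow> col w y \<in> C"
  shows "\<exists>v\<in>lines k N. \<forall>a<k. \<forall>y\<in>Y. col (fill a v) y = col (fill 0 v) y"
proof -
  let ?\<psi> = "\<lambda>w. restrict (col w) Y"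
  have img: "?\<psi> ` words k N \<subseteq> Y \<rightarrow>\<^sub>E C" using assms(5) by auto
  have "finite (Y \<rightarrow>\<^sub>E C)" by (rule finite_PiE[OF assms(3)]) (rule assms(2))
  from card_mono[OF this img] have "card (?\<psi> ` words k N) \<le> card (Y \<rightarrow>\<^sub>E C)" .
  also have "\<dots> = card C ^ card Y" using assms(3) by (simp add: card_PiE)
  finally have "\<exists>v\<in>lines k N. \<forall>a<k. ?\<psi> (fill a v) = ?\<psi> (fill 0 v)"
    by (rule HJ_colouring[OF assms(1) _ assms(4)])
  then obtain v where v: "v \<in> lines k N" "\<forall>a<k. ?\<psi> (fill a v) = ?\<psi> (fill 0 v)" ..
  have "col (fill a v) y = col (fill 0 v) y" if "a < k" "y \<in> Y" for a y
    using fun_cong[OF v(2)[rule_format, OF that(1)], of y] that(2) by (simp only: restrict_apply if_True)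
  with v(1) show ?thesis by (intro bexI[of _ v] allI impI ballI)
qed

text \<open>Colour focusing: \<open>s\<close> lines with a common last point \<open>f\<close> whose remaining points are monochromatic
  in pairwise distinct colours. Once \<open>s\<close> is the number of colours, the colour of \<open>f\<close> completes one
  of them.\<close>

abbreviation focused :: "nat \<Rightarrow> nat \<Rightarrow> nat \<Rightarrow> nat \<Rightarrow> (nat list \<Rightarrow> nat) \<Rightarrow> bool" where
  "focused k r s N col \<equiv> \<exists>f\<in>words (Suc k) N. \<exists>C\<subseteq>{..<r}. card C = s \<and>
     (\<forall>c\<in>C. \<exists>v\<in>lines (Suc k) N. fill k v = f \<and> (\<forall>a<k. col (fill a v) = c))"

text \<open>Induction on \<open>s\<close>. The theorem for \<open>k\<close> letters provides a
  second block whose line \<open>L\<close> has a colour independent of the letters below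
  \<open>k\<close>, whatever the first block is. With the second block fixed at
  \<open>fill 0 L\<close>, the induction hypothesis gives \<open>s\<close> focused lines in the
  first block, and the colour of their focus is either an old one or a new one.\<close>

lemma HJ_focusing:
  assumes HJk: "\<And>r. \<exists>N. HJ k r N" and k: "0 < k"
  shows "\<exists>N. \<forall>col :: nat list \<Rightarrow> nat. (\<forall>w\<in>words (Suc k) N. col w < r) \<longrightarrow>
    (\<exists>v\<in>lines (Suc k) N. \<forall>a<Suc k. col (fill a v) = col (fill 0 v)) \<or>
    (focused k r s N col)"
proof (induction s)
  case 0
  show ?case
  proof (rule exI[of _ 0], intro allI impI disjI2)
    fix col :: "nat list \<Rightarrow> nat"
    show "focused k r 0 0 col"
      by (intro bexI[of _ "[]"] exI[of _ "{}"]) (simp_all add: words_def)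
  qed
next
  case (Suc s)
  then obtain N1 where N1: "\<forall>col :: nat list \<Rightarrow> nat. (\<forall>w\<in>words (Suc k) N1. col w < r) \<longrightarrow>
    (\<exists>v\<in>lines (Suc k) N1. \<forall>a<Suc k. col (fill a v) = col (fill 0 v)) \<or>
    (focused k r s N1 col)" ..
  obtain N2 where N2: "HJ k (card {..<r} ^ card (words (Suc k) N1)) N2" using HJk by blast
  show ?case
  proof (rule exI[of _ "N1 + N2"], intro allI impI)
    fix col :: "nat list \<Rightarrow> nat"
    assume chi: "\<forall>w\<in>words (Suc k) (N1 + N2). col w < r"
    have "\<exists>L\<in>lines k N2. \<forall>a<k. \<forall>y\<in>words (Suc k) N1. col (y @ fill a L) = col (y @ fill 0 L)"
    proof (rule HJ_uniform[OF N2 _ _ k, of "\<lambda>w y. col (y @ w)"])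
      fix w y assume w: "w \<in> words k N2" and y: "y \<in> words (Suc k) N1"
      from w have "w \<in> words (Suc k) N2" by (auto simp: words_def)
      from words_append(1)[OF y this] show "col (y @ w) \<in> {..<r}" using chi by simp
    qed simp_all
    then obtain L where L: "L \<in> lines k N2"
      and Lc: "\<forall>a<k. \<forall>y\<in>words (Suc k) N1. col (y @ fill a L) = col (y @ fill 0 L)" ..
    have L': "L \<in> lines (Suc k) N2" using L by (auto simp: lines_def vletters_def)
    have sL: "fill a L \<in> words (Suc k) N2" if "a \<le> k" for a
      using fill_line_words[OF L'] that by simp
    let ?col = "\<lambda>y. col (y @ fill 0 L)"
    let ?line = "\<exists>v\<in>lines (Suc k) (N1 + N2). \<forall>a<Suc k. col (fill a v) = col (fill 0 v)"
    have mono: ?line if "v \<in> lines (Suc k) N1" "\<forall>a<Suc k. ?col (fill a v) = ?col (fill 0 v)" for v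
    proof (rule bexI[of _ "v @ map Some (fill 0 L)"])
      show "\<forall>a<Suc k. col (fill a (v @ map Some (fill 0 L))) = col (fill 0 (v @ map Some (fill 0 L)))"
        unfolding fill_simps by (rule that(2))
      show "v @ map Some (fill 0 L) \<in> lines (Suc k) (N1 + N2)"
        using that(1) sL[of 0] by (auto simp: lines_def words_def vletters_def)
    qed
    have "\<forall>w\<in>words (Suc k) N1. ?col w < r"
      using chi sL[of 0] by (auto simp: words_def)
    from N1[THEN spec, THEN mp, OF this] show "?line \<or> (focused k r (Suc s) (N1 + N2) col)"
    proof (elim disjE bexE exE conjE)
      fix v assume "v \<in> lines (Suc k) N1" "\<forall>a<Suc k. ?col (fill a v) = ?col (fill 0 v)"
      then show ?thesis using mono by blast
    next
      fix f C assume f: "f \<in> words (Suc k) N1" and C: "C \<subseteq> {..<r}" "card C = s"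
        and foc: "\<forall>c\<in>C. \<exists>v\<in>lines (Suc k) N1. fill k v = f \<and> (\<forall>a<k. ?col (fill a v) = c)"
      show ?thesis
      proof (cases "?col f \<in> C")
        case True
        with foc obtain v where v: "v \<in> lines (Suc k) N1" "fill k v = f" "\<forall>a<k. ?col (fill a v) = ?col f"
          by blast
        then have "\<forall>a<Suc k. ?col (fill a v) = ?col (fill 0 v)" using k by (auto simp: less_Suc_eq)
        with mono v(1) show ?thesis by blast
      next
        case False
        have fin: "finite C" using C(1) finite_subset by blast
        \<comment> \<open>Old lines are prolonged by \<open>L\<close>; the new colour belongs to the
          line that keeps \<open>f\<close> constant and varies in \<open>L\<close> alone. With the
          last letter they all meet in \<open>f @ fill k L\<close>.\<close>
        have "\<exists>v\<in>lines (Suc k) (N1 + N2). fill k v = f @ fill k L \<and> (\<forall>a<k. col (fill a v) = c)"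
          if c: "c \<in> insert (?col f) C" for c
        proof (cases "c \<in> C")
          case True
          with foc obtain v where v: "v \<in> lines (Suc k) N1" "fill k v = f" "\<forall>a<k. ?col (fill a v) = c"
            by blast
          have "v @ L \<in> lines (Suc k) (N1 + N2)" using v(1) L' by (auto simp: lines_def)
          moreover have "col (fill a (v @ L)) = c" if "a < k" for a

            using Lc[rule_format, OF that, of "fill a v"] fill_line_words[OF v(1), of a] v(3) that by simp
          ultimately show ?thesis using v(2) by (intro bexI[of _ "v @ L"]) auto
        next
          case False
          then have c': "c = ?col f" using c by simp
          show ?thesis
          proof (intro bexI[of _ "map Some f @ L"] conjI allI impI)
            fix a assume "a < k"
            then show "col (fill a (map Some f @ L)) = c"
              unfolding fill_simps c' using Lc f by blast
          qed (use f L' in \<open>auto simp: lines_def words_def vletters_def\<close>)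
        qed
        moreover have "f @ fill k L \<in> words (Suc k) (N1 + N2)" using f sL[of k] by (auto simp: words_def)
        moreover have "insert (?col f) C \<subseteq> {..<r}"
          using C(1) f sL[of 0] chi by (auto simp: words_def)
        moreover have "card (insert (?col f) C) = Suc s" using False fin C(2) by simp
        ultimately show ?thesis by blast
      qed
    qed
  qed
qed

theorem Hales_Jewett: "0 < k \<Longrightarrow> \<exists>N. HJ k r N"
proof (induction k arbitrary: r rule: nat_induct_non_zero)
  case 1
  show ?case
    by (rule exI[of _ 1]) (auto simp: HJ_def lines_def vletters_def intro!: exI[of _ "[None]"])
next
  case (Suc k)
  obtain N where N: "\<forall>col :: nat list \<Rightarrow> nat. (\<forall>w\<in>words (Suc k) N. col w < r) \<longrightarrow>
    (\<exists>v\<in>lines (Suc k) N. \<forall>a<Suc k. col (fill a v) = col (fill 0 v)) \<or>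
    (focused k r r N col)"
    using HJ_focusing[OF Suc.IH Suc.hyps] ..
  have "HJ (Suc k) r N"
    unfolding HJ_def
  proof (intro allI impI)
    fix col :: "nat list \<Rightarrow> nat" assume chi: "\<forall>w\<in>words (Suc k) N. col w < r"
    from N[THEN spec, THEN mp, OF chi] show "\<exists>v\<in>lines (Suc k) N. \<forall>a<Suc k. col (fill a v) = col (fill 0 v)"
    proof (elim disjE bexE exE conjE)
      fix f C assume f: "f \<in> words (Suc k) N" and C: "C \<subseteq> {..<r}" "card C = r"
        and foc: "\<forall>c\<in>C. \<exists>v\<in>lines (Suc k) N. fill k v = f \<and> (\<forall>a<k. col (fill a v) = c)"
      have "C = {..<r}" using C by (intro card_subset_eq) auto
      then obtain v where "v \<in> lines (Suc k) N" "fill k v = f" "\<forall>a<k. col (fill a v) = col f"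
        using foc chi f by blast
      then show ?thesis using Suc.hyps by (auto simp: less_Suc_eq intro!: bexI[of _ v])
    qed blast
  qed
  then show ?case by blast
qed

text \<open>By Hales-Jewett there is a line whose colour, also after appending any short word, does not
  depend on the letter. Either the colour of its constant prefix reoccurs after appending a short
  word, or that colour is lost and the number of colours drops.\<close>

lemma left_line_bounded:
  assumes k: "0 < k"
  shows "\<exists>N. \<forall>col :: nat list \<Rightarrow> 'c. card (col ` words_le k N) \<le> r \<longrightarrow>
    (\<exists>w v. set w \<subseteq> {..<k} \<and> set v \<subseteq> vletters k \<and> length w + length v < N \<and>
       (\<forall>a<k. col (w @ a # fill a v) = col w))"
proof (induction r)
  case 0
  have "card (col ` words_le k 1) > 0" for col :: "nat list \<Rightarrow> 'c"
  proof -
    have "[] \<in> words_le k 1" by (simp add: words_le_def)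
    then show ?thesis by (auto simp: card_gt_0_iff)
  qed
  then show ?case by (intro exI[of _ 1] allI impI) (metis not_le)
next
  case (Suc r)
  then obtain N1 where N1: "\<And>col :: nat list \<Rightarrow> 'c. card (col ` words_le k N1) \<le> r \<Longrightarrow>
    \<exists>w v. set w \<subseteq> {..<k} \<and> set v \<subseteq> vletters k \<and> length w + length v < N1 \<and>
       (\<forall>a<k. col (w @ a # fill a v) = col w)" by metis
  obtain N2 where N2: "HJ k (Suc r ^ card (words_le k N1)) N2" using Hales_Jewett[OF k] by blast
  show ?case
  proof (rule exI[of _ "N2 + N1"], intro allI impI)
    fix col :: "nat list \<Rightarrow> 'c"
    let ?C = "col ` words_le k (N2 + N1)" let ?Y = "words_le k N1"
    assume card: "card ?C \<le> Suc r"
    \<comment> \<open>\<open>N2\<close> was fixed for \<open>Suc r\<close> colours before the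
      colouring was known; fewer may occur, and \<open>HJ\<close> is inherited by fewer
      colours.\<close>
    have "HJ k (card ?C ^ card ?Y) N2"
      unfolding HJ_def
    proof (intro allI impI)
      fix \<psi> :: "nat list \<Rightarrow> nat" assume less: "\<forall>w\<in>words k N2. \<psi> w < card ?C ^ card ?Y"
      have "card ?C ^ card ?Y \<le> Suc r ^ card ?Y" using card by (rule power_mono) simp
      then have "\<psi> w < Suc r ^ card ?Y" if "w \<in> words k N2" for w
        using less that by (meson order_less_le_trans)
      then show "\<exists>v\<in>lines k N2. \<forall>a<k. \<psi> (fill a v) = \<psi> (fill 0 v)" by (rule HJ_D[OF N2])
    qed
    then have "\<exists>L\<in>lines k N2. \<forall>a<k. \<forall>z\<in>?Y. col (fill a L @ z) = col (fill 0 L @ z)"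
    proof (rule HJ_uniform[OF _ _ _ k, of _ _ _ "\<lambda>w z. col (w @ z)"])
      fix w y assume "w \<in> words k N2" "y \<in> ?Y"
      then show "col (w @ y) \<in> ?C" by (intro imageI words_append)
    qed simp_all
    then obtain L where L: "L \<in> lines k N2"
      and Lc: "\<forall>a<k. \<forall>z\<in>?Y. col (fill a L @ z) = col (fill 0 L @ z)" ..
    have "None \<in> set L" using L by (simp add: lines_def)
    then obtain y0 L' where sp: "L = y0 @ None # L'" "None \<notin> set y0" by (meson split_list_first)
    define y where "y = map the y0"
    have y0: "y0 = map Some y" unfolding y_def map_map using sp(2) by (intro map_idI[symmetric]) (metis comp_apply option.collapse)
    have yL: "set y \<subseteq> {..<k}" "set L' \<subseteq> vletters k" "length y + length L' < N2"
      using L by (auto simp: sp(1) y0 lines_def vletters_def)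
    show "\<exists>w v. set w \<subseteq> {..<k} \<and> set v \<subseteq> vletters k \<and> length w + length v < N2 + N1 \<and>
       (\<forall>a<k. col (w @ a # fill a v) = col w)"
    proof (cases "\<exists>z\<in>?Y. col (fill 0 L @ z) = col y")
      case True
      then obtain z where z: "z \<in> ?Y" "col (fill 0 L @ z) = col y" by blast
      \<comment> \<open>Since \<open>L\<close> was cut at its first variable,
        \<open>y @ a # fill a L'\<close> is \<open>fill a L\<close>, so appending \<open>z\<close>
        restores the colour of the prefix for every letter.\<close>
      have "col (y @ a # fill a (L' @ map Some z)) = col y" if "a < k" for a
        using Lc[rule_format, OF that z(1)] z(2) by (simp add: sp(1) y0)
      moreover have "set (L' @ map Some z) \<subseteq> vletters k"
        using yL z(1) by (auto simp: words_le_def vletters_def)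
      moreover have "length y + length (L' @ map Some z) < N2 + N1"
        using yL z(1) by (auto simp: words_le_def)
      ultimately show ?thesis using yL(1) by blast
    next
      case False
      let ?col = "\<lambda>z. col (fill 0 L @ z)"
      have sub: "fill 0 L \<in> words k N2" using fill_line_words[OF L k] .
      have "?col ` ?Y \<subseteq> ?C - {col y}"
        by (use words_append(2)[OF sub] False in auto)
      then have "card (?col ` ?Y) \<le> card (?C - {col y})" by (intro card_mono) auto
      also have "y \<in> words_le k (N2 + N1)" using yL by (simp add: words_le_def)
      then have "card (?C - {col y}) < card ?C" by (intro psubset_card_mono) auto
      finally have "card (?col ` ?Y) \<le> r" using card by simp
      from N1[OF this] obtain w v where "set w \<subseteq> {..<k}" "set v \<subseteq> vletters k"
        "length w + length v < N1" "\<forall>a<k. ?col (w @ a # fill a v) = ?col w" by blast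
      with sub show ?thesis by (intro exI[of _ "fill 0 L @ w"] exI[of _ v]) (auto simp: words_def)
    qed
  qed
qed

theorem left_variable_line:
  fixes col :: "nat list \<Rightarrow> 'c"
  assumes "0 < k" "finite (col ` {w. set w \<subseteq> {..<k}})"
  obtains w v where "set w \<subseteq> {..<k}" "set v \<subseteq> vletters k" "\<And>a. a < k \<Longrightarrow> col (w @ a # fill a v) = col w"
proof -
  obtain N where N: "card (col ` words_le k N) \<le> card (col ` {w. set w \<subseteq> {..<k}}) \<Longrightarrow>
    \<exists>w v. set w \<subseteq> {..<k} \<and> set v \<subseteq> vletters k \<and> (\<forall>a<k. col (w @ a # fill a v) = col w)"
    using left_line_bounded[OF assms(1), where 'c='c] by metis
  have "card (col ` words_le k N) \<le> card (col ` {w. set w \<subseteq> {..<k}})"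
    by (rule card_mono[OF assms(2)]) (auto simp: words_le_def)
  with N that show thesis by blast
qed

section \<open>Fusion\<close>

definition seg :: "(nat \<Rightarrow> 'u) \<Rightarrow> nat \<Rightarrow> nat \<Rightarrow> 'u list" where
  "seg U k k' = map U [k..<k']"

definition shift :: "(nat \<Rightarrow> 'u) \<Rightarrow> nat \<Rightarrow> nat \<Rightarrow> 'u" where
  "shift U k = (\<lambda>i. U (k + i))"

definition app :: "'u list \<Rightarrow> (nat \<Rightarrow> 'u) \<Rightarrow> nat \<Rightarrow> 'u" where
  "app x V = (\<lambda>i. if i < length x then x ! i else V (i - length x))"

lemma seg_simps [simp]: "seg U k k = []" "length (seg U k k') = k' - k"
  "seg (shift U k) i j = seg U (k + i) (k + j)"
proof -
  have "[k + i..<k + j] = map ((+) k) [i..<j]"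
    by (induction j) (auto simp: add.commute)
  then show "seg (shift U k) i j = seg U (k + i) (k + j)"
    by (simp add: seg_def shift_def comp_def)
qed (simp_all add: seg_def)

lemma seg_Suc: "k \<le> k' \<Longrightarrow> seg U k (Suc k') = seg U k k' @ [U k']"
  by (simp add: seg_def)

lemma seg_append: "i \<le> j \<Longrightarrow> j \<le> k \<Longrightarrow> seg U i j @ seg U j k = seg U i k"
  by (metis map_append seg_def upt_add_eq_append le_add_diff_inverse)

lemma seg_eq_append:
  assumes "seg U 0 k = a @ b"
  shows "a = seg U 0 (length a)" "b = seg U (length a) k" "length a \<le> k"
proof -
  have le: "length a \<le> k" using arg_cong[OF assms, of length] by simp
  then have "a @ b = seg U 0 (length a) @ seg U (length a) k"
    using assms seg_append[of 0 "length a" k U] by simp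
  then show "a = seg U 0 (length a)" "b = seg U (length a) k" by (simp_all add: append_eq_append_conv)
  show "length a \<le> k" by (rule le)
qed

lemma shift_simps [simp]: "shift U 0 = U" "shift (shift U i) j = shift U (i + j)"
  by (simp_all add: shift_def add.assoc)

lemma shift_apply: "shift U k i = U (k + i)"
  by (simp add: shift_def)

lemma app_simps [simp]: "app [] V = V" "app (x @ y) V = app x (app y V)"
  "app (u # x) V 0 = u" "shift (app x V) (length x) = V" "seg (app x V) 0 (length x) = x"
proof -
  show "app (x @ y) V = app x (app y V)"
    by (rule ext) (auto simp: app_def nth_append)
  show "seg (app x V) 0 (length x) = x"
    by (rule nth_equalityI) (auto simp: seg_def app_def)
qed (auto simp: app_def shift_def)

lemma app_nth: "i < length x \<Longrightarrow> app x V i = x ! i"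
  by (simp add: app_def)

lemma shift_app_Cons: "shift (app (u # x) V) (Suc 0) = app x V"
  by (rule ext) (auto simp: app_def shift_def)

lemma app_seg [simp]: "app (seg U 0 k) (shift U k) = U"
  by (rule ext) (auto simp: app_def seg_def shift_def)

section \<open>Sequences of entries and their cut levels\<close>

locale step_system =
  fixes A :: "nat \<Rightarrow> 'u set" and E :: "nat \<Rightarrow> 'u \<Rightarrow> nat"
  assumes E_gt: "u \<in> A n \<Longrightarrow> n < E n u"
begin

fun endl :: "nat \<Rightarrow> 'u list \<Rightarrow> nat" where
  "endl n [] = n"
| "endl n (u # us) = endl (E n u) us"

fun chain :: "nat \<Rightarrow> 'u list \<Rightarrow> bool" where
  "chain n [] = True"
| "chain n (u # us) \<longleftrightarrow> u \<in> A n \<and> chain (E n u) us"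

primrec cut :: "nat \<Rightarrow> (nat \<Rightarrow> 'u) \<Rightarrow> nat \<Rightarrow> nat" where
  "cut n U 0 = n"
| "cut n U (Suc k) = E (cut n U k) (U k)"

text \<open>The starting level is a parameter because a tail is treated as a sequence in its own
  right, starting at the cut level reached.\<close>

definition R :: "nat \<Rightarrow> (nat \<Rightarrow> 'u) set" where
  "R n = {U. \<forall>k. U k \<in> A (cut n U k)}"

lemma endl_append [simp]: "endl n (us @ vs) = endl (endl n us) vs"
  by (induction us arbitrary: n) auto

lemma chain_append [simp]: "chain n (us @ vs) \<longleftrightarrow> chain n us \<and> chain (endl n us) vs"
  by (induction us arbitrary: n) auto

lemma endl_ge: "chain n us \<Longrightarrow> n \<le> endl n us"
proof (induction us arbitrary: n)
  case (Cons u us)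
  from Cons.prems have "n < E n u" "E n u \<le> endl (E n u) us" using E_gt Cons.IH by auto
  then show ?case by simp
qed simp

lemma endl_gt: "chain n us \<Longrightarrow> us \<noteq> [] \<Longrightarrow> n < endl n us"
  using order_less_le_trans[OF E_gt endl_ge] by (cases us) auto

lemma R_A: "U \<in> R n \<Longrightarrow> U k \<in> A (cut n U k)"
  by (simp add: R_def)

lemma cut_seg:
  assumes "U \<in> R n" "k \<le> k'"
  shows "endl (cut n U k) (seg U k k') = cut n U k'" "chain (cut n U k) (seg U k k')"
  using assms(2) by (induction k' rule: dec_induct) (auto simp: seg_Suc R_A[OF assms(1)])

lemma cut_less: "U \<in> R n \<Longrightarrow> k < k' \<Longrightarrow> cut n U k < cut n U k'"
  using cut_seg[of U n k k'] endl_gt[of "cut n U k" "seg U k k'"] by (auto simp: seg_def)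

lemma cut_le: "U \<in> R n \<Longrightarrow> k \<le> k' \<Longrightarrow> cut n U k \<le> cut n U k'"
  using cut_less[of U n k k'] by (cases "k = k'") auto

lemma cut_inj: "U \<in> R n \<Longrightarrow> cut n U k = cut n U k' \<longleftrightarrow> k = k'"
  by (metis cut_less less_irrefl nat_neq_iff)

lemma cut_le_iff: "U \<in> R n \<Longrightarrow> cut n U k \<le> cut n U k' \<longleftrightarrow> k \<le> k'"
  by (metis cut_le cut_less leD not_le_imp_less)

lemma cut_shift [simp]: "cut (cut n U k) (shift U k) i = cut n U (k + i)"
  by (induction i) (auto simp: shift_apply)

lemma shift_R: "U \<in> R n \<Longrightarrow> shift U k \<in> R (cut n U k)"
  by (simp add: R_def shift_apply)

lemma R_Suc: "U \<in> R n \<longleftrightarrow> U 0 \<in> A n \<and> shift U (Suc 0) \<in> R (E n (U 0))"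
proof
  assume "U 0 \<in> A n \<and> shift U (Suc 0) \<in> R (E n (U 0))"
  then have "U k \<in> A (cut n U k)" for k
    using R_A[of "shift U (Suc 0)" "E n (U 0)" "k - 1"] cut_shift[of n U "Suc 0" "k - 1"]
    by (cases k) (auto simp: shift_apply)
  then show "U \<in> R n" by (simp add: R_def)
next
  assume "U \<in> R n"
  then show "U 0 \<in> A n \<and> shift U (Suc 0) \<in> R (E n (U 0))"
    using R_A[of U n 0] shift_R[of U n "Suc 0"] by simp
qed

lemma app_R: "chain n x \<Longrightarrow> W \<in> R (endl n x) \<Longrightarrow> app x W \<in> R n"
  by (induction x arbitrary: n) (auto simp: R_Suc[of "app (_ # _) W"] shift_app_Cons)

lemma cut_app:
  assumes "chain n x" "W \<in> R (endl n x)"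
  shows "cut n (app x W) (length x) = endl n x"
  using cut_seg(1)[OF app_R[OF assms], of 0 "length x"] by simp

end

section \<open>The fitting relation and the order it induces\<close>

locale fit_system = step_system A E for A :: "nat \<Rightarrow> 'u set" and E +
  fixes fit :: "nat \<Rightarrow> 'u list \<Rightarrow> 'u \<Rightarrow> bool"
begin

fun fits :: "nat \<Rightarrow> 'u list \<Rightarrow> 'u list \<Rightarrow> bool" where
  "fits n [] us \<longleftrightarrow> us = []"
| "fits n (v # vs) us \<longleftrightarrow> (\<exists>us1 us2. us = us1 @ us2 \<and> fit n us1 v \<and> fits (E n v) vs us2)"

text \<open>Entries are compared one at a time. That the segments are adjacent follows from
  injectivity of the cuts, see \<open>sub_fits\<close>; this entrywise form is what makes limits of
  fusions easy.\<close>

definition sub :: "nat \<Rightarrow> (nat \<Rightarrow> 'u) \<Rightarrow> (nat \<Rightarrow> 'u) \<Rightarrow> bool" where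
  "sub n V U \<longleftrightarrow> V \<in> R n \<and> U \<in> R n \<and>
     (\<forall>l. \<exists>k k'. cut n U k = cut n V l \<and> fit (cut n V l) (seg U k k') (V l))"

text \<open>The possible first entries of sequences below \<open>U\<close>, i.e. the objects
  coloured by the pigeonhole principle.\<close>

definition op :: "nat \<Rightarrow> (nat \<Rightarrow> 'u) \<Rightarrow> 'u set" where
  "op n U = {e. \<exists>k. fit n (seg U 0 k) e}"

end

locale fit_space = fit_system A E fit for A :: "nat \<Rightarrow> 'u set" and E fit +
  assumes fit_A: "fit n us u \<Longrightarrow> u \<in> A n"
    and fit_end: "fit n us u \<Longrightarrow> E n u = endl n us"
    and fit_refl: "u \<in> A n \<Longrightarrow> fit n [u] u"
    and fit_trans: "chain n us \<Longrightarrow> fits n vs us \<Longrightarrow> fit n vs u \<Longrightarrow> fit n us u"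
    and fit_finite: "chain n us \<Longrightarrow> finite {u. fit n us u}"
begin

lemma fit_Nil: "\<not> fit n [] u"
  using fit_A fit_end E_gt by fastforce

lemma fit_seg_less: "fit n (seg U k k') u \<Longrightarrow> k < k'"
  using fit_Nil by (cases "k < k'") (auto simp: seg_def)

lemma fits_end: "fits n vs us \<Longrightarrow> endl n vs = endl n us"
proof (induction vs arbitrary: n us)
  case (Cons v vs)
  then obtain us1 us2 where "us = us1 @ us2" "fit n us1 v" "fits (E n v) vs us2" by auto
  with Cons.IH fit_end show ?case by fastforce
qed simp

lemma fits_chain: "fits n vs us \<Longrightarrow> chain n vs"
proof (induction vs arbitrary: n us)
  case (Cons v vs)
  then obtain us1 us2 where "us = us1 @ us2" "fit n us1 v" "fits (E n v) vs us2" by auto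
  with Cons.IH fit_A show ?case by auto
qed simp

lemma fits_append:
  "fits n vs us \<Longrightarrow> fits (endl n vs) vs' us' \<Longrightarrow> fits n (vs @ vs') (us @ us')"
proof (induction vs arbitrary: n us)
  case (Cons v vs)
  then obtain us1 us2 where "us = us1 @ us2" "fit n us1 v" "fits (E n v) vs us2" by auto
  moreover have "fits (E n v) (vs @ vs') (us2 @ us')" using Cons calculation by auto
  ultimately show ?case by (simp, intro exI[of _ us1] exI[of _ "us2 @ us'"]) simp
qed simp

lemma fits_single [simp]: "fits n [v] us \<longleftrightarrow> fit n us v"
  by auto

lemma fits_split:
  "fits n (a @ b) us \<Longrightarrow> \<exists>us1 us2. us = us1 @ us2 \<and> fits n a us1 \<and> fits (endl n a) b us2"
proof (induction a arbitrary: n us)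
  case (Cons v a)
  then obtain us1 us2 where 1: "us = us1 @ us2" "fit n us1 v" "fits (E n v) (a @ b) us2" by auto
  with Cons.IH obtain us3 us4 where "us2 = us3 @ us4" "fits (E n v) a us3" "fits (endl (E n v) a) b us4"
    by blast
  with 1 show ?case by (intro exI[of _ "us1 @ us3"] exI[of _ us4]) auto
qed auto

lemma fits_refl: "chain n us \<Longrightarrow> fits n us us"
proof (induction us arbitrary: n)
  case (Cons u us)
  then have "fit n [u] u" "fits (E n u) us us" using fit_refl by auto
  then show ?case by (simp, intro exI[of _ "[u]"] exI[of _ us]) simp
qed simp

lemma fits_trans: "chain n us \<Longrightarrow> fits n vs us \<Longrightarrow> fits n ws vs \<Longrightarrow> fits n ws us"
proof (induction ws arbitrary: n us vs)
  case (Cons w ws)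
  then obtain vs1 vs2 where vs: "vs = vs1 @ vs2" "fit n vs1 w" "fits (E n w) ws vs2" by auto
  with Cons.prems fits_split obtain us1 us2 where us: "us = us1 @ us2" "fits n vs1 us1"
    "fits (endl n vs1) vs2 us2" by blast
  have ch: "chain n us1" "chain (endl n us1) us2" using Cons.prems us by auto
  have e: "endl n us1 = endl n vs1" "E n w = endl n vs1" using fits_end us(2) fit_end vs(2) by auto
  have "fits (E n w) ws us2" using Cons.IH[of "E n w" us2 vs2] ch us vs e by simp
  then show ?case using fit_trans[OF ch(1) us(2) vs(2)] us(1) by auto
qed auto

text \<open>A fitted entry uses up a nonempty block by \<open>fit_Nil\<close>, so the remaining
  entries are fitted into a strictly shorter list.\<close>

lemma fits_finite: "chain n us \<Longrightarrow> finite {vs. fits n vs us}"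
proof (induction "length us" arbitrary: n us rule: less_induct)
  case less
  let ?F = "\<lambda>i. {v. fit n (take i us) v}"
  have "{vs. fits n vs us} \<subseteq> {[]} \<union> (\<Union>i\<in>{1..length us}. \<Union>v\<in>?F i. (#) v ` {vs. fits (E n v) vs (drop i us)})"
  proof
    fix vs assume "vs \<in> {vs. fits n vs us}"
    then have vs: "fits n vs us" by simp
    show "vs \<in> {[]} \<union> (\<Union>i\<in>{1..length us}. \<Union>v\<in>?F i. (#) v ` {vs. fits (E n v) vs (drop i us)})"
    proof (cases vs)
      case (Cons v vs')
      with vs obtain us1 us2 where us: "us = us1 @ us2" "fit n us1 v" "fits (E n v) vs' us2" by auto
      have "us1 \<noteq> []" using us(2) fit_Nil by auto
      then have "length us1 \<in> {1..length us}" using us(1) by (cases us1) auto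
      moreover have "v \<in> ?F (length us1)" "vs' \<in> {vs. fits (E n v) vs (drop (length us1) us)}"
        using us by auto
      ultimately show ?thesis unfolding Cons by blast
    qed simp
  qed
  moreover have "finite \<dots>"
  proof (intro finite_UnI finite_UN_I finite_imageI)
    fix i v assume i: "i \<in> {1..length us}" and v: "v \<in> ?F i"
    have ch: "chain n (take i us @ drop i us)" using less.prems by simp
    then have "chain n (take i us)" "chain (endl n (take i us)) (drop i us)"
      unfolding chain_append by auto
    moreover have "E n v = endl n (take i us)" using v fit_end by simp
    ultimately show "finite {vs. fits (E n v) vs (drop i us)}" using i by (intro less.hyps) auto
  next
    fix i
    have "chain n (take i us @ drop i us)" using less.prems by simp
    then have "chain n (take i us)" unfolding chain_append by auto
    then show "finite (?F i)" by (rule fit_finite)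
  qed auto
  ultimately show ?case by (rule finite_subset)
qed

lemma sub_R: "sub n V U \<Longrightarrow> V \<in> R n" "sub n V U \<Longrightarrow> U \<in> R n"
  by (simp_all add: sub_def)

lemma sub_refl: "U \<in> R n \<Longrightarrow> sub n U U"
proof -
  assume U: "U \<in> R n"
  have "fit (cut n U l) (seg U l (Suc l)) (U l)" for l
    using fit_refl[OF R_A[OF U, of l]] by (simp add: seg_def)
  then show ?thesis using U unfolding sub_def by blast
qed

text \<open>The segment for \<open>V j\<close> starts at the cut level reached so far, hence by
  \<open>cut_inj\<close> exactly where the previous one ended; by \<open>fit_end\<close> it ends at
  the next cut level of \<open>V\<close>.\<close>

lemma sub_fits:
  assumes "sub n V U"
  shows "\<exists>k. cut n U k = cut n V j \<and> fits n (seg V 0 j) (seg U 0 k)"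
proof (induction j)
  case 0
  show ?case by (intro exI[of _ 0]) simp
next
  case (Suc j)
  note R = sub_R[OF assms]
  from Suc obtain k where k: "cut n U k = cut n V j" "fits n (seg V 0 j) (seg U 0 k)" by blast
  from assms obtain k1 k' where k': "cut n U k1 = cut n V j" "fit (cut n V j) (seg U k1 k') (V j)"
    unfolding sub_def by blast
  have "k1 = k" using k(1) k'(1) cut_inj[OF R(2)] by metis
  with k' have kk: "fit (cut n V j) (seg U k k') (V j)" "k < k'" using fit_seg_less by auto
  have "endl n (seg V 0 j) = cut n V j" using cut_seg(1)[OF R(1), of 0 j] by simp
  with kk fits_append[OF k(2), of "[V j]" "seg U k k'"]
  have "fits n (seg V 0 (Suc j)) (seg U 0 k')"
    by (simp add: seg_Suc seg_append)
  moreover have "cut n U k' = cut n V (Suc j)"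
    using fit_end[OF kk(1)] cut_seg(1)[OF R(2), of k k'] kk(2) k(1) by simp
  ultimately show ?case by blast
qed

lemma sub_shift:
  assumes "sub n V U" "cut n U k = cut n V j"
  shows "sub (cut n U k) (shift V j) (shift U k)"
  unfolding sub_def
proof (intro conjI allI)
  note R = sub_R[OF assms(1)]
  show "shift V j \<in> R (cut n U k)" "shift U k \<in> R (cut n U k)"
    using shift_R[OF R(1), of j] shift_R[OF R(2), of k] assms(2) by simp_all
  fix l
  from assms(1) obtain k1 k' where k1: "cut n U k1 = cut n V (j + l)"
    "fit (cut n V (j + l)) (seg U k1 k') (V (j + l))" unfolding sub_def by blast
  have "cut n U k \<le> cut n U k1" unfolding k1(1) assms(2) using cut_le[OF R(1)] by simp
  then have le: "k \<le> k1" using cut_le_iff[OF R(2)] by simp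
  have "k1 < k'" using k1(2) by (rule fit_seg_less)
  have c: "cut (cut n U k) (shift V j) l = cut n V (j + l)" unfolding assms(2) by simp
  show "\<exists>k1 k'. cut (cut n U k) (shift U k) k1 = cut (cut n U k) (shift V j) l \<and>
      fit (cut (cut n U k) (shift V j) l) (seg (shift U k) k1 k') (shift V j l)"
    unfolding c shift_apply[of V j l]
    by (rule exI[of _ "k1 - k"], rule exI[of _ "k' - k"]) (use k1 le \<open>k1 < k'\<close> in simp)
qed

lemma sub_trans:
  assumes "sub n V U" "sub n U W"
  shows "sub n V W"
  unfolding sub_def
proof (intro conjI allI)
  note R = sub_R[OF assms(1)] sub_R[OF assms(2)]
  show "V \<in> R n" "W \<in> R n" using R by auto
  fix l
  from assms(1) obtain k k' where k: "cut n U k = cut n V l" "fit (cut n V l) (seg U k k') (V l)"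
    unfolding sub_def by blast
  from sub_fits[OF assms(2), of k] obtain r where r: "cut n W r = cut n U k" by blast
  have kk: "k < k'" using k(2) by (rule fit_seg_less)
  from sub_fits[OF sub_shift[OF assms(2) r], of "k' - k"] obtain q where
    "fits (cut n W r) (seg (shift U k) 0 (k' - k)) (seg (shift W r) 0 q)" by blast
  then have f: "fits (cut n V l) (seg U k k') (seg W r (r + q))" using r k(1) kk by simp
  have "chain (cut n V l) (seg W r (r + q))" using cut_seg(2)[OF R(4), of r "r + q"] r k(1) by simp
  from fit_trans[OF this f k(2)]
  show "\<exists>k k'. cut n W k = cut n V l \<and> fit (cut n V l) (seg W k k') (V l)" using r k(1) by metis
qed

lemma sub_fit:
  assumes "sub n V U" "fit n (seg V 0 j) e"
  shows "\<exists>k. cut n U k = cut n V j \<and> fit n (seg U 0 k) e"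
proof -
  from sub_fits[OF assms(1), of j] obtain k where k: "cut n U k = cut n V j"
    "fits n (seg V 0 j) (seg U 0 k)" by blast
  have "chain n (seg U 0 k)" using cut_seg(2)[OF sub_R(2)[OF assms(1)], of 0 k] by simp
  with fit_trans[OF this k(2) assms(2)] k(1) show ?thesis by blast
qed

lemma fit_seg_cut: "U \<in> R n \<Longrightarrow> fit n (seg U 0 k) u \<Longrightarrow> cut n U k = E n u"
  using fit_end[of n "seg U 0 k" u] cut_seg(1)[of U n 0 k] by simp

lemma fits_seg_cut: "U \<in> R n \<Longrightarrow> fits n y (seg U 0 k) \<Longrightarrow> cut n U k = endl n y"
  using fits_end[of n y "seg U 0 k"] cut_seg(1)[of U n 0 k] by simp

lemma sub_uncons:
  assumes "sub n V U"
  shows "\<exists>k. fit n (seg U 0 k) (V 0) \<and> cut n U k = E n (V 0) \<and>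
    sub (cut n U k) (shift V (Suc 0)) (shift U k)"
proof -
  from sub_fits[OF assms, of "Suc 0"] obtain k where k: "cut n U k = cut n V (Suc 0)"
    "fits n (seg V 0 (Suc 0)) (seg U 0 k)" by blast
  then have "fit n (seg U 0 k) (V 0)" by (simp add: seg_Suc)
  with k sub_shift[OF assms k(1)] show ?thesis by auto
qed

lemma sub_Cons:
  assumes "fit n (seg U 0 k) u" "sub (cut n U k) (app x W) (shift U k)" "U \<in> R n"
  shows "sub n (app (u # x) W) U"
  unfolding sub_def
proof (intro conjI allI)
  let ?V = "app (u # x) W"
  have E: "cut n U k = E n u" using assms fit_seg_cut by blast
  have s: "shift ?V (Suc 0) = app x W" by (rule shift_app_Cons)
  show "?V \<in> R n" using sub_R(1)[OF assms(2)] fit_A[OF assms(1)] E by (simp add: R_Suc[of ?V] s)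
  show "U \<in> R n" by (rule assms)
  fix l
  show "\<exists>k k'. cut n U k = cut n ?V l \<and> fit (cut n ?V l) (seg U k k') (?V l)"
  proof (cases l)
    case 0
    with assms(1) show ?thesis by (intro exI[of _ 0] exI[of _ k]) simp
  next
    case (Suc j)
    have c: "cut n ?V l = cut (cut n U k) (app x W) j" "?V l = app x W j"
      using cut_shift[of n ?V "Suc 0" j] fun_cong[OF s, of j] shift_apply[of ?V "Suc 0" j]
      by (simp_all add: Suc E s del: cut_shift)
    from assms(2) obtain i i' where "cut (cut n U k) (shift U k) i = cut (cut n U k) (app x W) j"
      "fit (cut (cut n U k) (app x W) j) (seg (shift U k) i i') (app x W j)" unfolding sub_def by blast
    note i = this
    show ?thesis unfolding c
      by (rule exI[of _ "k + i"], rule exI[of _ "k + i'"]) (use i in simp)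
  qed
qed

lemma sub_app:
  "fits n y (seg U 0 k) \<Longrightarrow> sub (cut n U k) W (shift U k) \<Longrightarrow> U \<in> R n \<Longrightarrow> sub n (app y W) U"
proof (induction y arbitrary: n U k)
  case Nil
  then have "k = 0" by (simp add: seg_def)
  with Nil show ?case by simp
next
  case (Cons v vs)
  then obtain us1 us2 where us: "seg U 0 k = us1 @ us2" "fit n us1 v" "fits (E n v) vs us2" by auto
  define i where "i = length us1"
  have i: "us1 = seg U 0 i" "us2 = seg U i k" "i \<le> k" using seg_eq_append[OF us(1)] i_def by auto
  have c: "cut n U i = E n v" using us(2) i(1) Cons.prems(3) fit_seg_cut by blast
  have "sub (cut n U i) (app vs W) (shift U i)"
    using Cons.IH[of "cut n U i" "shift U i" "k - i"] us(3) i Cons.prems c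
      shift_R[OF Cons.prems(3), of i] cut_shift[of n U i "k - i"] by simp
  then show ?case using sub_Cons[of n U i v vs W] us(2) i(1) Cons.prems(3) by simp
qed

text \<open>Fusion: the members of the limit are taken from successively thinned sequences, so the limit
  is below each of them from the corresponding index on; no completeness assumption is needed.\<close>

lemma fusion:
  assumes init: "Q n0 s0 W0" "W0 \<in> R n0"
    and step: "\<And>n s W. Q n s W \<Longrightarrow> W \<in> R n \<Longrightarrow>
      \<exists>u k s' W'. fit n (seg W 0 k) u \<and> sub (cut n W k) W' (shift W k) \<and> Q (cut n W k) s' W' \<and> T n s u s'"
  shows "\<exists>U f. sub n0 U W0 \<and> f 0 = s0 \<and>
    (\<forall>k. T (cut n0 U k) (f k) (U k) (f (Suc k)) \<and>
      (\<exists>W. Q (cut n0 U k) (f k) W \<and> sub (cut n0 U k) (shift U k) W))"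
proof -
  \<comment> \<open>The clause for \<open>i = 0\<close> carries the given start through
    \<open>dependent_nat_choice\<close>, which otherwise leaves the first state unspecified.\<close>
  define P where "P = (\<lambda>(i::nat) (n, s, W). Q n s W \<and> W \<in> R n \<and> (i = 0 \<longrightarrow> (n, s, W) = (n0, s0, W0)))"
  define S where "S = (\<lambda>(i::nat) (n, s, W) (n', s', W'). \<exists>u k. fit n (seg W 0 k) u \<and> n' = cut n W k \<and>
     sub n' W' (shift W k) \<and> T n s u s')"
  have "\<exists>g. \<forall>i. P i (g i) \<and> S i (g i) (g (Suc i))"
  proof (rule dependent_nat_choice)
    show "\<exists>x. P 0 x" using init by (auto simp: P_def)
    fix x i assume "P i x"
    moreover obtain n s W where x: "x = (n, s, W)" by (cases x)
    ultimately have "Q n s W" "W \<in> R n" by (auto simp: P_def)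
    from step[OF this] obtain u k s' W' where 1: "fit n (seg W 0 k) u" "sub (cut n W k) W' (shift W k)"
      "Q (cut n W k) s' W'" "T n s u s'" by blast
    then have "P (Suc i) (cut n W k, s', W')" using sub_R(1) by (auto simp: P_def)
    moreover have "S i x (cut n W k, s', W')" unfolding S_def x using 1 by blast
    ultimately show "\<exists>y. P (Suc i) y \<and> S i x y" by blast
  qed
  then obtain g where g: "\<And>i. P i (g i)" "\<And>i. S i (g i) (g (Suc i))" by blast
  define N where "N = (\<lambda>i. fst (g i))"
  define f where "f = (\<lambda>i. fst (snd (g i)))"
  define W where "W = (\<lambda>i. snd (snd (g i)))"
  have gi: "g i = (N i, f i, W i)" for i by (simp add: N_def f_def W_def)
  have Q: "Q (N i) (f i) (W i)" "W i \<in> R (N i)" for i using g(1)[of i] by (auto simp: P_def gi)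
  have g0: "N 0 = n0" "f 0 = s0" "W 0 = W0" using g(1)[of 0] by (auto simp: P_def gi)
  have "\<forall>i. \<exists>u k. fit (N i) (seg (W i) 0 k) u \<and> N (Suc i) = cut (N i) (W i) k \<and>
     sub (N (Suc i)) (W (Suc i)) (shift (W i) k) \<and> T (N i) (f i) u (f (Suc i))"
    using g(2) by (simp add: S_def gi)
  then obtain U K where UK: "\<And>i. fit (N i) (seg (W i) 0 (K i)) (U i)"
     "\<And>i. N (Suc i) = cut (N i) (W i) (K i)"
     "\<And>i. sub (N (Suc i)) (W (Suc i)) (shift (W i) (K i))" "\<And>i. T (N i) (f i) (U i) (f (Suc i))"
    by metis
  have EN: "N (Suc i) = E (N i) (U i)" for i
    using fit_seg_cut[OF Q(2) UK(1), of i] UK(2)[of i] by simp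
  have cutU: "cut n0 U i = N i" for i by (induction i) (simp_all add: g0 EN)
  have UR: "U \<in> R n0" unfolding R_def using fit_A[OF UK(1)] by (simp add: cutU)
  \<comment> \<open>Each stage lies below a tail of every earlier one; \<open>r\<close> is the index
    where that tail starts, found by comparing cut levels.\<close>
  have below: "\<exists>r. cut (N i) (W i) r = N (i + l) \<and> sub (N (i + l)) (W (i + l)) (shift (W i) r)" for i l
  proof (induction l)
    case 0
    show ?case using sub_refl[OF Q(2)] by (intro exI[of _ 0]) simp
  next
    case (Suc l)
    then obtain r where r: "cut (N i) (W i) r = N (i + l)" "sub (N (i + l)) (W (i + l)) (shift (W i) r)"
      by blast
    let ?m = "i + l"
    from sub_fits[OF r(2), of "K ?m"] obtain q where
      q: "cut (N ?m) (shift (W i) r) q = cut (N ?m) (W ?m) (K ?m)" by blast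
    have q': "cut (N i) (W i) (r + q) = N (Suc ?m)" using q r(1)[symmetric] UK(2)[of ?m] by simp
    have "sub (N (Suc ?m)) (shift (W ?m) (K ?m)) (shift (W i) (r + q))"
      using sub_shift[OF r(2) q] q UK(2)[of ?m] by simp
    with UK(3)[of ?m] have "sub (N (Suc ?m)) (W (Suc ?m)) (shift (W i) (r + q))" by (rule sub_trans)
    with q' show ?case by auto
  qed
  have sub: "sub (N i) (shift U i) (W i)" for i
    unfolding sub_def
  proof (intro conjI allI)
    show "shift U i \<in> R (N i)" using shift_R[OF UR, of i] by (simp add: cutU)
    show "W i \<in> R (N i)" by (rule Q)
    fix l
    have c: "cut (N i) (shift U i) l = N (i + l)" using cut_shift[of n0 U i l] by (simp add: cutU)
    from below obtain r where r: "cut (N i) (W i) r = N (i + l)"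
      "sub (N (i + l)) (W (i + l)) (shift (W i) r)" by blast
    from sub_fit[OF r(2) UK(1)] obtain q where "fit (N (i + l)) (seg (shift (W i) r) 0 q) (U (i + l))"
      by blast
    note q = this
    show "\<exists>k k'. cut (N i) (W i) k = cut (N i) (shift U i) l \<and>
        fit (cut (N i) (shift U i) l) (seg (W i) k k') (shift U i l)"
      unfolding c shift_apply[of U i l]
      by (rule exI[of _ r], rule exI[of _ "r + q"]) (use r(1) q in simp)
  qed
  show ?thesis
  proof (rule exI[of _ U], rule exI[of _ f], intro conjI allI)
    show "sub n0 U W0" using sub[of 0] g0 by simp
    show "f 0 = s0" by (rule g0)
    fix k
    show "T (cut n0 U k) (f k) (U k) (f (Suc k))" using UK(4) by (simp add: cutU)
    show "\<exists>W. Q (cut n0 U k) (f k) W \<and> sub (cut n0 U k) (shift U k) W"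
      using Q(1) sub by (auto simp: cutU)
  qed
qed

text \<open>The requirements are met one after another, and heredity keeps those already
  met.\<close>

lemma shrink_finite:
  assumes "finite F" "W0 \<in> R m"
    and "\<And>y W. y \<in> F \<Longrightarrow> sub m W W0 \<Longrightarrow> \<exists>W'. sub m W' W \<and> P y W'"
    and "\<And>y W W'. y \<in> F \<Longrightarrow> P y W \<Longrightarrow> sub m W' W \<Longrightarrow> P y W'"
  shows "\<exists>W. sub m W W0 \<and> (\<forall>y\<in>F. P y W)"
  using assms
proof (induction F)
  case empty
  then show ?case using sub_refl by auto
next
  case (insert y F)
  have "\<exists>W. sub m W W0 \<and> (\<forall>y\<in>F. P y W)"
  proof (rule insert.IH[OF insert.prems(1)])
    show "\<exists>W'. sub m W' W \<and> P x W'" if "x \<in> F" "sub m W W0" for x W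
      using insert.prems(2)[OF insertI2[OF that(1)] that(2)] .
    show "P x W'" if "x \<in> F" "P x W" "sub m W' W" for x W W'
      using insert.prems(3)[OF insertI2[OF that(1)] that(2,3)] .
  qed
  then obtain W where W: "sub m W W0" "\<forall>y\<in>F. P y W" by blast
  from insert.prems(2)[OF insertI1 W(1)] obtain W' where W': "sub m W' W" "P y W'" by blast
  have "P x W'" if "x \<in> insert y F" for x
    using that W(2) W' insert.prems(3)[OF that _ W'(1)] by auto
  with sub_trans[OF W'(1) W(1)] show ?case by blast
qed

text \<open>A fusion whose state is the list of entries chosen so far. At each stage the reservoir
  has been thinned for all of the finitely many \<open>y\<close> fitting that list, and heredity
  passes \<open>P y\<close> on to the tail of the limit.\<close>

lemma diagonal:
  assumes U: "U \<in> R n"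
    and hered: "\<And>y m W W'. P y W \<Longrightarrow> sub m W' W \<Longrightarrow> m = endl n y \<Longrightarrow> P y W'"
    and dense: "\<And>y k W. fits n y (seg U 0 k) \<Longrightarrow> sub (cut n U k) W (shift U k) \<Longrightarrow>
      \<exists>W'. sub (cut n U k) W' W \<and> P y W'"
  shows "\<exists>U'. sub n U' U \<and> (\<forall>y k. fits n y (seg U' 0 k) \<longrightarrow> P y (shift U' k))"
proof -
  define Q where "Q = (\<lambda>m us W. (\<exists>k. fits n us (seg U 0 k) \<and> m = cut n U k \<and> sub m W (shift U k)) \<and>
      (\<forall>y. fits n y us \<longrightarrow> P y W))"
  have chU: "chain n (seg U 0 k)" for k using cut_seg(2)[OF U, of 0 k] by simp
  have thin: "\<exists>W'. sub m W' W \<and> Q m us W'"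
    if k: "fits n us (seg U 0 k)" "m = cut n U k" and W: "sub m W (shift U k)" for us m W k
  proof -
    have m: "m = endl n us" using fits_seg_cut[OF U k(1)] k(2) by simp
    have "\<exists>W'. sub m W' W \<and> (\<forall>y\<in>{y. fits n y us}. P y W')"
    proof (rule shrink_finite)
      show "finite {y. fits n y us}" using fits_finite fits_chain k(1) by blast
      show "W \<in> R m" using sub_R(1)[OF W] .
    next
      fix y V assume y: "y \<in> {y. fits n y us}" and V: "sub m V W"
      then have "fits n y (seg U 0 k)" using fits_trans[OF chU k(1)] by simp
      from dense[OF this] sub_trans[OF V W] show "\<exists>W'. sub m W' V \<and> P y W'" using k(2) by blast
    next
      fix y V V' assume "y \<in> {y. fits n y us}" "P y V" "sub m V' V"
      then show "P y V'" using hered m fits_end by auto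
    qed
    then obtain W' where W': "sub m W' W" "\<forall>y\<in>{y. fits n y us}. P y W'" by blast
    then have "Q m us W'" unfolding Q_def using k sub_trans[OF W'(1) W] by blast
    with W' show ?thesis by blast
  qed
  obtain W0 where W0: "sub n W0 U" "Q n [] W0"
    using thin[of "[]" 0 n U] sub_refl[OF U] by auto
  have "\<exists>U' f. sub n U' W0 \<and> f 0 = [] \<and>
    (\<forall>k. f (Suc k) = f k @ [U' k] \<and> (\<exists>W. Q (cut n U' k) (f k) W \<and> sub (cut n U' k) (shift U' k) W))"
  proof (rule fusion[where T = "\<lambda>n s u s'. s' = s @ [u]"])
    show "Q n [] W0" "W0 \<in> R n" using W0 sub_R by auto
    fix m us W assume Q: "Q m us W" and W: "W \<in> R m"
    then obtain k where k: "fits n us (seg U 0 k)" "m = cut n U k" "sub m W (shift U k)"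
      unfolding Q_def by blast
    \<comment> \<open>The next entry is simply the first one of the reservoir; all freedom lies in
      thinning the tail behind it.\<close>
    have WA: "W 0 \<in> A m" using R_A[OF W, of 0] by simp
    have f1: "fit m (seg W 0 1) (W 0)" using fit_refl[OF WA] by (simp add: seg_def)
    from sub_fit[OF k(3) f1] obtain j where j: "cut m (shift U k) j = cut m W 1"
      "fit m (seg (shift U k) 0 j) (W 0)" by blast
    have m: "m = endl n us" using fits_seg_cut[OF U k(1)] k(2) by simp
    have "fits n (us @ [W 0]) (seg U 0 k @ seg U k (k + j))"
      using fits_append[OF k(1), of "[W 0]"] j(2) m by simp
    then have a: "fits n (us @ [W 0]) (seg U 0 (k + j))" by (simp add: seg_append)
    have b: "cut m W 1 = cut n U (k + j)" using j(1) k(2) by simp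
    have c: "sub (cut m W 1) (shift W 1) (shift U (k + j))"
      using sub_shift[OF k(3) j(1)] j(1) by simp
    from thin[OF a b c] obtain W' where W': "sub (cut m W 1) W' (shift W 1)"
      "Q (cut m W 1) (us @ [W 0]) W'" by blast
    show "\<exists>u k s' W'. fit m (seg W 0 k) u \<and> sub (cut m W k) W' (shift W k) \<and> Q (cut m W k) s' W' \<and>
       s' = us @ [u]"
      by (intro exI[of _ "W 0"] exI[of _ 1] exI[of _ "us @ [W 0]"] exI[of _ W'] conjI f1 W' refl)
  qed
  then obtain U' f where U': "sub n U' W0" "f 0 = []" "\<And>k. f (Suc k) = f k @ [U' k]"
    "\<And>k. \<exists>W. Q (cut n U' k) (f k) W \<and> sub (cut n U' k) (shift U' k) W" by blast
  have f: "f k = seg U' 0 k" for k by (induction k) (simp_all add: U' seg_Suc)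
  have "P y (shift U' k)" if y: "fits n y (seg U' 0 k)" for y k
  proof -
    from U'(4)[of k] obtain W where W: "Q (cut n U' k) (seg U' 0 k) W" "sub (cut n U' k) (shift U' k) W"
      unfolding f by blast
    have "cut n U' k = endl n y" using fits_seg_cut[OF sub_R(1)[OF U'(1)] y] .
    with W y show ?thesis using hered unfolding Q_def by metis
  qed
  with sub_trans[OF U'(1) W0(1)] show ?thesis by blast
qed

end

section \<open>The abstract Ellentuck theorem\<close>

locale ramsey_system = fit_space A E fit for A :: "nat \<Rightarrow> 'u set" and E fit +
  assumes pigeonhole: "U \<in> R n \<Longrightarrow> \<exists>U'. sub n U' U \<and> (op n U' \<subseteq> X \<or> op n U' \<inter> X = {})"
begin

section \<open>Accepting, rejecting and avoiding\<close>

abbreviation stays :: "(nat \<Rightarrow> 'u) set \<Rightarrow> 'u list \<Rightarrow> (nat \<Rightarrow> 'u) \<Rightarrow> bool" where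
  "stays X x W \<equiv> \<forall>V. sub (endl 0 x) V W \<longrightarrow> app x V \<in> X"

abbreviation avoids :: "(nat \<Rightarrow> 'u) set \<Rightarrow> 'u list \<Rightarrow> (nat \<Rightarrow> 'u) \<Rightarrow> bool" where
  "avoids X x W \<equiv> \<forall>V. sub (endl 0 x) V W \<longrightarrow> app x V \<notin> X"

text \<open>Members of a basic set are written as a stem \<open>x\<close> followed by a sequence
  below a reservoir, which separates the stem from the part to be thinned.
  \<open>homogenized\<close> and \<open>avoidable\<close> are the Ramsey and Ramsey null properties
  in this form.\<close>

definition homogenized :: "(nat \<Rightarrow> 'u) set \<Rightarrow> bool" where
  "homogenized X \<longleftrightarrow> (\<forall>x U. chain 0 x \<longrightarrow> U \<in> R (endl 0 x) \<longrightarrow>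
     (\<exists>U'. sub (endl 0 x) U' U \<and>
        (stays X x U' \<or> avoids X x U')))"

definition avoidable :: "(nat \<Rightarrow> 'u) set \<Rightarrow> bool" where
  "avoidable X \<longleftrightarrow> (\<forall>x U. chain 0 x \<longrightarrow> U \<in> R (endl 0 x) \<longrightarrow>
     (\<exists>U'. sub (endl 0 x) U' U \<and> avoids X x U'))"

definition accepts :: "(nat \<Rightarrow> 'u) set \<Rightarrow> 'u list \<Rightarrow> (nat \<Rightarrow> 'u) \<Rightarrow> bool" where
  "accepts X y W \<longleftrightarrow> stays X y W"

definition rejects :: "(nat \<Rightarrow> 'u) set \<Rightarrow> 'u list \<Rightarrow> (nat \<Rightarrow> 'u) \<Rightarrow> bool" where
  "rejects X y W \<longleftrightarrow> (\<forall>W'. sub (endl 0 y) W' W \<longrightarrow> \<not> accepts X y W')"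

lemma accepts_mono: "accepts X y W \<Longrightarrow> sub (endl 0 y) W' W \<Longrightarrow> accepts X y W'"
  unfolding accepts_def using sub_trans by blast

lemma rejects_mono: "rejects X y W \<Longrightarrow> sub (endl 0 y) W' W \<Longrightarrow> rejects X y W'"
  unfolding rejects_def using sub_trans by blast

lemma not_accepts_rejects: "W \<in> R (endl 0 y) \<Longrightarrow> accepts X y W \<Longrightarrow> \<not> rejects X y W"
  unfolding rejects_def using sub_refl by blast

text \<open>The sets given by an initial segment of \<open>V\<close> and \<open>V\<close> itself
  form a neighbourhood base at \<open>V\<close>, so openness is tested on them.\<close>

definition ellentuck_open :: "(nat \<Rightarrow> 'u) set \<Rightarrow> bool" where
  "ellentuck_open X \<longleftrightarrow> (\<forall>V\<in>X. V \<in> R 0 \<longrightarrow> (\<exists>k. accepts X (seg V 0 k) (shift V k)))"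

lemma accepts_extend:
  assumes V: "V \<in> R 0" and k: "accepts X (seg V 0 k) (shift V k)" "k \<le> k'"
  shows "accepts X (seg V 0 k') (shift V k')"
  unfolding accepts_def
proof (intro allI impI)
  fix W assume W: "sub (endl 0 (seg V 0 k')) W (shift V k')"
  have e: "endl 0 (seg V 0 i) = cut 0 V i" for i using cut_seg(1)[OF V, of 0 i] by simp
  have f: "fits (cut 0 V k) (seg V k k') (seg (shift V k) 0 (k' - k))"
    using fits_refl[OF cut_seg(2)[OF V k(2)]] k(2) by simp
  have "sub (cut (cut 0 V k) (shift V k) (k' - k)) W (shift (shift V k) (k' - k))"
    using W e k(2) by simp
  from sub_app[OF f this shift_R[OF V]] k(1) have "app (seg V 0 k) (app (seg V k k') W) \<in> X"
    unfolding accepts_def e by blast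
  then show "app (seg V 0 k') W \<in> X" using seg_append[of 0 k k' V] k(2) by (metis app_simps(2) zero_le)
qed

lemma ellentuck_open_app:
  assumes "ellentuck_open X" and x: "chain 0 x" and V: "V \<in> R (endl 0 x)" and X: "app x V \<in> X"
  shows "\<exists>j. accepts X (x @ seg V 0 j) (shift V j)"
proof -
  let ?V = "app x V"
  have VR: "?V \<in> R 0" using app_R[OF x V] .
  with assms(1) X obtain k where "accepts X (seg ?V 0 k) (shift ?V k)"
    unfolding ellentuck_open_def by blast
  from accepts_extend[OF VR this, of "length x + k"]
  have "accepts X (seg ?V 0 (length x + k)) (shift ?V (length x + k))" by simp
  moreover have "shift ?V (length x + k) = shift V k"
    by (metis app_simps(4) shift_simps(2))
  moreover have "seg ?V 0 (length x + k) = x @ seg V 0 k"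
    using seg_append[of 0 "length x" "length x + k" ?V] seg_simps(3)[of ?V "length x" 0 k] by simp
  ultimately show ?thesis by auto
qed

text \<open>\<open>U1\<close> decides every finite continuation of \<open>x\<close>. If
  \<open>x\<close> is rejected, a second diagonalization makes rejection pass to one-entry
  extensions, so that \<open>U2\<close> rejects all continuations. Membership in an open set is
  witnessed by an accepted initial segment, hence none is left below \<open>U2\<close>.\<close>

theorem open_homogenized:
  assumes X: "ellentuck_open X"
  shows "homogenized X"
  unfolding homogenized_def
proof (intro allI impI)
  fix x U assume x: "chain 0 x" and U: "U \<in> R (endl 0 x)"
  let ?n = "endl 0 x"
  let ?dec = "\<lambda>y W. accepts X (x @ y) W \<or> rejects X (x @ y) W"
  obtain U1 where U1: "sub ?n U1 U" "\<And>y k. fits ?n y (seg U1 0 k) \<Longrightarrow> ?dec y (shift U1 k)"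
  proof -
    have "\<exists>U'. sub ?n U' U \<and> (\<forall>y k. fits ?n y (seg U' 0 k) \<longrightarrow> ?dec y (shift U' k))"
    proof (rule diagonal[OF U])
      fix y m W W' assume "?dec y W" "sub m W' W" "m = endl ?n y"
      then show "?dec y W'" using accepts_mono[of X "x @ y" W W'] rejects_mono[of X "x @ y" W W'] by auto
    next
      fix y k W assume y: "fits ?n y (seg U 0 k)" and W: "sub (cut ?n U k) W (shift U k)"
      have "cut ?n U k = endl 0 (x @ y)" using fits_seg_cut[OF U y] by simp
      with W show "\<exists>W'. sub (cut ?n U k) W' W \<and> ?dec y W'"
        unfolding rejects_def using sub_refl[OF sub_R(1)[OF W]] by metis
    qed
    with that show thesis by blast
  qed
  note U1R = sub_R(1)[OF U1(1)]
  show "\<exists>U'. sub ?n U' U \<and> ((\<forall>V. sub ?n V U' \<longrightarrow> app x V \<in> X) \<or> (\<forall>V. sub ?n V U' \<longrightarrow> app x V \<notin> X))"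
  proof (cases "accepts X x U1")
    case True
    with U1(1) show ?thesis unfolding accepts_def by blast
  next
    case False
    then have rej: "rejects X x U1" using U1(2)[of "[]" 0] by simp
    let ?P = "\<lambda>y W. accepts X (x @ y) W \<or> (rejects X (x @ y) W \<and>
      (\<forall>e k. fit (endl ?n y) (seg W 0 k) e \<longrightarrow> rejects X (x @ y @ [e]) (shift W k)))"
    have "\<exists>U'. sub ?n U' U1 \<and> (\<forall>y k. fits ?n y (seg U' 0 k) \<longrightarrow> ?P y (shift U' k))"
    proof (rule diagonal[OF U1R])
      fix y m W W' assume P: "?P y W" and s: "sub m W' W" and m: "m = endl ?n y"
      show "?P y W'"
      proof (cases "accepts X (x @ y) W")
        case True
        with s m accepts_mono[of X "x @ y" W W'] show ?thesis by simp
      next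
        case False
        with P have P': "rejects X (x @ y) W"
          "\<And>e k. fit m (seg W 0 k) e \<Longrightarrow> rejects X (x @ y @ [e]) (shift W k)" using m by auto
        have "rejects X (x @ y @ [e]) (shift W' k)" if e: "fit m (seg W' 0 k) e" for e k
        proof -
          from sub_fit[OF s e] obtain j where j: "cut m W j = cut m W' k" "fit m (seg W 0 j) e" by blast
          have "cut m W j = endl 0 (x @ y @ [e])" using fit_seg_cut[OF sub_R(2)[OF s] j(2)] m by simp
          with sub_shift[OF s j(1)] rejects_mono[OF P'(2)[OF j(2)]] show ?thesis by simp
        qed
        with rejects_mono[OF P'(1)] s m show ?thesis by simp
      qed
    next
      fix y k W assume y: "fits ?n y (seg U1 0 k)" and W: "sub (cut ?n U1 k) W (shift U1 k)"
      define m where "m = cut ?n U1 k"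
      have m: "m = endl ?n y" using fits_seg_cut[OF U1R y] m_def by simp
      note W' = W[folded m_def]
      show "\<exists>W'. sub (cut ?n U1 k) W' W \<and> ?P y W'"
      proof (cases "accepts X (x @ y) (shift U1 k)")
        case True
        with W' m have "accepts X (x @ y) W" using accepts_mono[of X "x @ y" "shift U1 k" W] by simp
        with sub_refl[OF sub_R(1)[OF W]] show ?thesis by blast
      next
        case False
        with U1(2)[OF y] have "rejects X (x @ y) (shift U1 k)" by blast
        with W' m have rW: "rejects X (x @ y) W" using rejects_mono[of X "x @ y" "shift U1 k" W] by simp
        \<comment> \<open>The next entries after which the stem is accepted; this is the set
          coloured by the pigeonhole principle.\<close>
        define Y where "Y = {e. \<exists>j. fit m (seg W 0 j) e \<and> accepts X (x @ y @ [e]) (shift W j)}"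
        from pigeonhole[OF sub_R(1)[OF W'], of Y] obtain V where V: "sub m V W"
          "op m V \<subseteq> Y \<or> op m V \<inter> Y = {}" by blast
        \<comment> \<open>If all first entries below \<open>V\<close> were in \<open>Y\<close>,
          every sequence below \<open>V\<close> would begin by entering an accepted extension; then
          \<open>V\<close> would accept \<open>x @ y\<close>, which \<open>W\<close>
          rejects.\<close>
        have VY: "op m V \<inter> Y = {}"
        proof (rule ccontr)
          assume "op m V \<inter> Y \<noteq> {}"
          with V(2) have all: "op m V \<subseteq> Y" by blast
          have "app (x @ y) V' \<in> X" if V': "sub m V' V" for V'
          proof -
            from sub_uncons[OF V'] obtain i where i: "fit m (seg V 0 i) (V' 0)" "cut m V i = E m (V' 0)"
              "sub (cut m V i) (shift V' (Suc 0)) (shift V i)" by blast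
            then have "V' 0 \<in> Y" using all unfolding op_def by blast
            then obtain j where j: "fit m (seg W 0 j) (V' 0)" "accepts X (x @ y @ [V' 0]) (shift W j)"
              unfolding Y_def by blast
            have c: "cut m W j = cut m V i" using fit_seg_cut[OF sub_R(2)[OF V(1)] j(1)] i(2) by simp
            from sub_shift[OF V(1) c] i(3) c have "sub (E m (V' 0)) (shift V' (Suc 0)) (shift W j)"
              using sub_trans i(2) by metis
            then have "app (x @ y @ [V' 0]) (shift V' (Suc 0)) \<in> X"
              using j(2) m unfolding accepts_def by simp
            moreover have "app [V' 0] (shift V' (Suc 0)) = V'"
              using app_seg[of V' "Suc 0"] by (simp add: seg_def)
            ultimately show ?thesis by simp
          qed
          then have "accepts X (x @ y) V" unfolding accepts_def using m by simp
          with rW V(1) m show False unfolding rejects_def by simp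
        qed
        have "rejects X (x @ y @ [e]) (shift V i)" if e: "fit m (seg V 0 i) e" for e i
        proof -
          from sub_fit[OF V(1) e] obtain j where j: "cut m W j = cut m V i" "fit m (seg W 0 j) e" by blast
          have "e \<notin> Y" using e VY unfolding op_def by blast
          with j(2) have na: "\<not> accepts X (x @ y @ [e]) (shift W j)" unfolding Y_def by blast
          from sub_fit[OF W' j(2)] obtain q where
            q: "cut m (shift U1 k) q = cut m W j" "fit m (seg (shift U1 k) 0 q) e" by blast
          have q': "cut ?n U1 (k + q) = cut m W j" using q(1) m_def by simp
          have "fits ?n (y @ [e]) (seg U1 0 k @ seg U1 k (k + q))"
            using fits_append[OF y, of "[e]"] q(2) m by simp
          then have "fits ?n (y @ [e]) (seg U1 0 (k + q))" by (simp add: seg_append)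
          \<comment> \<open>An entry outside \<open>Y\<close> is merely not accepted; the decision
            made by \<open>U1\<close> turns this into rejection.\<close>
          from U1(2)[OF this] have dd: "?dec (y @ [e]) (shift U1 (k + q))" .
          have en: "endl 0 (x @ y @ [e]) = cut m W j"
            using fit_seg_cut[OF sub_R(1)[OF W'] j(2)] m by simp
          have sW: "sub (cut m W j) (shift W j) (shift U1 (k + q))"
            using sub_shift[OF W' q(1)] q(1) by simp
          have "rejects X (x @ y @ [e]) (shift U1 (k + q))"
            using dd na accepts_mono[of X "x @ y @ [e]" "shift U1 (k + q)" "shift W j"] sW en by auto
          moreover have "sub (cut m W j) (shift V i) (shift U1 (k + q))"
            using sub_trans[OF sub_shift[OF V(1) j(1)] sW] .
          ultimately show ?thesis using rejects_mono en by metis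
        qed
        moreover have "rejects X (x @ y) V" using rejects_mono[OF rW] V(1) m by simp
        ultimately show ?thesis using V(1) m m_def by metis
      qed
    qed
    then obtain U2 where U2: "sub ?n U2 U1" "\<And>y k. fits ?n y (seg U2 0 k) \<Longrightarrow> ?P y (shift U2 k)" by blast
    note U2R = sub_R(1)[OF U2(1)]
    have allrej: "rejects X (x @ y) (shift U2 k)" if "fits ?n y (seg U2 0 k)" for y k
      using that
    proof (induction y arbitrary: k rule: rev_induct)
      case Nil
      then have "k = 0" by (simp add: seg_def)
      then show ?case using rejects_mono[OF rej U2(1)] by simp
    next
      case (snoc e y)
      from fits_split[OF snoc.prems] obtain us1 us2 where us: "seg U2 0 k = us1 @ us2"
        "fits ?n y us1" "fits (endl ?n y) [e] us2" by blast
      define i where "i = length us1"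
      have i: "us1 = seg U2 0 i" "us2 = seg U2 i k" "i \<le> k" using seg_eq_append[OF us(1)] i_def by auto
      have y: "fits ?n y (seg U2 0 i)" using us(2) i by simp
      have m: "cut ?n U2 i = endl ?n y" using fits_seg_cut[OF U2R y] .
      have "shift U2 i \<in> R (endl 0 (x @ y))" using shift_R[OF U2R, of i] m by simp
      with not_accepts_rejects snoc.IH[OF y] have "\<not> accepts X (x @ y) (shift U2 i)" by blast
      with U2(2)[OF y] have "fit (endl ?n y) (seg (shift U2 i) 0 (k - i)) e \<Longrightarrow>
        rejects X (x @ y @ [e]) (shift (shift U2 i) (k - i))" by blast
      then show ?case using us(3) i by simp
    qed
    have "app x V \<notin> X" if V: "sub ?n V U2" for V
    proof
      assume "app x V \<in> X"
      from ellentuck_open_app[OF X x sub_R(1)[OF V] this]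
      obtain j where j: "accepts X (x @ seg V 0 j) (shift V j)" by blast
      from sub_fits[OF V, of j] obtain k where k: "cut ?n U2 k = cut ?n V j"
        "fits ?n (seg V 0 j) (seg U2 0 k)" by blast
      have en: "endl 0 (x @ seg V 0 j) = cut ?n U2 k" using fits_seg_cut[OF U2R k(2)] by simp
      from allrej[OF k(2)] sub_shift[OF V k(1)] j show False unfolding rejects_def en by blast
    qed
    with sub_trans[OF U2(1) U1(1)] show ?thesis by blast
  qed
qed

lemma avoidable_nowhere_dense:
  assumes "homogenized C"
    and "\<And>x U. chain 0 x \<Longrightarrow> U \<in> R (endl 0 x) \<Longrightarrow> \<exists>V. sub (endl 0 x) V U \<and> app x V \<notin> C"
  shows "avoidable C"
  unfolding avoidable_def
proof (intro allI impI)
  fix x U assume x: "chain 0 x" and U: "U \<in> R (endl 0 x)"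
  with assms(1) obtain U' where U': "sub (endl 0 x) U' U"
    "stays C x U' \<or> avoids C x U'"
    unfolding homogenized_def by blast
  with assms(2)[OF x sub_R(1)[OF U'(1)]] show
    "\<exists>U'. sub (endl 0 x) U' U \<and> avoids C x U'" by blast
qed

text \<open>After a stem \<open>y\<close> only the sets with index up to \<open>length y\<close> are
  avoided, finitely many at a time. A given \<open>N i\<close> is excluded by the initial segment of
  length \<open>i\<close>.\<close>

lemma avoidable_Union:
  fixes N :: "nat \<Rightarrow> (nat \<Rightarrow> 'u) set"
  assumes N: "\<And>i. avoidable (N i)"
  shows "avoidable (\<Union>i. N i)"
  unfolding avoidable_def
proof (intro allI impI)
  fix x U assume x: "chain 0 x" and U: "U \<in> R (endl 0 x)"
  let ?n = "endl 0 x"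
  let ?avoid = "\<lambda>y i W. \<forall>V. sub (endl ?n y) V W \<longrightarrow> app (x @ y) V \<notin> N i"
  let ?P = "\<lambda>y W. \<forall>i\<in>{..length y}. ?avoid y i W"
  have "\<exists>U'. sub ?n U' U \<and> (\<forall>y k. fits ?n y (seg U' 0 k) \<longrightarrow> ?P y (shift U' k))"
  proof (rule diagonal[OF U])
    fix y m W W' assume "?P y W" "sub m W' W" "m = endl ?n y"
    then show "?P y W'" using sub_trans by blast
  next
    fix y k W assume y: "fits ?n y (seg U 0 k)" and W: "sub (cut ?n U k) W (shift U k)"
    have m: "cut ?n U k = endl ?n y" using fits_seg_cut[OF U y] .
    have c: "chain 0 (x @ y)" using x fits_chain[OF y] by simp
    show "\<exists>W'. sub (cut ?n U k) W' W \<and> ?P y W'"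
    proof (rule shrink_finite)
      show "W \<in> R (cut ?n U k)" using sub_R(1)[OF W] .
      fix i V assume "sub (cut ?n U k) V W"
      then show "\<exists>W'. sub (cut ?n U k) W' V \<and> ?avoid y i W'"
        using N[of i] c sub_R(1) m unfolding avoidable_def by (metis endl_append)
    next
      fix i V V' assume "?avoid y i V" "sub (cut ?n U k) V' V"
      then show "?avoid y i V'" using sub_trans m by metis
    qed simp
  qed
  then obtain U' where U': "sub ?n U' U" "\<And>y k. fits ?n y (seg U' 0 k) \<Longrightarrow> ?P y (shift U' k)" by blast
  have "app x V \<notin> N i" if V: "sub ?n V U'" for V i
  proof -
    from sub_fits[OF V, of i] obtain k where k: "cut ?n U' k = cut ?n V i"
      "fits ?n (seg V 0 i) (seg U' 0 k)" by blast
    have "cut ?n U' k = endl ?n (seg V 0 i)" using fits_seg_cut[OF sub_R(2)[OF V] k(2)] .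
    with sub_shift[OF V k(1)] bspec[OF U'(2)[OF k(2)], of i, THEN spec, of "shift V i"]
    have "app (x @ seg V 0 i) (shift V i) \<notin> N i" by simp
    then show ?thesis by simp
  qed
  with U'(1) show "\<exists>U'. sub ?n U' U \<and> (\<forall>V. sub ?n V U' \<longrightarrow> app x V \<notin> (\<Union>i. N i))" by blast
qed

lemma homogenized_modulo_avoidable:
  assumes "homogenized G" "avoidable ((X - G) \<union> (G - X))"
  shows "homogenized X"
  unfolding homogenized_def
proof (intro allI impI)
  fix x U assume x: "chain 0 x" and U: "U \<in> R (endl 0 x)"
  with assms(2) obtain U1 where U1: "sub (endl 0 x) U1 U"
    "\<forall>V. sub (endl 0 x) V U1 \<longrightarrow> app x V \<notin> (X - G) \<union> (G - X)"
    unfolding avoidable_def by blast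
  from assms(1) x sub_R(1)[OF U1(1)] obtain U2 where U2: "sub (endl 0 x) U2 U1"
    "stays G x U2 \<or> avoids G x U2"
    unfolding homogenized_def by blast
  have "app x V \<in> X \<longleftrightarrow> app x V \<in> G" if "sub (endl 0 x) V U2" for V
    using U1(2) sub_trans[OF that U2(1)] by blast
  with U2 sub_trans[OF U2(1) U1(1)] show "\<exists>U'. sub (endl 0 x) U' U \<and>
      (stays X x U' \<or> avoids X x U')"
    by metis
qed

lemma avoidable_subset: "avoidable Y \<Longrightarrow> X \<subseteq> Y \<Longrightarrow> avoidable X"
  unfolding avoidable_def by (meson subsetD)

end

section \<open>Shape-preserving maps and lifts\<close>

lemma strict_mono_range_unique:
  fixes f g :: "nat \<Rightarrow> nat"
  assumes "strict_mono f" "strict_mono g" "range f = range g"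
  shows "f = g"
proof
  fix i show "f i = g i"
  proof (induction i rule: less_induct)
    case (less i)
    have aux: "h' i \<le> h i" if "strict_mono h" "strict_mono h'" "range h = range h'" "\<And>j. j < i \<Longrightarrow> h j = h' j"
      for h h' :: "nat \<Rightarrow> nat"
    proof -
      from that(3) have "h i \<in> range h'" by auto
      then obtain j where j: "h i = h' j" by blast
      have "\<not> j < i"
      proof
        assume "j < i"
        then have "h j = h i" using that(4) j by simp
        with \<open>j < i\<close> show False using strict_mono_eq[OF that(1)] by simp
      qed
      then show ?thesis using j strict_mono_less_eq[OF that(2)] by simp
    qed
    show ?case using aux[of f g] aux[of g f] assms less by force
  qed
qed

locale SM_tree =
  fixes le :: "'a::countable \<Rightarrow> 'a \<Rightarrow> bool"
    and S :: "'a \<Rightarrow> 'a list \<Rightarrow> 'c \<Rightarrow> 'a option"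
    and M :: "('a \<Rightarrow> 'a) set"
  assumes SM: "is_SM_tree le S M"
begin

abbreviation lv where "lv \<equiv> lev le"
abbreviation T where "T \<equiv> levset le"
abbreviation tlv where "tlv \<equiv> tildeF le"

lemma in_T [simp]: "a \<in> T n \<longleftrightarrow> lv a = n"
  by (simp add: levset_def)

lemmas SM_axioms = SM[unfolded is_SM_tree_def]

lemma S_tree: "is_S_tree le S"
  by (rule SM_axioms[THEN conjunct1])

lemmas S_axioms = S_tree[unfolded is_S_tree_def]

lemma tree: "is_tree le"
  by (rule S_axioms[THEN conjunct1])

lemma le_refl [simp]: "le a a"
  and le_antisym: "le a b \<Longrightarrow> le b a \<Longrightarrow> a = b"
  and le_trans: "le a b \<Longrightarrow> le b c \<Longrightarrow> le a c"
  and finite_below: "finite {b. lt le b a}"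
  and lt_linear: "lt le b a \<Longrightarrow> lt le c a \<Longrightarrow> le b c \<or> le c b"
  using tree unfolding is_tree_def by blast+

lemma le_linear: "le b a \<Longrightarrow> le c a \<Longrightarrow> le b c \<or> le c b"
  using lt_linear[of b a c] unfolding lt_def by blast

lemma lev_less: "le a b \<Longrightarrow> a \<noteq> b \<Longrightarrow> lv a < lv b"
proof -
  assume "le a b" "a \<noteq> b"
  then have "{x. lt le x a} \<subset> {x. lt le x b}"
    unfolding lt_def using le_trans le_antisym by blast
  then show ?thesis unfolding lev_def by (rule psubset_card_mono[OF finite_below])
qed

lemma lev_mono: "le a b \<Longrightarrow> lv a \<le> lv b"
  using lev_less[of a b] by (cases "a = b") auto

lemma le_lev_eq: "le a b \<Longrightarrow> lv a = lv b \<Longrightarrow> a = b"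
  using lev_less by fastforce

lemma le_below: "le a x \<Longrightarrow> le b x \<Longrightarrow> lv a \<le> lv b \<Longrightarrow> le a b"
  using le_linear[of a x b] lev_mono[of b a] le_lev_eq[of b a] by auto

lemma ex_below: "j \<le> lv b \<Longrightarrow> \<exists>a. le a b \<and> lv a = j"
proof -
  assume j: "j \<le> lv b"
  let ?D = "{x. le x b}"
  have D: "?D = insert b {x. lt le x b}" unfolding lt_def by auto
  then have fin: "finite ?D" using finite_below by simp
  have "b \<notin> {x. lt le x b}" unfolding lt_def by simp
  then have card: "card ?D = Suc (lv b)" unfolding D lev_def using finite_below by simp
  have "inj_on lv ?D" using le_below le_antisym by (intro inj_onI) (metis mem_Collect_eq order_refl)
  then have "card (lv ` ?D) = card {..lv b}" using card by (simp add: card_image)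
  moreover have "lv ` ?D \<subseteq> {..lv b}" using lev_mono by auto
  ultimately have "lv ` ?D = {..lv b}" by (intro card_subset_eq) auto
  with j show ?thesis by force
qed

definition trunc :: "'a \<Rightarrow> nat \<Rightarrow> 'a" where
  "trunc b j = (SOME a. le a b \<and> lv a = j)"

lemma trunc: "j \<le> lv b \<Longrightarrow> le (trunc b j) b" "j \<le> lv b \<Longrightarrow> lv (trunc b j) = j"
  using someI_ex[OF ex_below[of j b]] unfolding trunc_def by auto

lemma trunc_eq: "le a b \<Longrightarrow> lv a = j \<Longrightarrow> trunc b j = a"
  using trunc[of j b] le_below[of "trunc b j" b a] le_lev_eq lev_mono[of a b] by auto

lemma trunc_trunc: "i \<le> j \<Longrightarrow> j \<le> lv b \<Longrightarrow> trunc (trunc b j) i = trunc b i"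
  using trunc[of j b] trunc[of i "trunc b j"] le_trans by (intro trunc_eq[symmetric]) auto

lemma immsucc_iff: "immsucc le a b \<longleftrightarrow> le a b \<and> lv b = Suc (lv a)"
proof
  assume i: "immsucc le a b"
  then have ab: "le a b" "a \<noteq> b" unfolding immsucc_def lt_def by auto
  have less: "lv a < lv b" using lev_less ab by blast
  let ?c = "trunc b (Suc (lv a))"
  have c: "le ?c b" "lv ?c = Suc (lv a)" using trunc[of "Suc (lv a)" b] less by auto
  have ac: "le a ?c" using le_below[OF ab(1) c(1)] c(2) by simp
  have "lt le a ?c" using ac c(2) unfolding lt_def by auto
  then have "\<not> lt le ?c b" using i unfolding immsucc_def by blast
  then have "?c = b" using c(1) unfolding lt_def by blast
  with ab c show "le a b \<and> lv b = Suc (lv a)" by simp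
next
  assume i: "le a b \<and> lv b = Suc (lv a)"
  then have "lt le a b" unfolding lt_def by auto
  moreover have "\<not> (lt le a c \<and> lt le c b)" for c
  proof
    assume "lt le a c \<and> lt le c b"
    then have "lv a < lv c" "lv c < lv b" using lev_less unfolding lt_def by blast+
    with i show False by simp
  qed
  ultimately show "immsucc le a b" unfolding immsucc_def by blast
qed

lemma S_le: "S a p c = Some b \<Longrightarrow> le a b"
  and S_lev: "S a p c = Some b \<Longrightarrow> lv b = Suc (lv a)"
  and S_params: "S a p c = Some b \<Longrightarrow> x \<in> set p \<Longrightarrow> lv x < lv a"
  and S_inj: "S a p c = Some x \<Longrightarrow> S b q d = Some x \<Longrightarrow> a = b \<and> p = q \<and> c = d"
  and S_total: "le a b \<Longrightarrow> lv b = Suc (lv a) \<Longrightarrow> \<exists>p c. S a p c = Some b"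
proof -
  have *: "\<forall>a p c b. S a p c = Some b \<longrightarrow> immsucc le a b \<and> (\<forall>x\<in>set p. lv x + 1 \<le> lv a)"
    and i: "\<forall>a p c b q d x. S a p c = Some x \<and> S b q d = Some x \<longrightarrow> a = b \<and> p = q \<and> c = d"
    and t: "\<forall>a b. immsucc le a b \<longrightarrow> (\<exists>p c. S a p c = Some b)"
    by (rule S_axioms[THEN conjunct2, THEN conjunct2, THEN conjunct2, THEN conjunct1]
        S_axioms[THEN conjunct2, THEN conjunct2, THEN conjunct2, THEN conjunct2, THEN conjunct1]
        S_axioms[THEN conjunct2, THEN conjunct2, THEN conjunct2, THEN conjunct2, THEN conjunct2])+
  show "S a p c = Some b \<Longrightarrow> le a b" "S a p c = Some b \<Longrightarrow> lv b = Suc (lv a)"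
    using * immsucc_iff by blast+
  show "S a p c = Some b \<Longrightarrow> x \<in> set p \<Longrightarrow> lv x < lv a" using * by fastforce
  show "S a p c = Some x \<Longrightarrow> S b q d = Some x \<Longrightarrow> a = b \<and> p = q \<and> c = d" using i by blast
  show "le a b \<Longrightarrow> lv b = Suc (lv a) \<Longrightarrow> \<exists>p c. S a p c = Some b" using t immsucc_iff by blast
qed

section \<open>Shape-preserving maps and their level functions\<close>

lemma shape: "F \<in> M \<Longrightarrow> shape_pres le S F"
  by (rule SM_axioms[THEN conjunct2, THEN conjunct1, rule_format])

lemma M_id: "id \<in> M"
  by (rule SM_axioms[THEN conjunct2, THEN conjunct2, THEN conjunct1])

lemma M_comp: "F \<in> M \<Longrightarrow> G \<in> M \<Longrightarrow> F \<circ> G \<in> M"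
  by (rule SM_axioms[THEN conjunct2, THEN conjunct2, THEN conjunct2, THEN conjunct1, rule_format])

lemmas M_axioms = SM_axioms[THEN conjunct2, THEN conjunct2, THEN conjunct2, THEN conjunct2]

lemma M_limit: "(\<And>i. Fs i \<in> M) \<Longrightarrow> (\<And>i a. lv a \<le> i \<Longrightarrow> Fs i a = Fs (Suc i) a) \<Longrightarrow>
    \<exists>G\<in>M. \<forall>i a. lv a \<le> i \<longrightarrow> G a = Fs i a"
  by (rule M_axioms[THEN conjunct1, THEN spec, THEN mp]) blast

lemma M2: "F \<in> M \<Longrightarrow> tlv F n > 0 \<Longrightarrow> tlv F n - 1 \<notin> limg le F \<Longrightarrow>
    \<exists>F1\<in>M. \<exists>F2\<in>M. limg le F2 = UNIV - {tlv F n - 1} \<and> (\<forall>a. lv a \<le> n \<longrightarrow> F2 (F1 a) = F a)"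
  by (rule M_axioms[THEN conjunct2, THEN conjunct1, THEN spec, THEN bspec, THEN mp]) blast+

lemma M3: "n < m \<Longrightarrow> \<exists>F\<in>M. limg le F = UNIV - {m} \<and>
    (\<forall>a b p c x. lv a = n \<and> lv b = m \<and> S a p c = Some x \<and> le x b \<longrightarrow> S b p c = Some (F b))"
  by (rule M_axioms[THEN conjunct2, THEN conjunct2, THEN spec, THEN spec, THEN mp])

text \<open>A map that skips only level \<open>Suc n\<close> attains level \<open>n\<close>, so (M3)
  guarantees that no level is empty.\<close>

lemma ex_level: "\<exists>a. lv a = n"
proof -
  from M3[of 0 "Suc n"] obtain F where "limg le F = UNIV - {Suc n}" by blast
  then have "n \<in> limg le F" by simp
  then show ?thesis unfolding limg_def by auto
qed

lemma finite_T: "finite (T n)"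
proof (induction n)
  case 0
  show ?case by (rule S_axioms[THEN conjunct2, THEN conjunct2, THEN conjunct1])
next
  case (Suc n)
  have fin: "finite {b. immsucc le a b}" for a
    by (rule S_axioms[THEN conjunct2, THEN conjunct1, THEN spec])
  have "T (Suc n) \<subseteq> (\<Union>a\<in>T n. {b. immsucc le a b})"
  proof
    fix b assume "b \<in> T (Suc n)"
    then have "immsucc le (trunc b n) b" "trunc b n \<in> T n" using trunc[of n b] immsucc_iff by auto
    then show "b \<in> (\<Union>a\<in>T n. {b. immsucc le a b})" by blast
  qed
  with Suc fin show ?case by (meson finite_UN_I finite_subset)
qed

lemma lev_F: "F \<in> M \<Longrightarrow> lv (F a) = tlv F (lv a)"
proof -
  assume "F \<in> M"
  then have "level_pres le F" using shape unfolding shape_pres_def by blast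
  moreover have "lv (SOME x. lv x = lv a) = lv a" using someI[of "\<lambda>x. lv x = lv a" a] by simp
  ultimately show ?thesis unfolding tildeF_def level_pres_def by metis
qed

lemma F_S: "F \<in> M \<Longrightarrow> S a p c = Some b \<Longrightarrow> \<exists>b'. S (F a) (map F p) c = Some b' \<and> le b' (F b)"
  using shape unfolding shape_pres_def by blast

lemma F_root: "F \<in> M \<Longrightarrow> lv a = 0 \<Longrightarrow> le a b \<Longrightarrow> le a (F b)"
  using shape unfolding shape_pres_def by blast

lemma tl_strict: "F \<in> M \<Longrightarrow> strict_mono (tlv F)"
proof (rule strict_monoI_Suc)
  fix n assume F: "F \<in> M"
  from ex_level obtain b where b: "lv b = Suc n" by blast
  from trunc[of n b] b have a: "le (trunc b n) b" "lv (trunc b n) = n" by auto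
  from S_total[OF a(1)] a b obtain p c where "S (trunc b n) p c = Some b" by auto
  from F_S[OF F this] obtain b' where "S (F (trunc b n)) (map F p) c = Some b'" "le b' (F b)" by blast
  then have "lv (F (trunc b n)) < lv (F b)" using S_lev lev_mono by fastforce
  then show "tlv F n < tlv F (Suc n)" using lev_F[OF F] a b by simp
qed

lemma limg_range: "F \<in> M \<Longrightarrow> limg le F = range (tlv F)"
  unfolding limg_def using lev_F ex_level by (auto simp: image_iff) metis

lemma tl_ge: "F \<in> M \<Longrightarrow> n \<le> tlv F n"
  using strict_mono_imp_increasing[OF tl_strict] .

text \<open>Roots cannot move by the root condition. Higher up, the predecessor and the parameters
  are fixed by induction, so preservation of \<open>S\<close> places \<open>a\<close> below
  \<open>F a\<close>, and their levels agree.\<close>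

lemma F_id_below:
  assumes F: "F \<in> M" and "\<And>i. i < n \<Longrightarrow> tlv F i = i" and "lv a < n"
  shows "F a = a"
  using assms(3)
proof (induction "lv a" arbitrary: a rule: less_induct)
  case less
  have lev: "lv (F a) = lv a" using lev_F[OF F] assms(2) less.prems by simp
  show ?case
  proof (cases "lv a")
    case 0
    with F_root[OF F 0 le_refl] lev le_lev_eq show ?thesis by metis
  next
    case (Suc j)
    let ?b = "trunc a j"
    have b: "le ?b a" "lv ?b = j" using trunc[of j a] Suc by auto
    from S_total[OF b(1)] b(2) Suc obtain p c where p: "S ?b p c = Some a" by auto
    have "F x = x" if "x \<in> set p" for x using S_params[OF p that] b less Suc by auto
    then have "map F p = p" by (simp add: map_idI)
    moreover have "F ?b = ?b" using less b Suc by auto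
    ultimately have "le a (F a)" using F_S[OF F p] p by auto
    with lev le_lev_eq show ?thesis by metis
  qed
qed

abbreviation MM where "MM \<equiv> Mn le M"

lemma MM_M: "F \<in> MM n \<Longrightarrow> F \<in> M"
  by (simp add: Mn_def)

lemma MM_id: "F \<in> MM n \<Longrightarrow> lv a < n \<Longrightarrow> F a = a"
  by (simp add: Mn_def)

lemma MM_I: "F \<in> M \<Longrightarrow> (\<And>i. i < n \<Longrightarrow> tlv F i = i) \<Longrightarrow> F \<in> MM n"
  using F_id_below unfolding Mn_def by blast

lemma MM_tl: "F \<in> MM n \<Longrightarrow> i < n \<Longrightarrow> tlv F i = i"
  using ex_level[of i] lev_F MM_M MM_id by metis

lemma MM_map: "F \<in> MM n \<Longrightarrow> (\<And>x. x \<in> set p \<Longrightarrow> lv x < n) \<Longrightarrow> map F p = p"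
  using MM_id by (intro map_idI) blast

lemma MM_S: "F \<in> MM n \<Longrightarrow> lv a = n \<Longrightarrow> S a p c = Some b \<Longrightarrow> \<exists>b'. S (F a) p c = Some b' \<and> le b' (F b)"
  using F_S[OF MM_M, of F n a p c b] MM_map[of F n p] S_params[of a p c b] by auto

text \<open>The edge leading to \<open>a\<close> leaves a node below level \<open>n\<close> and has
  its parameters there; all of these are fixed, so the edge is preserved.\<close>

lemma MM_ge: "F \<in> MM n \<Longrightarrow> lv a = n \<Longrightarrow> le a (F a)"
proof -
  assume F: "F \<in> MM n" and a: "lv a = n"
  show ?thesis
  proof (cases n)
    case 0
    then show ?thesis using F_root[OF MM_M[OF F], of a a] a by simp
  next
    case (Suc j)
    let ?b = "trunc a j"
    have b: "le ?b a" "lv ?b = j" using trunc[of j a] Suc a by auto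
    from S_total[OF b(1)] b(2) Suc a obtain p c where p: "S ?b p c = Some a" by auto
    have "map F p = p" by (rule MM_map[OF F]) (use S_params[OF p] b Suc in \<open>auto intro: less_SucI\<close>)
    moreover have "F ?b = ?b" using MM_id[OF F] b Suc by auto
    ultimately show ?thesis using F_S[OF MM_M[OF F] p] p by auto
  qed
qed

lemma MM_lev: "F \<in> MM n \<Longrightarrow> lv a = n \<Longrightarrow> lv (F a) = tlv F n"
  using lev_F[OF MM_M] by simp

lemma MM_tl_ge: "F \<in> MM n \<Longrightarrow> n \<le> tlv F n"
  using tl_ge MM_M by blast

lemma tl_id [simp]: "tlv id n = n"
  using lev_F[OF M_id] ex_level[of n] by fastforce

lemma tl_comp: "F \<in> M \<Longrightarrow> G \<in> M \<Longrightarrow> tlv (F \<circ> G) n = tlv F (tlv G n)"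
  using lev_F[of F] lev_F[of G] lev_F[OF M_comp, of F G] ex_level[of n] by fastforce

lemma MM_idI: "id \<in> MM n"
  by (simp add: Mn_def M_id)

lemma MM_comp: "F \<in> MM m \<Longrightarrow> G \<in> MM n \<Longrightarrow> n \<le> m \<Longrightarrow> F \<circ> G \<in> MM n"
  unfolding Mn_def using M_comp by auto

lemma skip_only:
  assumes "F \<in> M" "limg le F = UNIV - {m}"
  shows "F \<in> MM m" "\<And>i. m \<le> i \<Longrightarrow> tlv F i = Suc i"
proof -
  let ?g = "\<lambda>i. if i < m then i else Suc i"
  have "strict_mono ?g" by (rule strict_monoI) auto
  moreover have "range ?g = range (tlv F)"
  proof -
    have "x \<in> range ?g" if "x \<noteq> m" for x
    proof (cases "x < m")
      case False
      with that have "x = ?g (x - 1)" by auto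
      then show ?thesis by (rule range_eqI)
    qed (auto intro: range_eqI[of _ _ x])
    then have "range ?g = UNIV - {m}" by auto
    then show ?thesis using assms limg_range by simp
  qed
  ultimately have "?g = tlv F" using strict_mono_range_unique tl_strict[OF assms(1)] by metis
  then have tlv: "tlv F i = ?g i" for i by (rule fun_cong[symmetric])
  show "F \<in> MM m" using MM_I[OF assms(1)] tlv by simp
  show "\<And>i. m \<le> i \<Longrightarrow> tlv F i = Suc i" using tlv by simp
qed

text \<open>Axiom (M2) removes one skipped level at a time, hence entries can be truncated to lower levels
  and skipped levels above a given one can be filled successively.\<close>

lemma M2_split:
  assumes F: "F \<in> M" and tlv: "tlv F n = Suc m" and m: "m \<notin> limg le F"
  shows "\<exists>G\<in>M. \<exists>V\<in>MM m. tlv V m = Suc m \<and> tlv G n = m \<and> (\<forall>a. lv a \<le> n \<longrightarrow> V (G a) = F a) \<and>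
    (\<forall>a. lv a < n \<longrightarrow> G a = F a)"
proof -
  from M2[OF F, of n] tlv m obtain G V where G: "G \<in> M" and V: "V \<in> M" "limg le V = UNIV - {m}"
    and eq: "\<And>a. lv a \<le> n \<Longrightarrow> V (G a) = F a" by auto
  have Vm: "V \<in> MM m" and V2: "\<And>i. m \<le> i \<Longrightarrow> tlv V i = Suc i" using skip_only[OF V] by auto
  have lev: "tlv V (tlv G i) = tlv F i" if "i \<le> n" for i
    using ex_level[of i] eq lev_F[OF F] lev_F[OF G] lev_F[OF V(1)] that by metis
  have "tlv G n = m"
    using lev[of n] tlv V2[of "tlv G n"] MM_tl[OF Vm, of "tlv G n"] by (cases "m \<le> tlv G n") auto
  moreover have "G a = F a" if a: "lv a < n" for a
  proof -
    have "tlv F (lv a) < Suc m" using strict_monoD[OF tl_strict[OF F] a] tlv by simp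
    then have "tlv V (tlv G (lv a)) \<le> m" using lev a by simp
    then have "tlv G (lv a) < m" using V2[of "tlv G (lv a)"] by (cases "m \<le> tlv G (lv a)") auto
    then show ?thesis using MM_id[OF Vm, of "G a"] eq[of a] a lev_F[OF G] by simp
  qed
  ultimately show ?thesis using G Vm V2 eq by blast
qed

text \<open>Level \<open>m\<close> is skipped: levels below \<open>n\<close> are fixed, and from
  \<open>n\<close> on the level function is at least \<open>Suc m\<close>. Hence (M2)
  applies.\<close>

lemma factor:
  assumes F: "F \<in> MM n" and m: "n \<le> m" "tlv F n = Suc m"
  shows "\<exists>G\<in>MM n. \<exists>V\<in>MM m. tlv G n = m \<and> tlv V m = Suc m \<and> (\<forall>a\<in>T n. V (G a) = F a)"
proof -
  have "m \<notin> limg le F"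
  proof
    assume "m \<in> limg le F"
    then obtain i where i: "m = tlv F i" using limg_range[OF MM_M[OF F]] by auto
    show False
    proof (cases "i < n")
      case True
      then show ?thesis using MM_tl[OF F] i m by simp
    next
      case False
      then have "tlv F n \<le> tlv F i" using strict_mono_less_eq[OF tl_strict[OF MM_M[OF F]]] by simp
      then show ?thesis using i m by simp
    qed
  qed
  from M2_split[OF MM_M[OF F] m(2) this] obtain G V where G: "G \<in> M" "V \<in> MM m" "tlv V m = Suc m"
    "tlv G n = m" "\<forall>a. lv a \<le> n \<longrightarrow> V (G a) = F a" "\<forall>a. lv a < n \<longrightarrow> G a = F a" by blast
  have "G \<in> MM n" using G(1,6) MM_id[OF F] unfolding Mn_def by simp
  with G show ?thesis by (intro bexI[of _ G] bexI[of _ V]) auto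
qed

text \<open>Each use of \<open>factor\<close> lowers the target level by one. Its second factor only
  moves nodes upward, so the values of the first are predecessors of the old ones.\<close>

lemma truncate:
  assumes F: "F \<in> MM n" and j: "n \<le> j" "j \<le> tlv F n"
  shows "\<exists>G\<in>MM n. tlv G n = j \<and> (\<forall>a\<in>T n. G a = trunc (F a) j)"
  using F j(2)
proof (induction "tlv F n - j" arbitrary: F)
  case 0
  then have "tlv F n = j" by simp
  then show ?case using 0 MM_lev by (intro bexI[of _ F]) (auto intro!: trunc_eq[symmetric])
next
  case (Suc d)
  then obtain m where m: "tlv F n = Suc m" "j \<le> m" "d = m - j" by (cases "tlv F n") auto
  from factor[OF Suc.prems(1) _ m(1)] j m obtain G V where G: "G \<in> MM n" "tlv G n = m"
    and V: "V \<in> MM m" "\<forall>a\<in>T n. V (G a) = F a" by auto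
  from Suc.hyps(1)[of G] G m obtain G' where G': "G' \<in> MM n" "tlv G' n = j" "\<forall>a\<in>T n. G' a = trunc (G a) j"
    by auto
  have "trunc (G a) j = trunc (F a) j" if "a \<in> T n" for a
  proof -
    have l: "lv (G a) = m" using MM_lev[OF G(1)] that G by simp
    have le: "le (G a) (F a)" using MM_ge[OF V(1) l] V(2) that by simp
    have "le (trunc (G a) j) (F a)" using trunc(1)[of j "G a"] l m le le_trans by metis
    then show ?thesis using trunc(2)[of j "G a"] l m by (intro trunc_eq[symmetric]) auto
  qed
  with G' show ?case by auto
qed

lemma compress:
  assumes F: "F \<in> M"
  shows "\<exists>G\<in>M. (\<forall>a. lv a \<le> n \<longrightarrow> G a = F a) \<and> tlv G (Suc n) = Suc (tlv F n)"
  using F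
proof (induction "tlv F (Suc n) - Suc (tlv F n)" arbitrary: F)
  case 0
  then have "tlv F (Suc n) = Suc (tlv F n)" using strict_monoD[OF tl_strict[OF 0(2)], of n "Suc n"] by simp
  then show ?case using 0 by (intro bexI[of _ F]) auto
next
  case (Suc d)
  then obtain m where m: "tlv F (Suc n) = Suc m" "tlv F n < m" "d = m - Suc (tlv F n)"
    by (cases "tlv F (Suc n)") auto
  have "m \<notin> limg le F"
  proof
    assume "m \<in> limg le F"
    then obtain i where i: "m = tlv F i" using limg_range[OF Suc.prems] by auto
    note sm = strict_mono_less[OF tl_strict[OF Suc.prems]]
    have "n < i" "i < Suc n" using sm[of n i] sm[of i "Suc n"] i m by auto
    then show False by simp
  qed
  from M2_split[OF Suc.prems m(1) this] obtain G where G: "G \<in> M" "tlv G (Suc n) = m"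
    "\<forall>a. lv a \<le> n \<longrightarrow> G a = F a" by (auto simp: less_Suc_eq_le)
  have "tlv G n = tlv F n" using ex_level[of n] G lev_F[OF G(1)] lev_F[OF Suc.prems] by (metis order_refl)
  with Suc.hyps(1)[of G] G m obtain H where "H \<in> M" "\<forall>a. lv a \<le> n \<longrightarrow> H a = G a" "tlv H (Suc n) = Suc (tlv F n)"
    by auto
  with G(3) show ?case by auto
qed

text \<open>\<open>compress\<close> is applied at the levels \<open>n\<close>, \<open>n + 1\<close>
  and so on. Values up to level \<open>n + i\<close> are final after \<open>i\<close> steps, so (M1)
  provides the limit; truncated subtraction in \<open>i - n\<close> covers the levels below
  \<open>n\<close>.\<close>

lemma ex_full_extension:
  assumes F: "F \<in> M"
  shows "\<exists>G\<in>M. (\<forall>a. lv a \<le> n \<longrightarrow> G a = F a) \<and> (\<forall>i. tlv G (n + i) = tlv F n + i)"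
proof -
  have "\<exists>H. \<forall>i. (H i \<in> M \<and> (\<forall>a. lv a \<le> n \<longrightarrow> H i a = F a)) \<and>
     ((\<forall>a. lv a \<le> n + i \<longrightarrow> H (Suc i) a = H i a) \<and> tlv (H (Suc i)) (Suc (n + i)) = Suc (tlv (H i) (n + i)))"
  proof (rule dependent_nat_choice)
    show "\<exists>H. H \<in> M \<and> (\<forall>a. lv a \<le> n \<longrightarrow> H a = F a)" using F by blast
    fix H i assume "H \<in> M \<and> (\<forall>a. lv a \<le> n \<longrightarrow> H a = F a)"
    with compress[of H "n + i"] show "\<exists>H'. (H' \<in> M \<and> (\<forall>a. lv a \<le> n \<longrightarrow> H' a = F a)) \<and>
       ((\<forall>a. lv a \<le> n + i \<longrightarrow> H' a = H a) \<and> tlv H' (Suc (n + i)) = Suc (tlv H (n + i)))"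
      by auto
  qed
  then obtain H where H: "\<And>i. H i \<in> M" "\<And>i a. lv a \<le> n \<Longrightarrow> H i a = F a"
     "\<And>i a. lv a \<le> n + i \<Longrightarrow> H (Suc i) a = H i a" "\<And>i. tlv (H (Suc i)) (Suc (n + i)) = Suc (tlv (H i) (n + i))"
    by metis
  have tln: "tlv (H 0) n = tlv F n"
  proof -
    from ex_level obtain a where a: "lv a = n" by blast
    then show ?thesis using H(2)[of a 0] lev_F[OF H(1), of 0 a] lev_F[OF F, of a] by simp
  qed
  have tlH: "tlv (H i) (n + i) = tlv F n + i" for i by (induction i) (simp_all add: tln H(4))
  have "\<exists>G\<in>M. \<forall>i a. lv a \<le> i \<longrightarrow> G a = H (i - n) a"
  proof (rule M_limit)
    fix i a assume a: "lv a \<le> i"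
    show "H (i - n) a = H (Suc i - n) a"
    proof (cases "i < n")
      case False
      then show ?thesis using H(3)[of a "i - n"] a by (simp add: Suc_diff_le)
    qed simp
  qed (rule H)
  then obtain G where G: "G \<in> M" "\<And>i a. lv a \<le> i \<Longrightarrow> G a = H (i - n) a" by blast
  have "tlv G (n + i) = tlv F n + i" for i
  proof -
    from ex_level obtain a where a: "lv a = n + i" by blast
    then show ?thesis using G(2)[of a "n + i"] lev_F[OF G(1), of a] lev_F[OF H(1), of i a] tlH by simp
  qed
  moreover have "G a = F a" if "lv a \<le> n" for a using G(2)[OF that] H(2)[OF that] by simp
  ultimately show ?thesis using G(1) by blast
qed

text \<open>Where the level function grows by one, the successor of the image of
  \<open>trunc a j\<close> carrying the label of \<open>a\<close> already has the level of
  \<open>F a\<close>. So \<open>F a\<close> is computed from values on smaller levels.\<close>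

lemma full_extension_unique:
  assumes "F \<in> M" "G \<in> M" "\<And>a. lv a \<le> n \<Longrightarrow> F a = G a"
    and "\<And>i. n \<le> i \<Longrightarrow> tlv F (Suc i) = Suc (tlv F i)" "\<And>i. n \<le> i \<Longrightarrow> tlv G (Suc i) = Suc (tlv G i)"
  shows "F = G"
proof
  fix a show "F a = G a"
  proof (induction "lv a" arbitrary: a rule: less_induct)
    case less
    show ?case
    proof (cases "lv a \<le> n")
      case False
      then obtain j where j: "lv a = Suc j" "n \<le> j" by (cases "lv a") auto
      let ?b = "trunc a j"
      have b: "le ?b a" "lv ?b = j" using trunc[of j a] j by auto
      from S_total[OF b(1)] b(2) j obtain p c where p: "S ?b p c = Some a" by auto
      have "F x = G x" if "x \<in> set p" for x using S_params[OF p that] b j by (intro less) simp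
      then have eq: "F ?b = G ?b" "map F p = map G p" using less b j by auto
      from F_S[OF assms(1) p] F_S[OF assms(2) p] eq obtain b' where
        b': "S (F ?b) (map F p) c = Some b'" "le b' (F a)" "le b' (G a)" by auto
      have "lv b' = Suc (tlv F j)" "lv b' = Suc (tlv G j)"
        using S_lev[OF b'(1)] lev_F[OF assms(1), of ?b] lev_F[OF assms(2), of ?b] b eq by auto
      then have "lv b' = lv (F a)" "lv b' = lv (G a)"
        using lev_F[OF assms(1), of a] lev_F[OF assms(2), of a] j assms(4,5) by auto
      with b' le_lev_eq show ?thesis by metis
    qed (use assms(3) in auto)
  qed
qed

section \<open>Restrictions and canonical extensions\<close>

abbreviation rs where "rs F n \<equiv> restr le F (Suc n)"

lemma tildep_rs [simp]: "tildep le (rs F n) n = tlv F n"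
proof -
  have "lv (SOME a. lv a = n) = n" using someI_ex[OF ex_level] .
  then show ?thesis unfolding tildep_def tildeF_def restr_def by simp
qed

lemma rs_eq_iff: "rs F n = rs G n \<longleftrightarrow> (\<forall>a. lv a \<le> n \<longrightarrow> F a = G a)"
  unfolding restr_def fun_eq_iff by (auto simp: less_Suc_eq_le)

lemma rs_eqI: "F \<in> MM n \<Longrightarrow> G \<in> MM n \<Longrightarrow> (\<And>a. a \<in> T n \<Longrightarrow> F a = G a) \<Longrightarrow> rs F n = rs G n"
  unfolding rs_eq_iff using MM_id by (metis in_T le_neq_implies_less)

abbreviation K where "K n u \<equiv> canon le M u n"

text \<open>Attaining every level from \<open>tlv F n\<close> on forces the level function to grow
  by exactly one beyond \<open>n\<close>; existence and uniqueness of such an extension resolve the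
  definite description.\<close>

lemma canon:
  assumes F: "F \<in> M"
  shows "K n (rs F n) \<in> M" "\<And>a. lv a \<le> n \<Longrightarrow> K n (rs F n) a = F a"
    "\<And>i. tlv (K n (rs F n)) (n + i) = tlv F n + i"
proof -
  let ?P = "\<lambda>G. G \<in> M \<and> rs G n = rs F n \<and> (\<forall>l\<ge>tlv F n. l \<in> limg le G)"
  have full: "tlv G (Suc i) = Suc (tlv G i)" if G: "?P G" and i: "n \<le> i" for G i
  proof -
    have "tlv G n = tlv F n" using G lev_F F ex_level[of n] unfolding rs_eq_iff by (metis order_refl)
    then have "tlv F n \<le> Suc (tlv G i)"
      using strict_mono_less_eq[OF tl_strict, of G n i] G i by simp
    then obtain j where j: "Suc (tlv G i) = tlv G j" using G limg_range[of G] by auto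
    then have "i < j" using strict_mono_less[OF tl_strict, of G i j] G by auto
    then have "tlv G (Suc i) \<le> tlv G j" using strict_mono_less_eq[OF tl_strict, of G "Suc i" j] G by simp
    moreover have "tlv G i < tlv G (Suc i)" using strict_mono_less[OF tl_strict, of G] G by simp
    ultimately show ?thesis using j by simp
  qed
  from ex_full_extension[OF F, of n] obtain G where G: "G \<in> M" "\<forall>a. lv a \<le> n \<longrightarrow> G a = F a"
    "\<And>i. tlv G (n + i) = tlv F n + i" by blast
  have "l \<in> limg le G" if "tlv F n \<le> l" for l
    unfolding limg_range[OF G(1)] using G(3)[of "l - tlv F n"] that by (intro range_eqI[of _ _ "n + (l - tlv F n)"]) simp
  then have PG: "?P G" using G unfolding rs_eq_iff by auto
  have uniq: "H = G" if H: "?P H" for H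
    using full_extension_unique[of H G n] full[OF H] full[OF PG] H PG rs_eq_iff by metis
  have "K n (rs F n) = (THE G. ?P G)" unfolding canon_def tildep_rs ..
  also have "\<dots> = G"
  proof (rule the_equality)
    show "?P G" by (rule PG)
    show "\<And>H. ?P H \<Longrightarrow> H = G" by (rule uniq)
  qed
  finally have eq: "K n (rs F n) = G" .
  show "K n (rs F n) \<in> M" "\<And>a. lv a \<le> n \<Longrightarrow> K n (rs F n) a = F a"
    "\<And>i. tlv (K n (rs F n)) (n + i) = tlv F n + i" unfolding eq using G by blast+
qed

section \<open>Entries and lifts\<close>

definition A :: "nat \<Rightarrow> ('a \<Rightarrow> 'a option) set" where
  "A n = AMnk le M n 1"

text \<open>Off by one: \<open>u\<close> sends level \<open>n\<close> to level
  \<open>E n u - 1\<close>, and the next entry starts among successors of these nodes, at level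
  \<open>E n u\<close>.\<close>

definition E :: "nat \<Rightarrow> ('a \<Rightarrow> 'a option) \<Rightarrow> nat" where
  "E n u = Suc (tildep le u n)"

lemma A_iff: "u \<in> A n \<longleftrightarrow> (\<exists>F\<in>MM n. u = rs F n)"
  by (auto simp: A_def AMnk_def)

lemma rs_A: "F \<in> MM n \<Longrightarrow> rs F n \<in> A n"
  using A_iff by blast

lemma E_rs [simp]: "E n (rs F n) = Suc (tlv F n)"
  by (simp add: E_def)

lemma K_rs: "F \<in> MM n \<Longrightarrow> K n (rs F n) \<in> MM n" "F \<in> MM n \<Longrightarrow> lv a \<le> n \<Longrightarrow> K n (rs F n) a = F a"
    "F \<in> MM n \<Longrightarrow> tlv (K n (rs F n)) (n + i) = tlv F n + i"
  using canon[OF MM_M, of F n] MM_id[of F n] unfolding Mn_def by auto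

lemma K_A: "u \<in> A n \<Longrightarrow> K n u \<in> MM n" "u \<in> A n \<Longrightarrow> rs (K n u) n = u"
    "u \<in> A n \<Longrightarrow> tlv (K n u) n = E n u - 1" "u \<in> A n \<Longrightarrow> tlv (K n u) (Suc n) = E n u"
  "u \<in> A n \<Longrightarrow> Suc (tlv (K n u) n) = E n u"
proof -
  assume "u \<in> A n"
  then obtain F where F: "F \<in> MM n" "u = rs F n" using A_iff by blast
  then show "K n u \<in> MM n" "rs (K n u) n = u" "tlv (K n u) n = E n u - 1" "tlv (K n u) (Suc n) = E n u"
    "Suc (tlv (K n u) n) = E n u"
    using K_rs[OF F(1)] K_rs(3)[OF F(1), of 0] K_rs(3)[OF F(1), of 1] by (auto simp: rs_eq_iff)
qed

lemma E_gt: "u \<in> A n \<Longrightarrow> n < E n u"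
  using A_iff MM_tl_ge by (auto simp: less_Suc_eq_le)

sublocale step_system A E
  by unfold_locales (rule E_gt)

text \<open>One step of the lift without the canonical extension: the successor of
  \<open>F a\<close> has to carry a label available at \<open>a\<close>. Only the values of
  \<open>F\<close> on \<open>X\<close> enter; \<open>canon_succs\<close> gives the agreement with
  the original description.\<close>

definition lift1 :: "('a \<Rightarrow> 'a) \<Rightarrow> 'a set \<Rightarrow> 'a set" where
  "lift1 F X = {y. \<exists>a\<in>X. \<exists>p c x. S a p c = Some x \<and> S (F a) p c = Some y}"

fun lifts :: "nat \<Rightarrow> ('a \<Rightarrow> 'a option) list \<Rightarrow> 'a set \<Rightarrow> 'a set" where
  "lifts n [] X = X"
| "lifts n (u # us) X = lifts (E n u) us (lift1 (K n u) X)"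

lemma lift1_cong: "(\<And>a. a \<in> X \<Longrightarrow> F a = G a) \<Longrightarrow> lift1 F X = lift1 G X"
  unfolding lift1_def by auto

lemma lift1_mono: "X \<subseteq> Y \<Longrightarrow> lift1 F X \<subseteq> lift1 F Y"
  unfolding lift1_def by blast

lemma lift1_UN: "y \<in> lift1 F X \<longleftrightarrow> (\<exists>a\<in>X. y \<in> lift1 F {a})"
  unfolding lift1_def by blast

lemma lift1_single:
  assumes F: "F \<in> MM n" and a: "a \<in> T n" and y: "y \<in> lift1 F {a}"
  shows "lv y = Suc (tlv F n)" "le (F a) y" "le a y" "trunc y n = a" "trunc y (tlv F n) = F a"
proof -
  from y obtain p c where p: "S (F a) p c = Some y" unfolding lift1_def by blast
  have l: "lv (F a) = tlv F n" using MM_lev[OF F] a by simp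
  show "lv y = Suc (tlv F n)" using S_lev[OF p] l by simp
  show 1: "le (F a) y" using S_le[OF p] .
  show 2: "le a y" using le_trans[OF MM_ge[OF F] 1] a by simp
  show "trunc y n = a" using trunc_eq[OF 2] a by simp
  show "trunc y (tlv F n) = F a" using trunc_eq[OF 1 l] .
qed

lemma canon_succs:
  assumes u: "u \<in> A n" and X: "X \<subseteq> T n"
  shows "K n u ` succs le X = lift1 (K n u) X"
proof -
  note KA = K_A[OF u]
  have key: "S (K n u a) p c = Some (K n u b)" if "a \<in> X" "S a p c = Some b" for a p c b
  proof -
    have a: "lv a = n" using that X by auto
    from MM_S[OF KA(1) a that(2)] obtain b' where b': "S (K n u a) p c = Some b'" "le b' (K n u b)" by blast
    have "lv b' = Suc (tlv (K n u) n)" using S_lev[OF b'(1)] MM_lev[OF KA(1) a] by simp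
    moreover have "lv (K n u b) = E n u" using lev_F[OF MM_M[OF KA(1)], of b] S_lev[OF that(2)] a KA(4) by simp
    ultimately have "b' = K n u b" using le_lev_eq[OF b'(2)] KA(5) by simp
    with b'(1) show ?thesis by simp
  qed
  show ?thesis
  proof (intro set_eqI iffI)
    fix y assume "y \<in> K n u ` succs le X"
    then obtain a b where ab: "a \<in> X" "le a b" "lv b = Suc (lv a)" "y = K n u b"
      unfolding succs_def immsucc_iff by blast
    from S_total[OF ab(2,3)] obtain p c where "S a p c = Some b" by blast
    with key ab show "y \<in> lift1 (K n u) X" unfolding lift1_def by blast
  next
    fix y assume "y \<in> lift1 (K n u) X"
    then obtain a p c b where a: "a \<in> X" "S a p c = Some b" "S (K n u a) p c = Some y"
      unfolding lift1_def by blast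
    have "y = K n u b" using key[OF a(1,2)] a(3) by simp
    moreover have "b \<in> succs le X" unfolding succs_def immsucc_iff using a S_le S_lev by blast
    ultimately show "y \<in> K n u ` succs le X" by blast
  qed
qed

lemma lift1_T: "F \<in> MM n \<Longrightarrow> X \<subseteq> T n \<Longrightarrow> lift1 F X \<subseteq> T (Suc (tlv F n))"
proof
  fix y assume F: "F \<in> MM n" and X: "X \<subseteq> T n" and "y \<in> lift1 F X"
  then obtain a where "a \<in> X" "y \<in> lift1 F {a}" using lift1_UN by blast
  with lift1_single(1)[OF F] X show "y \<in> T (Suc (tlv F n))" by auto
qed

text \<open>The base point of a lifted node is its predecessor on level \<open>n\<close>, so the
  lift over the full level determines the lifts over all its subsets. This is why \<open>fit\<close>
  compares full levels only.\<close>

lemma lift1_iff: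
  assumes "F \<in> MM n" "X \<subseteq> T n"
  shows "y \<in> lift1 F X \<longleftrightarrow> y \<in> lift1 F (T n) \<and> trunc y n \<in> X"
proof
  assume "y \<in> lift1 F X"
  then obtain a where a: "a \<in> X" "y \<in> lift1 F {a}" using lift1_UN by blast
  with lift1_single(4)[OF assms(1), of a y] assms(2) lift1_mono[OF assms(2)]
  show "y \<in> lift1 F (T n) \<and> trunc y n \<in> X" by (metis lift1_UN subsetD)
next
  assume y: "y \<in> lift1 F (T n) \<and> trunc y n \<in> X"
  then obtain a where a: "a \<in> T n" "y \<in> lift1 F {a}" using lift1_UN by blast
  with lift1_single(4)[OF assms(1) a] y show "y \<in> lift1 F X" using lift1_UN by metis
qed

lemma lifts_mono: "X \<subseteq> Y \<Longrightarrow> lifts n us X \<subseteq> lifts n us Y"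
  by (induction us arbitrary: n X Y) (simp_all add: lift1_mono)

lemma lifts_append: "lifts n (us @ vs) X = lifts (endl n us) vs (lifts n us X)"
  by (induction us arbitrary: n X) simp_all

lemma lift1_K_T: "u \<in> A n \<Longrightarrow> X \<subseteq> T n \<Longrightarrow> lift1 (K n u) X \<subseteq> T (E n u)"
  using lift1_T[OF K_A(1)] K_A(5) by metis

lemma lifts_T: "chain n us \<Longrightarrow> X \<subseteq> T n \<Longrightarrow> lifts n us X \<subseteq> T (endl n us)"
proof (induction us arbitrary: n X)
  case (Cons u us)
  then show ?case using lift1_K_T[of u n X] by simp
qed simp

lemma lifts_iff: "chain n us \<Longrightarrow> X \<subseteq> T n \<Longrightarrow> y \<in> lifts n us X \<longleftrightarrow> y \<in> lifts n us (T n) \<and> trunc y n \<in> X"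
proof (induction us arbitrary: n X)
  case Nil
  then show ?case using trunc_eq[of y y] by auto
next
  case (Cons u us)
  let ?e = "E n u"
  have u: "u \<in> A n" and us: "chain ?e us" using Cons.prems by auto
  note K = K_A(1)[OF u]
  have sub: "lift1 (K n u) X \<subseteq> T ?e" "lift1 (K n u) (T n) \<subseteq> T ?e" using lift1_K_T[OF u] Cons.prems by auto
  have tt: "trunc (trunc y ?e) n = trunc y n" if "y \<in> lifts ?e us (T ?e)"
  proof -
    have "lv y = endl ?e us" using lifts_T[OF us order_refl] that by auto
    then show ?thesis using trunc_trunc[of n ?e y] endl_ge[OF us] E_gt[OF u] by simp
  qed
  have "y \<in> lifts n (u # us) X \<longleftrightarrow> y \<in> lifts ?e us (T ?e) \<and> trunc y ?e \<in> lift1 (K n u) X"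
    using Cons.IH[OF us sub(1)] by simp
  also have "\<dots> \<longleftrightarrow> y \<in> lifts ?e us (T ?e) \<and> trunc y ?e \<in> lift1 (K n u) (T n) \<and> trunc y n \<in> X"
    by (cases "y \<in> lifts ?e us (T ?e)") (simp_all add: lift1_iff[OF K Cons.prems(2)] tt)
  also have "\<dots> \<longleftrightarrow> y \<in> lifts n (u # us) (T n) \<and> trunc y n \<in> X"
    using Cons.IH[OF us sub(2)] by simp
  finally show ?case .
qed

definition fit :: "nat \<Rightarrow> ('a \<Rightarrow> 'a option) list \<Rightarrow> ('a \<Rightarrow> 'a option) \<Rightarrow> bool" where
  "fit n us e \<longleftrightarrow> chain n us \<and> e \<in> A n \<and> E n e = endl n us \<and> lift1 (K n e) (T n) \<subseteq> lifts n us (T n)"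

sublocale fit_system A E fit
  by unfold_locales

lemma fits_lifts: "fits n vs us \<Longrightarrow> X \<subseteq> T n \<Longrightarrow> lifts n vs X \<subseteq> lifts n us X"
proof (induction vs arbitrary: n us X)
  case (Cons v vs)
  from Cons.prems(1) obtain us1 us2 where us: "us = us1 @ us2" "fit n us1 v" "fits (E n v) vs us2"
    by auto
  have v: "v \<in> A n" "chain n us1" "E n v = endl n us1" "lift1 (K n v) (T n) \<subseteq> lifts n us1 (T n)"
    using us(2) unfolding fit_def by auto
  have "lift1 (K n v) X \<subseteq> lifts n us1 X"
    using lift1_iff[OF K_A(1)[OF v(1)] Cons.prems(2)] lifts_iff[OF v(2) Cons.prems(2)] v(4) by blast
  then have "lifts (E n v) us2 (lift1 (K n v) X) \<subseteq> lifts n us X"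
    unfolding us(1) lifts_append v(3) by (rule lifts_mono)
  moreover have "lifts (E n v) vs (lift1 (K n v) X) \<subseteq> lifts (E n v) us2 (lift1 (K n v) X)"
    using Cons.IH[OF us(3)] lift1_K_T[OF v(1) Cons.prems(2)] .
  ultimately show ?case by simp
qed simp

lemma fits_endl: "fits n vs us \<Longrightarrow> endl n vs = endl n us"
proof (induction vs arbitrary: n us)
  case (Cons v vs)
  from Cons.prems obtain us1 us2 where us: "us = us1 @ us2" "fit n us1 v" "fits (E n v) vs us2"
    by auto
  from us(2) have "E n v = endl n us1" unfolding fit_def by blast
  with Cons.IH[OF us(3)] us(1) show ?case by simp
qed simp

text \<open>An entry is the identity below level \<open>n\<close>, and its values on the finite
  level \<open>n\<close> lie on one finite level given by its end.\<close>

lemma finite_A: "finite {u \<in> A n. E n u = e}"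
proof -
  let ?r = "\<lambda>u. restrict (K n u) (T n)"
  have "inj_on ?r {u \<in> A n. E n u = e}"
  proof (rule inj_onI)
    fix u v assume u: "u \<in> {u \<in> A n. E n u = e}" and v: "v \<in> {u \<in> A n. E n u = e}" and eq: "?r u = ?r v"
    have "K n u a = K n v a" if "a \<in> T n" for a
      using fun_cong[OF eq, of a] that by (simp only: restrict_apply if_True)
    then have "rs (K n u) n = rs (K n v) n" using u v K_A(1) by (intro rs_eqI) auto
    then show "u = v" using u v K_A(2) by auto
  qed
  moreover have "?r ` {u \<in> A n. E n u = e} \<subseteq> T n \<rightarrow>\<^sub>E T (e - 1)"
  proof -
    have "lv (K n u a) = E n u - 1" if "u \<in> A n" "lv a = n" for u a
      using MM_lev[OF K_A(1)] K_A(3) that by simp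
    then show ?thesis by (auto simp del: One_nat_def)
  qed
  moreover have "finite (T n \<rightarrow>\<^sub>E T (e - 1))" by (rule finite_PiE) (rule finite_T)+
  ultimately show ?thesis by (meson finite_imageD finite_subset)
qed

sublocale fit_space A E fit
proof
  show "\<And>n us u. fit n us u \<Longrightarrow> u \<in> A n" "\<And>n us u. fit n us u \<Longrightarrow> E n u = endl n us"
    by (simp_all add: fit_def)
  show "\<And>u n. u \<in> A n \<Longrightarrow> fit n [u] u" by (simp add: fit_def)
  fix n vs us u
  show "fit n us u" if "chain n us" "fits n vs us" "fit n vs u"
    using that fits_lifts[OF that(2) order_refl] fits_endl[OF that(2)] unfolding fit_def by auto
  show "finite {u. fit n us u}"
    by (rule finite_subset[OF _ finite_A[of n "endl n us"]]) (auto simp: fit_def)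
qed

lemma fit_rs: "F \<in> MM n \<Longrightarrow> fit n us (rs F n) \<longleftrightarrow>
    chain n us \<and> Suc (tlv F n) = endl n us \<and> lift1 F (T n) \<subseteq> lifts n us (T n)"
proof -
  assume F: "F \<in> MM n"
  have "lift1 (K n (rs F n)) (T n) = lift1 F (T n)" using K_rs(2)[OF F] by (intro lift1_cong) auto
  then show ?thesis unfolding fit_def using rs_A[OF F] by auto
qed

end

context SM_tree
begin

section \<open>The pigeonhole principle\<close>

text \<open>\<open>Fit\<close> is \<open>fit\<close> for total maps in place of their restrictions. \<open>FS n us f\<close> is the state after
  the segment \<open>us\<close> has been traversed but before the next entry acts: \<open>f\<close> has already chosen
  successors, so its values lie in the lift, at level \<open>endl n us\<close>.\<close>

definition FS :: "nat \<Rightarrow> ('a \<Rightarrow> 'a option) list \<Rightarrow> ('a \<Rightarrow> 'a) \<Rightarrow> bool" where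
  "FS n us f \<longleftrightarrow> f \<in> MM n \<and> tlv f n = endl n us \<and> f ` T n \<subseteq> lifts n us (T n)"

definition Fit :: "nat \<Rightarrow> ('a \<Rightarrow> 'a option) list \<Rightarrow> ('a \<Rightarrow> 'a) \<Rightarrow> bool" where
  "Fit n us F \<longleftrightarrow> F \<in> MM n \<and> fit n us (rs F n)"

definition Op :: "nat \<Rightarrow> (nat \<Rightarrow> ('a \<Rightarrow> 'a option)) \<Rightarrow> ('a \<Rightarrow> 'a) \<Rightarrow> bool" where
  "Op n U F \<longleftrightarrow> (\<exists>k. Fit n (seg U 0 k) F)"

lemma FS_D: "FS n us f \<Longrightarrow> f \<in> MM n" "FS n us f \<Longrightarrow> tlv f n = endl n us"
    "FS n us f \<Longrightarrow> a \<in> T n \<Longrightarrow> f a \<in> lifts n us (T n)" "FS n us f \<Longrightarrow> lv a = n \<Longrightarrow> lv (f a) = endl n us"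
  unfolding FS_def using MM_lev[of f n a] by auto

lemma Fit_D: "Fit n us F \<Longrightarrow> F \<in> MM n" "Fit n us F \<Longrightarrow> chain n us" "Fit n us F \<Longrightarrow> Suc (tlv F n) = endl n us"
    "Fit n us F \<Longrightarrow> lift1 F (T n) \<subseteq> lifts n us (T n)"
  unfolding Fit_def using fit_rs[of F n us] by auto

lemma Fit_I: "F \<in> MM n \<Longrightarrow> chain n us \<Longrightarrow> Suc (tlv F n) = endl n us \<Longrightarrow> lift1 F (T n) \<subseteq> lifts n us (T n) \<Longrightarrow>
    Fit n us F"
  unfolding Fit_def using fit_rs[of F n us] by blast

lemma lift1_I: "a \<in> X \<Longrightarrow> S a p c = Some x \<Longrightarrow> S (F a) p c = Some y \<Longrightarrow> y \<in> lift1 F X"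
  unfolding lift1_def by blast

lemma Fit_K: "u \<in> A n \<Longrightarrow> Fit n [u] (K n u)"
  unfolding Fit_def using K_A(1,2) fit_refl by simp

text \<open>A label available at \<open>a\<close> is available at \<open>f a\<close>, because its
  parameters lie below level \<open>n\<close> and are fixed. So the lift of the composition is
  contained in the lift of \<open>V\<close> over the values of \<open>f\<close>.\<close>

lemma Fit_comp:
  assumes f: "FS n us f" and us: "chain n us" and V: "Fit (endl n us) us' V"
  shows "Fit n (us @ us') (V \<circ> f)"
proof (rule Fit_I)
  let ?c = "endl n us"
  note f' = FS_D[OF f] and V' = Fit_D[OF V]
  show "V \<circ> f \<in> MM n" using MM_comp[OF V'(1) f'(1) endl_ge[OF us]] .
  show "chain n (us @ us')" using us V'(2) by simp
  show "Suc (tlv (V \<circ> f) n) = endl n (us @ us')"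
    using tl_comp[OF MM_M[OF V'(1)] MM_M[OF f'(1)]] f'(2) V'(3) by simp
  show "lift1 (V \<circ> f) (T n) \<subseteq> lifts n (us @ us') (T n)"
  proof
    fix y assume "y \<in> lift1 (V \<circ> f) (T n)"
    then obtain a p c x where a: "lv a = n" "S a p c = Some x" "S (V (f a)) p c = Some y"
      unfolding lift1_def by auto
    have fa: "f a \<in> T ?c" using f'(4) a by simp
    from MM_S[OF f'(1) a(1,2)] a(3) have y: "y \<in> lift1 V {f a}" unfolding lift1_def by auto
    then have "y \<in> lift1 V (T ?c)" using fa lift1_UN by blast
    moreover have "trunc y ?c = f a" using lift1_single(4)[OF V'(1) fa y] .
    moreover have "f a \<in> lifts n us (T n)" using f'(3) a(1) by simp
    ultimately show "y \<in> lifts n (us @ us') (T n)"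
      unfolding lifts_append using lifts_iff[OF V'(2) lifts_T[OF us order_refl]] V'(4) by auto
  qed
qed

lemma FS_comp:
  assumes f: "FS n us f" and us: "chain n us" "chain (endl n us) us'" and g: "FS (endl n us) us' g"
  shows "FS n (us @ us') (g \<circ> f)"
  unfolding FS_def
proof (intro conjI subsetI)
  let ?c = "endl n us"
  note f' = FS_D[OF f] and g' = FS_D[OF g]
  show "g \<circ> f \<in> MM n" using MM_comp[OF g'(1) f'(1) endl_ge[OF us(1)]] .
  show "tlv (g \<circ> f) n = endl n (us @ us')"
    using tl_comp[OF MM_M[OF g'(1)] MM_M[OF f'(1)]] f'(2) g'(2) by simp
  fix y assume "y \<in> (g \<circ> f) ` T n"
  then obtain a where a: "lv a = n" "y = g (f a)" by auto
  have fa: "lv (f a) = ?c" using f'(4) a by simp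
  have "y \<in> lifts ?c us' (T ?c)" using g'(3)[of "f a"] fa a by simp
  moreover have "trunc y ?c = f a" using trunc_eq[OF MM_ge[OF g'(1) fa] fa] a by simp
  moreover have "f a \<in> lifts n us (T n)" using f'(3) a(1) by simp
  ultimately show "y \<in> lifts n (us @ us') (T n)"
    unfolding lifts_append using lifts_iff[OF us(2) lifts_T[OF us(1) order_refl]] by simp
qed

lemma FS_Nil: "FS n [] id"
  unfolding FS_def using MM_idI by simp

lemma MM_eq_level: "F \<in> MM n \<Longrightarrow> tlv F n = n \<Longrightarrow> lv a = n \<Longrightarrow> F a = a"
  using MM_ge MM_lev le_lev_eq by metis

lemma FS_mono: "fits n vs us \<Longrightarrow> FS n vs f \<Longrightarrow> FS n us f"
  unfolding FS_def using fits_lifts[of n vs us "T n"] fits_endl[of n vs us] by auto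

text \<open>Truncating \<open>F\<close> to the level where \<open>u\<close> starts recovers the
  state before \<open>u\<close>. This converse of \<open>Fit_comp\<close> describes a fitted map as
  a state followed by one last entry.\<close>

lemma Fit_snoc:
  assumes u: "u \<in> A (endl n us)" and F: "Fit n (us @ [u]) F"
  shows "\<exists>f. FS n us f \<and> (\<forall>a\<in>T n. F a = K (endl n us) u (f a))"
proof -
  let ?c = "endl n us"
  let ?K = "K ?c u"
  note F' = Fit_D[OF F] and K = K_A[OF u]
  have us: "chain n us" using F'(2) by simp
  have tl: "tlv F n = tlv ?K ?c" using F'(3) K(5) by simp
  then have "?c \<le> tlv F n" using MM_tl_ge[OF K(1)] by simp
  with truncate[OF F'(1) endl_ge[OF us]] obtain f where
    f: "f \<in> MM n" "tlv f n = ?c" "\<And>a. a \<in> T n \<Longrightarrow> f a = trunc (F a) ?c" by blast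
  \<comment> \<open>A node may have no successors, and then its lift carries no information. If
    \<open>F\<close> moves level \<open>n\<close>, the successor of \<open>a\<close> on the way to
    \<open>F a\<close> supplies a label; otherwise all maps involved fix level
    \<open>n\<close>.\<close>
  have main: "f a \<in> lifts n us (T n) \<and> F a = ?K (f a)" if a: "lv a = n" for a
  proof (cases "tlv F n = n")
    case True
    then have c: "?c = n" using tl MM_tl_ge[OF K(1)] endl_ge[OF us] by simp
    then have "us = []" using endl_gt[OF us] by fastforce
    moreover have "F a = a" using MM_eq_level[OF F'(1) True a] .
    moreover have "?K a = a" using MM_eq_level[OF K(1), of a] tl True c a by simp
    moreover have "f a = a" using MM_eq_level[OF f(1), of a] f(2) c a by simp
    ultimately show ?thesis using a by simp
  next
    case False
    then have less: "Suc n \<le> lv (F a)" using MM_lev[OF F'(1) a] MM_tl_ge[OF F'(1)] by simp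
    let ?s = "trunc (F a) (Suc n)"
    have s: "le ?s (F a)" "lv ?s = Suc n" using trunc[OF less] by auto
    have "le a ?s" using le_below[OF MM_ge[OF F'(1) a] s(1)] a s(2) by simp
    from S_total[OF this] a s(2) obtain p c where "S a p c = Some ?s" by auto
    with MM_S[OF F'(1) a this] obtain y where y: "S (F a) p c = Some y" "S a p c = Some ?s" by blast
    then have "y \<in> lift1 F (T n)" using a by (intro lift1_I[of a]) auto
    then have "y \<in> lift1 ?K (lifts n us (T n))" using F'(4) by (auto simp: lifts_append)
    then obtain b where b: "b \<in> lifts n us (T n)" "y \<in> lift1 ?K {b}" using lift1_UN by blast
    have bT: "b \<in> T ?c" using b(1) lifts_T[OF us order_refl] by blast
    have "F a = trunc y (tlv ?K ?c)" using trunc_eq[OF S_le[OF y(1)]] MM_lev[OF F'(1) a] tl by simp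
    also have "\<dots> = ?K b" using lift1_single(5)[OF K(1) bT b(2)] .
    finally have Fa: "F a = ?K b" .
    have "f a = b" using f(3)[of a] a trunc_eq[OF MM_ge[OF K(1)], of b] bT Fa by simp
    with Fa b(1) show ?thesis by simp
  qed
  then have "FS n us f" unfolding FS_def using f by auto
  with main show ?thesis by auto
qed

lemma FS_snoc:
  assumes u: "u \<in> A (endl n us)" and us: "chain n us" and g: "FS n (us @ [u]) g"
  shows "\<exists>f. FS n us f \<and> (\<forall>a\<in>T n. g a \<in> lift1 (K (endl n us) u) {f a})"
proof -
  let ?c = "endl n us"
  note g' = FS_D[OF g] and K = K_A[OF u]
  have "?c \<le> tlv g n" using g'(2) E_gt[OF u] by simp
  with truncate[OF g'(1) endl_ge[OF us]] obtain f where
    f: "f \<in> MM n" "tlv f n = ?c" "\<And>a. a \<in> T n \<Longrightarrow> f a = trunc (g a) ?c" by blast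
  have main: "f a \<in> lifts n us (T n) \<and> g a \<in> lift1 (K ?c u) {f a}" if a: "a \<in> T n" for a
  proof -
    have "g a \<in> lift1 (K ?c u) (lifts n us (T n))" using g'(3)[OF a] by (simp add: lifts_append)
    then obtain b where b: "b \<in> lifts n us (T n)" "g a \<in> lift1 (K ?c u) {b}" using lift1_UN by blast
    have "b \<in> T ?c" using b(1) lifts_T[OF us order_refl] by blast
    from lift1_single(4)[OF K(1) this b(2)] f(3)[OF a] have "f a = b" by simp
    with b show ?thesis by simp
  qed
  then have "FS n us f" unfolding FS_def using f by auto
  with main show ?thesis by auto
qed

text \<open>The letter of a node at position \<open>j\<close> is the label \<open>(p, c)\<close> of the edge leaving its
  predecessor at level \<open>j\<close>.\<close>

definition letter :: "'a \<Rightarrow> nat \<Rightarrow> 'a list \<Rightarrow> 'c \<Rightarrow> bool" where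
  "letter b j p c \<longleftrightarrow> (\<exists>a x. lv a = j \<and> S a p c = Some x \<and> le x b)"

section \<open>Letters and the maps copying them\<close>

lemma letter_ex:
  assumes "j < lv b"
  shows "\<exists>p c. letter b j p c"
proof -
  let ?a = "trunc b j" and ?x = "trunc b (Suc j)"
  have a: "le ?a b" "lv ?a = j" and x: "le ?x b" "lv ?x = Suc j"
    using trunc[of j b] trunc[of "Suc j" b] assms by auto
  have "le ?a ?x" using le_below[OF a(1) x(1)] a x by simp
  from S_total[OF this] a x show ?thesis unfolding letter_def by auto
qed

lemma letter_mono: "letter b j p c \<Longrightarrow> le b b' \<Longrightarrow> letter b' j p c"
  unfolding letter_def using le_trans by blast

lemma letter_S: "S b p c = Some y \<Longrightarrow> letter y (lv b) p c"
  unfolding letter_def using le_refl by blast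

lemma letter_lower:
  assumes "letter b' j p c" "le b b'" "j < lv b"
  shows "letter b j p c"
proof -
  from assms(1) obtain a x where x: "lv a = j" "S a p c = Some x" "le x b'" unfolding letter_def by blast
  have "lv x \<le> lv b" using S_lev[OF x(2)] x(1) assms(3) by simp
  from le_below[OF x(3) assms(2) this] x show ?thesis unfolding letter_def by blast
qed

definition copy :: "nat \<Rightarrow> nat \<Rightarrow> 'a \<Rightarrow> 'a" where
  "copy j m = (SOME F. F \<in> M \<and> limg le F = UNIV - {m} \<and>
     (\<forall>a b p c x. lv a = j \<and> lv b = m \<and> S a p c = Some x \<and> le x b \<longrightarrow> S b p c = Some (F b)))"

lemma copy:
  assumes "j < m"
  shows "copy j m \<in> MM m" "tlv (copy j m) m = Suc m"
    "\<And>b p c. lv b = m \<Longrightarrow> letter b j p c \<Longrightarrow> S b p c = Some (copy j m b)"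
proof -
  let ?P = "\<lambda>F. F \<in> M \<and> limg le F = UNIV - {m} \<and>
     (\<forall>a b p c x. lv a = j \<and> lv b = m \<and> S a p c = Some x \<and> le x b \<longrightarrow> S b p c = Some (F b))"
  from M3[OF assms] have "\<exists>F. ?P F" unfolding Bex_def .
  then have P: "?P (copy j m)" unfolding copy_def by (rule someI_ex)
  show "copy j m \<in> MM m" "tlv (copy j m) m = Suc m" using skip_only[of "copy j m" m] P by auto
  show "\<And>b p c. lv b = m \<Longrightarrow> letter b j p c \<Longrightarrow> S b p c = Some (copy j m b)"
    using P unfolding letter_def by blast
qed

definition copy_step :: "nat \<Rightarrow> ('a \<Rightarrow> 'a option) \<Rightarrow> nat \<Rightarrow> 'a \<Rightarrow> 'a" where
  "copy_step c u j = copy j (tlv (K c u) c) \<circ> K c u"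

lemma copy_step:
  assumes u: "u \<in> A c" and j: "j < c"
  shows "copy_step c u j \<in> MM c" "tlv (copy_step c u j) c = E c u"
    "\<And>b p q. lv b = c \<Longrightarrow> letter b j p q \<Longrightarrow> S (K c u b) p q = Some (copy_step c u j b)"
    "FS c [u] (copy_step c u j)"
proof -
  let ?m = "tlv (K c u) c"
  note K = K_A[OF u]
  have jm: "j < ?m" using j MM_tl_ge[OF K(1)] by simp
  note rp = copy[OF jm]
  show 1: "copy_step c u j \<in> MM c" unfolding copy_step_def using MM_comp[OF rp(1) K(1) MM_tl_ge[OF K(1)]] .
  show 2: "tlv (copy_step c u j) c = E c u"
    unfolding copy_step_def using tl_comp[OF MM_M[OF rp(1)] MM_M[OF K(1)]] rp(2) K(5) by simp
  show 3: "S (K c u b) p q = Some (copy_step c u j b)" if "lv b = c" "letter b j p q" for b p q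
    using rp(3)[of "K c u b" p q] MM_lev[OF K(1) that(1)] letter_mono[OF that(2) MM_ge[OF K(1) that(1)]]
    by (simp add: copy_step_def)
  \<comment> \<open>The lift asks for the label at \<open>b\<close> itself as well; as
    \<open>j < c\<close>, copying at level \<open>c\<close> yields such a successor of
    \<open>b\<close>.\<close>
  have "copy_step c u j b \<in> lift1 (K c u) (T c)" if b: "lv b = c" for b
  proof -
    from letter_ex[of j b] j b obtain p q where l: "letter b j p q" by auto
    from copy(3)[OF j b l] 3[OF b l] b show ?thesis by (intro lift1_I[of b]) auto
  qed
  then show "FS c [u] (copy_step c u j)" unfolding FS_def using 1 2 by auto
qed

text \<open>Automatic at positive levels by (M3), so it is a genuine condition only at level
  0.\<close>

definition can_skip :: "nat \<Rightarrow> bool" where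
  "can_skip n \<longleftrightarrow> (\<exists>F\<in>MM n. tlv F n = Suc n)"

lemma can_skip_pos: "0 < n \<Longrightarrow> can_skip n"
  unfolding can_skip_def using copy(1,2)[of 0 n] by blast

lemma FS_one:
  assumes "can_skip n" and u: "u \<in> A n"
  shows "\<exists>f. FS n [u] f"
proof -
  from assms obtain F where F: "F \<in> MM n" "tlv F n = Suc n" unfolding can_skip_def by blast
  note K = K_A[OF u]
  let ?f = "K n u \<circ> F"
  have "?f \<in> MM n" using MM_comp[OF K(1) F(1)] by simp
  moreover have "tlv ?f n = E n u" using tl_comp[OF MM_M[OF K(1)] MM_M[OF F(1)]] F(2) K(4) by simp
  moreover have "?f a \<in> lift1 (K n u) (T n)" if a: "lv a = n" for a
  proof -
    have "F a \<in> succs le (T n)"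
      unfolding succs_def immsucc_iff using MM_ge[OF F(1) a] MM_lev[OF F(1) a] F(2) a by auto
    with canon_succs[OF u order_refl] show ?thesis by auto
  qed
  ultimately show ?thesis unfolding FS_def by (intro exI[of _ ?f]) auto
qed

lemma FS_exists:
  assumes can_skip: "can_skip n" and U: "U \<in> R n"
  shows "\<exists>f. FS n (seg U 0 k) f"
proof (induction k)
  case 0
  show ?case using FS_Nil by auto
next
  case (Suc k)
  then obtain f where f: "FS n (seg U 0 k) f" by blast
  have c: "endl n (seg U 0 k) = cut n U k" "chain n (seg U 0 k)" using cut_seg[OF U, of 0 k] by auto
  have ndc: "can_skip (cut n U k)"
  proof (cases k)
    case (Suc j)
    then show ?thesis using cut_less[OF U, of 0 k] by (intro can_skip_pos) simp
  qed (use can_skip in simp)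
  note uA = R_A[OF U, of k]
  from FS_one[OF ndc uA] obtain g where "FS (cut n U k) [U k] g" by blast
  with FS_comp[OF f c(2), of "[U k]" g] uA c(1) show ?case by (auto simp: seg_Suc)
qed

text \<open>One entry of \<open>W\<close> is spent on each letter. Letters are meant to be levels
  below the start \<open>c\<close>, so they stay available for copying at all later cuts.\<close>

fun copy_word :: "nat \<Rightarrow> (nat \<Rightarrow> ('a \<Rightarrow> 'a option)) \<Rightarrow> nat list \<Rightarrow> 'a \<Rightarrow> 'a" where
  "copy_word c W [] = id"
| "copy_word c W (j # w) = copy_word (E c (W 0)) (shift W 1) w \<circ> copy_step c (W 0) j"

lemma FS_copy_word: "W \<in> R c \<Longrightarrow> set w \<subseteq> {..<c} \<Longrightarrow> FS c (seg W 0 (length w)) (copy_word c W w)"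
proof (induction w arbitrary: c W)
  case Nil
  show ?case by (simp only: copy_word.simps list.size seg_simps FS_Nil)
next
  case (Cons j w)
  have u: "W 0 \<in> A c" and W: "shift W 1 \<in> R (E c (W 0))" using Cons.prems(1) R_Suc[of W c] by auto
  have "set w \<subseteq> {..<E c (W 0)}" using Cons.prems(2) E_gt[OF u] by auto
  from Cons.IH[OF W this] have IH: "FS (E c (W 0)) (seg (shift W 1) 0 (length w)) (copy_word (E c (W 0)) (shift W 1) w)" .
  have "chain (E c (W 0)) (seg (shift W 1) 0 (length w))" using cut_seg(2)[OF W, of 0] by simp
  with FS_comp[OF copy_step(4)[OF u], of j] Cons.prems(2) u IH
  have 1: "FS c ([W 0] @ seg (shift W 1) 0 (length w)) (copy_word c W (j # w))" by simp
  have "[W 0] = seg W 0 1" by (simp add: seg_def)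
  then have 2: "[W 0] @ seg (shift W 1) 0 (length w) = seg W 0 (length (j # w))"
    using seg_append[of 0 1 "Suc (length w)" W] by simp
  show ?case using 1 unfolding 2 .
qed

lemma copy_word_append: "copy_word c W (w @ w') = copy_word (cut c W (length w)) (shift W (length w)) w' \<circ> copy_word c W w"
proof (induction w arbitrary: c W)
  case (Cons j w)
  have "cut (E c (W 0)) (shift W 1) (length w) = cut c W (Suc (length w))"
    using cut_shift[of c W 1 "length w"] by simp
  with Cons[of "E c (W 0)" "shift W 1"] show ?case by (simp add: comp_assoc)
qed simp

text \<open>At a variable both words copy the same label above the same node and reach the same
  successor; constant letters agree anyway. Both letters persist above \<open>y\<close>, so the
  induction goes on.\<close>

lemma copy_word_letters:
  "W \<in> R c \<Longrightarrow> set v \<subseteq> vletters c \<Longrightarrow> j < c \<Longrightarrow> m < c \<Longrightarrow> lv y = c \<Longrightarrow>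
    letter y j p q \<Longrightarrow> letter y m p q \<Longrightarrow> copy_word c W (fill j v) y = copy_word c W (fill m v) y"
proof (induction v arbitrary: c W y)
  case (Cons x v)
  have u: "W 0 \<in> A c" and W: "shift W 1 \<in> R (E c (W 0))" using Cons.prems(1) R_Suc[of W c] by auto
  note lt = E_gt[OF u]
  have v: "set v \<subseteq> vletters (E c (W 0))" using Cons.prems(2) lt by (auto simp: vletters_def)
  obtain i i' where i: "fill j (x # v) = i # fill j v" "fill m (x # v) = i' # fill m v" "i < c"
     "copy_step c (W 0) i y = copy_step c (W 0) i' y"
  proof (cases x)
    case None
    have "Some (copy_step c (W 0) j y) = Some (copy_step c (W 0) m y)"
      using copy_step(3)[OF u Cons.prems(3,5,6)] copy_step(3)[OF u Cons.prems(4,5,7)] by simp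
    with that None Cons.prems(3) show thesis by simp
  next
    case (Some b)
    then have "b < c" using Cons.prems(2) by (auto simp: vletters_def)
    with that Some show thesis by simp
  qed
  let ?y = "copy_step c (W 0) i y"
  note sti = copy_step[OF u i(3)]
  have le: "le y ?y" using MM_ge[OF sti(1) Cons.prems(5)] .
  have lev: "lv ?y = E c (W 0)" using MM_lev[OF sti(1) Cons.prems(5)] sti(2) by simp
  have "copy_word (E c (W 0)) (shift W 1) (fill j v) ?y = copy_word (E c (W 0)) (shift W 1) (fill m v) ?y"
    using Cons.IH[OF W v _ _ lev letter_mono[OF Cons.prems(6) le] letter_mono[OF Cons.prems(7) le]]
      Cons.prems(3,4) lt by simp
  then show ?case using i(4) unfolding i(1,2) by simp
qed simp

end

context SM_tree
begin

section \<open>Large sets of entries\<close>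

context
  fixes n :: nat and X :: "('a \<Rightarrow> 'a option) set"
begin

text \<open>The colouring lives on the entries starting at level \<open>n\<close>; \<open>H\<close> collects the maps with values on
  level \<open>m\<close> that can occur before the next entry \<open>v\<close> acts, and \<open>good H v\<close> says that \<open>v\<close> carries all
  of them into \<open>X\<close>.\<close>

definition base :: "nat \<Rightarrow> ('a \<Rightarrow> 'a) set \<Rightarrow> bool" where
  "base m H \<longleftrightarrow> n \<le> m \<and> H \<subseteq> {h \<in> MM n. tlv h n = m}"

definition good :: "('a \<Rightarrow> 'a) set \<Rightarrow> ('a \<Rightarrow> 'a) \<Rightarrow> bool" where
  "good H v \<longleftrightarrow> (\<forall>h\<in>H. rs (v \<circ> h) n \<in> X)"

text \<open>The states possible after \<open>z\<close>: a state \<open>h\<close>, then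
  \<open>z\<close>, then a simultaneous choice of successors. It replaces \<open>H\<close> at the
  next cut.\<close>

definition Succ :: "nat \<Rightarrow> ('a \<Rightarrow> 'a) set \<Rightarrow> ('a \<Rightarrow> 'a) \<Rightarrow> ('a \<Rightarrow> 'a) set" where
  "Succ m H z = {g \<in> MM n. tlv g n = Suc (tlv z m) \<and> (\<exists>h\<in>H. \<forall>a\<in>T n. g a \<in> lift1 z {h a})}"

definition large :: "nat \<Rightarrow> ('a \<Rightarrow> 'a) set \<Rightarrow> (nat \<Rightarrow> ('a \<Rightarrow> 'a option)) \<Rightarrow> bool" where
  "large m H U \<longleftrightarrow> U \<in> R m \<and> (\<forall>U'. sub m U' U \<longrightarrow> (\<exists>v. Op m U' v \<and> good H v))"

lemma base_D: "base m H \<Longrightarrow> n \<le> m" "base m H \<Longrightarrow> h \<in> H \<Longrightarrow> h \<in> MM n"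
    "base m H \<Longrightarrow> h \<in> H \<Longrightarrow> tlv h n = m" "base m H \<Longrightarrow> h \<in> H \<Longrightarrow> lv a = n \<Longrightarrow> lv (h a) = m"
  unfolding base_def using MM_lev by auto

lemma good_cong:
  assumes "base m H" "v \<in> MM m" "w \<in> MM m" "\<And>a. a \<in> T m \<Longrightarrow> v a = w a"
  shows "good H v \<longleftrightarrow> good H w"
proof -
  have "rs (v \<circ> h) n = rs (w \<circ> h) n" if h: "h \<in> H" for h
  proof (rule rs_eqI)
    note b = base_D[OF assms(1)]
    show "v \<circ> h \<in> MM n" "w \<circ> h \<in> MM n" using MM_comp assms(2,3) b(1) b(2)[OF h] by blast+
    show "(v \<circ> h) a = (w \<circ> h) a" if "a \<in> T n" for a using assms(4)[of "h a"] b(4)[OF h] that by simp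
  qed
  then show ?thesis unfolding good_def by simp
qed

lemma large_sub: "large m H U \<Longrightarrow> sub m V U \<Longrightarrow> large m H V"
  unfolding large_def using sub_R(1) sub_trans by blast

lemma Op_mono: "sub m V U \<Longrightarrow> Op m V v \<Longrightarrow> Op m U v"
  unfolding Op_def Fit_def using sub_fit by blast

lemma Op_MM: "Op m U v \<Longrightarrow> v \<in> MM m"
  unfolding Op_def using Fit_D(1) by blast

lemma Succ_base: "base m H \<Longrightarrow> z \<in> MM m \<Longrightarrow> base (Suc (tlv z m)) (Succ m H z)"
  unfolding base_def Succ_def using MM_tl_ge[of z m] by auto

lemma Succ_cong:
  assumes "base m H" "z \<in> MM m" "w \<in> MM m" "\<And>a. a \<in> T m \<Longrightarrow> z a = w a"
  shows "Succ m H z = Succ m H w"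
proof -
  obtain a where a: "lv a = m" using ex_level by blast
  have tl: "tlv z m = tlv w m" using MM_lev[OF assms(2) a] MM_lev[OF assms(3) a] assms(4)[of a] a by simp
  have "lift1 z {h a} = lift1 w {h a}" if "h \<in> H" "a \<in> T n" for h a
    using base_D(4)[OF assms(1) that(1), of a] that(2) assms(4)[of "h a"] by (intro lift1_cong) simp
  then show ?thesis unfolding Succ_def tl by auto
qed

text \<open>A large set is syndetic: otherwise fusing operations that avoid \<open>X\<close> after every legal
  prefix would produce a subsequence avoiding \<open>X\<close> altogether.\<close>

lemma syndetic:
  assumes b: "base m H" and can_skip: "can_skip m" and L: "large m H Y"
  shows "\<exists>k\<ge>1. \<forall>v. Op (cut m Y k) (shift Y k) v \<longrightarrow> (\<exists>f. FS m (seg Y 0 k) f \<and> good H (v \<circ> f))"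
proof (rule ccontr)
  assume "\<not> ?thesis"
  then have neg: "\<exists>v. Op (cut m Y k) (shift Y k) v \<and> (\<forall>f. FS m (seg Y 0 k) f \<longrightarrow> \<not> good H (v \<circ> f))"
    if "1 \<le> k" for k using that by blast
  have YR: "Y \<in> R m" using L unfolding large_def by blast
  have seg0: "endl m (seg Y 0 k) = cut m Y k" "chain m (seg Y 0 k)" for k
    using cut_seg[OF YR, of 0 k] by auto
  \<comment> \<open>The fusion starts at index 0, whereas the claim has \<open>k \<ge> 1\<close>,
    because later the first entry of \<open>Y\<close> must belong to the prefix. A failure at index
    1 is moved to index 0 by composing with one step.\<close>
  have avoid: "\<exists>v. Op (cut m Y k) (shift Y k) v \<and> (\<forall>f. FS m (seg Y 0 k) f \<longrightarrow> \<not> good H (v \<circ> f))" for k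
  proof (cases "1 \<le> k")
    case True
    then show ?thesis by (rule neg)
  next
    case False
    then have k: "k = 0" by simp
    from neg[OF order_refl] obtain v where v: "Op (cut m Y 1) (shift Y 1) v"
      "\<And>f. FS m (seg Y 0 1) f \<Longrightarrow> \<not> good H (v \<circ> f)" by blast
    from FS_exists[OF can_skip YR, of 1] obtain f where f: "FS m (seg Y 0 1) f" by blast
    from v(1) obtain i where "Fit (cut m Y 1) (seg (shift Y 1) 0 i) v" unfolding Op_def by blast
    with Fit_comp[OF f seg0(2)] have "Fit m (seg Y 0 1 @ seg Y 1 (1 + i)) (v \<circ> f)"
      by (simp add: seg0)
    then have "Op m Y (v \<circ> f)" unfolding Op_def using seg_append[of 0 1 "1 + i" Y] by auto
    moreover have "\<not> good H ((v \<circ> f) \<circ> f')" if "FS m [] f'" for f'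
    proof -
      have "FS m (seg Y 0 1) (f \<circ> f')" using FS_comp[OF that] seg0 f by simp
      with v(2) show ?thesis by (simp add: comp_assoc)
    qed
    ultimately show ?thesis unfolding k by auto
  qed
  let ?Q = "\<lambda>c k W. c = cut m Y k \<and> W = shift Y k"
  let ?T = "\<lambda>c k u (k'::nat). \<exists>v\<in>MM c. u = rs v c \<and> (\<forall>f. FS m (seg Y 0 k) f \<longrightarrow> \<not> good H (v \<circ> f))"
  have "\<exists>U f. sub m U Y \<and> f 0 = 0 \<and>
    (\<forall>k. ?T (cut m U k) (f k) (U k) (f (Suc k)) \<and>
      (\<exists>W. ?Q (cut m U k) (f k) W \<and> sub (cut m U k) (shift U k) W))"
  proof (rule fusion)
    show "?Q m 0 Y" "Y \<in> R m" using YR by simp_all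
    fix c k W assume Q: "?Q c k W"
    from avoid obtain v where v: "Op (cut m Y k) (shift Y k) v"
      "\<forall>f. FS m (seg Y 0 k) f \<longrightarrow> \<not> good H (v \<circ> f)" by blast
    from v(1) obtain i where i: "Fit c (seg W 0 i) v" unfolding Op_def using Q by blast
    have "fit c (seg W 0 i) (rs v c)" using i unfolding Fit_def by blast
    moreover have "sub (cut c W i) (shift Y (k + i)) (shift W i)"
      using sub_refl[OF shift_R[OF YR, of "k + i"]] Q by simp
    moreover have "?Q (cut c W i) (k + i) (shift Y (k + i))" using Q by simp
    moreover have "?T c k (rs v c) (k + i)" using v(2) Fit_D(1)[OF i] by blast
    ultimately show "\<exists>u i k' W'. fit c (seg W 0 i) u \<and> sub (cut c W i) W' (shift W i) \<and>
      ?Q (cut c W i) k' W' \<and> ?T c k u k'" by blast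
  qed
  then obtain U col where U: "sub m U Y" and T: "\<And>k. ?T (cut m U k) (col k) (U k) (col (Suc k))"
    and c: "\<And>k. cut m U k = cut m Y (col k)" by blast
  from L U obtain v where v: "Op m U v" "good H v" unfolding large_def by blast
  from v(1) obtain j where j: "Fit m (seg U 0 j) v" unfolding Op_def by blast
  then have "j \<noteq> 0" using fit_Nil unfolding Fit_def by (intro notI) simp
  then obtain i where i: "j = Suc i" by (cases j) auto
  note UR = sub_R(1)[OF U]
  have e: "endl m (seg U 0 i) = cut m U i" using cut_seg(1)[OF UR, of 0 i] by simp
  from j have "Fit m (seg U 0 i @ [U i]) v" by (simp add: i seg_Suc)
  from Fit_snoc[OF _ this] R_A[OF UR, of i] e obtain f where
    f: "FS m (seg U 0 i) f" "\<forall>a\<in>T m. v a = K (cut m U i) (U i) (f a)" by auto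
  \<comment> \<open>A state along \<open>U\<close> is also a state along \<open>Y\<close>, up to the
    index recorded by \<open>col\<close>; so \<open>U i\<close> was chosen to fail after this very
    \<open>f\<close>.\<close>
  from sub_fits[OF U, of i] obtain r where r: "cut m Y r = cut m U i" "fits m (seg U 0 i) (seg Y 0 r)"
    by blast
  have "r = col i" using r(1) c cut_inj[OF YR] by simp
  with FS_mono[OF r(2) f(1)] have fY: "FS m (seg Y 0 (col i)) f" by simp
  from T[of i] obtain w where w: "w \<in> MM (cut m U i)" "U i = rs w (cut m U i)"
    "\<And>f. FS m (seg Y 0 (col i)) f \<Longrightarrow> \<not> good H (w \<circ> f)" by blast
  have "v a = (w \<circ> f) a" if a: "a \<in> T m" for a
  proof -
    have "lv (f a) = cut m U i" using FS_D(4)[OF f(1)] a e by simp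
    then show ?thesis using f(2) a K_rs(2)[OF w(1), of "f a"] w(2) by simp
  qed
  moreover have "w \<circ> f \<in> MM m" using MM_comp[OF w(1) FS_D(1)[OF f(1)]] cut_le[OF UR, of 0 i] by simp
  ultimately have "good H (w \<circ> f)" using good_cong[OF b Fit_D(1)[OF j]] v(2) by blast
  with w(3)[OF fY] show False by blast
qed

text \<open>The choice \<open>g\<close> has to be displayed inside a fitted map. The map
  \<open>v\<close> realizing \<open>g\<close> moves every node of its level, and away from the nodes
  \<open>z (h a)\<close> it may leave the lift. So a harmless copied letter is inserted first, and
  \<open>g\<close> is repeated one entry later, where every label used by \<open>v\<close> is
  available.\<close>

lemma extend_type:
  assumes U: "U \<in> R m" and nm: "n \<le> m" and z: "Fit m (seg U 0 k) z" and pos: "0 < tlv z m"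
    and h: "h \<in> MM n" "tlv h n = m" and g: "g \<in> MM n" "tlv g n = Suc (tlv z m)"
    and gz: "\<And>a. a \<in> T n \<Longrightarrow> g a \<in> lift1 z {h a}"
  shows "\<exists>z'. Op m U z' \<and> (\<forall>b\<in>T m. le (z b) (z' b)) \<and>
    (\<exists>j<tlv z' m. \<forall>a\<in>T n. \<forall>p c. S (z (h a)) p c = Some (g a) \<longrightarrow> letter (z' (h a)) j p c)"
proof -
  let ?d = "tlv z m"
  note z' = Fit_D[OF z]
  note mz = MM_tl_ge[OF z'(1)]
  have lz: "lv (z b) = ?d" if "lv b = m" for b using MM_lev[OF z'(1) that] .
  have lh: "lv (h a) = m" if "lv a = n" for a using MM_lev[OF h(1) that] h(2) by simp
  have c: "cut m U k = Suc ?d" using z'(3) cut_seg(1)[OF U, of 0 k] by simp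
  \<comment> \<open>As \<open>g\<close> ends one level above \<open>z\<close>, (M2) splits off a map
    \<open>v\<close> that moves level \<open>?d\<close> by one and extends the choice
    \<open>g\<close> to all nodes there.\<close>
  from factor[OF g(1) _ g(2)] nm mz obtain f v where f: "f \<in> MM n" "tlv f n = ?d"
    and v: "v \<in> MM ?d" "tlv v ?d = Suc ?d" and vf: "\<And>a. a \<in> T n \<Longrightarrow> v (f a) = g a" by auto
  have vz: "v (z (h a)) = g a" if a: "lv a = n" for a
  proof -
    have fa: "lv (f a) = ?d" using MM_lev[OF f(1) a] f(2) by simp
    have "le (f a) (g a)" using MM_ge[OF v(1) fa] vf a by simp
    moreover have "le (z (h a)) (g a)" using lift1_single(2)[OF z'(1) _ gz, of a] lh a by simp
    ultimately have "f a = z (h a)" using trunc_eq[of "f a" "g a" ?d] trunc_eq[of "z (h a)" "g a" ?d] fa lz lh a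
      by simp
    then show ?thesis using vf[of a] a by simp
  qed
  note rho = copy[OF pos]
  let ?\<rho> = "copy 0 ?d"
  have rz: "?\<rho> (z b) \<in> lift1 z {b}" if b: "lv b = m" for b
  proof -
    from letter_ex[of 0 "z b"] pos lz[OF b] obtain p q where l: "letter (z b) 0 p q" by auto
    \<comment> \<open>For \<open>m = 0\<close> the letter at position 0 labels an edge leaving
      \<open>b\<close> itself; otherwise \<open>b\<close> already has this letter, and copying gives
      the successor.\<close>
    have "\<exists>x. S b p q = Some x"
    proof (cases m)
      case 0
      from l obtain a x where a: "lv a = 0" "S a p q = Some x" "le x (z b)" unfolding letter_def by blast
      have "a = b" using trunc_eq[OF le_trans[OF S_le[OF a(2)] a(3)] a(1)]
          trunc_eq[OF MM_ge[OF z'(1) b], of 0] b 0 by simp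
      with a show ?thesis by blast
    next
      case (Suc i)
      then have "letter b 0 p q" using letter_lower[OF l MM_ge[OF z'(1) b]] b by simp
      with copy(3)[OF _ b, of 0] Suc show ?thesis by blast
    qed
    with rho(3)[OF lz[OF b] l] show ?thesis by (auto intro!: lift1_I[of b])
  qed
  have rzT: "?\<rho> (z b) \<in> lifts m (seg U 0 k) (T m)" if b: "lv b = m" for b
    using z'(4) rz[OF b] lift1_mono[of "{b}" "T m" z] b by auto
  have lrz: "lv (?\<rho> (z b)) = Suc ?d" if "lv b = m" for b using MM_lev[OF rho(1) lz[OF that]] rho(2) by simp
  define u where "u = U k"
  have uA: "u \<in> A (Suc ?d)" using R_A[OF U, of k] c u_def by simp
  let ?Ku = "K (Suc ?d) u"
  note Ku = K_A[OF uA]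
  \<comment> \<open>On level \<open>?d\<close> this is the copied letter followed by the next entry.
    Being canonical above it, \<open>L\<close> carries the edges chosen by \<open>v\<close> to edges
    immediately above these values.\<close>
  define L where "L = K ?d (rs (?Ku \<circ> ?\<rho>) ?d)"
  have KuR: "?Ku \<circ> ?\<rho> \<in> MM ?d" using MM_comp[OF Ku(1) rho(1)] by simp
  note L = K_rs[OF KuR, folded L_def]
  have tKu: "tlv (?Ku \<circ> ?\<rho>) ?d = E (Suc ?d) u - 1"
    using tl_comp[OF MM_M[OF Ku(1)] MM_M[OF rho(1)]] rho(2) Ku(3) by simp
  have Epos: "Suc (E (Suc ?d) u - 1) = E (Suc ?d) u" using E_gt[OF uA] by simp
  have tL: "tlv L (Suc ?d) = E (Suc ?d) u" using L(3)[of 1] tKu Epos by simp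
  have Lz: "L (z b) = ?Ku (?\<rho> (z b))" if "lv b = m" for b using L(2)[of "z b"] lz[OF that] by simp
  define q where "q = L \<circ> (v \<circ> z)"
  have vzM: "v \<circ> z \<in> MM m" using MM_comp[OF v(1) z'(1) mz] .
  have qM: "q \<in> MM m" unfolding q_def using MM_comp[OF L(1) vzM mz] .
  have tq: "tlv q m = E (Suc ?d) u" unfolding q_def
    using tl_comp[OF MM_M[OF L(1)] MM_M[OF vzM]] tl_comp[OF MM_M[OF v(1)] MM_M[OF z'(1)]] v(2) tL by simp
  have lLz: "lv (L (z b)) = E (Suc ?d) u - 1" if "lv b = m" for b
    using MM_lev[OF Ku(1) lrz[OF that]] Ku(3) Lz[OF that] by simp
  have qS: "S (L (z b)) p e = Some (q b)" if b: "lv b = m" and p: "S (z b) p e = Some (v (z b))" for b p e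
  proof -
    from MM_S[OF L(1) lz[OF b] p] obtain y where y: "S (L (z b)) p e = Some y" "le y (L (v (z b)))" by blast
    have "lv y = E (Suc ?d) u" using S_lev[OF y(1)] lLz[OF b] Epos by simp
    moreover have "lv (q b) = E (Suc ?d) u" using MM_lev[OF qM b] tq by simp
    ultimately have "y = q b" using le_lev_eq[OF y(2)] by (simp add: q_def)
    with y(1) show ?thesis by simp
  qed
  have vS: "\<exists>p e. S (z b) p e = Some (v (z b))" if b: "lv b = m" for b
    using S_total[OF MM_ge[OF v(1) lz[OF b]]] MM_lev[OF v(1) lz[OF b]] lz[OF b] v(2) by simp
  have qlf: "q b \<in> lift1 ?Ku {?\<rho> (z b)}" if b: "lv b = m" for b
  proof -
    from vS[OF b] obtain p e where p: "S (z b) p e = Some (v (z b))" by blast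
    from MM_S[OF rho(1) lz[OF b] p] obtain y where "S (?\<rho> (z b)) p e = Some y" by blast
    with qS[OF b p] Lz[OF b] show ?thesis by (auto intro!: lift1_I[of "?\<rho> (z b)"])
  qed
  have segk: "seg U 0 (Suc k) = seg U 0 k @ [u]" by (simp add: seg_Suc u_def)
  have ek: "endl m (seg U 0 k) = Suc ?d" using z'(3) by simp
  have FSq: "FS m (seg U 0 (Suc k)) q"
    unfolding FS_def
  proof (intro conjI subsetI)
    show "q \<in> MM m" by (rule qM)
    show "tlv q m = endl m (seg U 0 (Suc k))" using tq ek by (simp add: segk)
    fix y assume "y \<in> q ` T m"
    then obtain b where b: "lv b = m" "y = q b" by auto
    have "{?\<rho> (z b)} \<subseteq> lifts m (seg U 0 k) (T m)" using rzT[OF b(1)] by simp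
    from lift1_mono[OF this, of ?Ku] qlf[OF b(1)] b(2) have "y \<in> lift1 ?Ku (lifts m (seg U 0 k) (T m))" by blast
    then show "y \<in> lifts m (seg U 0 (Suc k)) (T m)" by (simp add: segk lifts_append ek)
  qed
  let ?w = "U (Suc k)" and ?c = "cut m U (Suc k)"
  have wA: "?w \<in> A ?c" by (rule R_A[OF U])
  have ec: "endl m (seg U 0 (Suc k)) = ?c" "chain m (seg U 0 (Suc k))" using cut_seg[OF U, of 0 "Suc k"] by auto
  define z2 where "z2 = K ?c ?w \<circ> q"
  have "Fit m (seg U 0 (Suc k) @ [?w]) z2"
    unfolding z2_def using Fit_comp[OF FSq ec(2)] Fit_K[OF wA] ec(1) by simp
  then have fit2: "Fit m (seg U 0 (Suc (Suc k))) z2" by (simp add: seg_Suc)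
  have lq: "lv (q b) = ?c" if "lv b = m" for b using FS_D(4)[OF FSq that] ec(1) by simp
  have qz2: "le (q b) (z2 b)" if b: "lv b = m" for b
    unfolding z2_def using MM_ge[OF K_A(1)[OF wA] lq[OF b]] by simp
  have zq: "le (z b) (q b)" if b: "lv b = m" for b
  proof -
    from vS[OF b] qS[OF b] S_le have "le (L (z b)) (q b)" by blast
    with MM_ge[OF L(1) lz[OF b]] show ?thesis using le_trans by blast
  qed
  have "Op m U z2" unfolding Op_def using fit2 by blast
  moreover have "\<forall>b\<in>T m. le (z b) (z2 b)" using le_trans[OF zq qz2] by simp
  \<comment> \<open>The repeated choice leaves the nodes \<open>L (z (h a))\<close>, whose level is
    the position sought.\<close>
  moreover have "\<exists>j<tlv z2 m. \<forall>a\<in>T n. \<forall>p e. S (z (h a)) p e = Some (g a) \<longrightarrow> letter (z2 (h a)) j p e"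
  proof (intro exI[of _ "E (Suc ?d) u - 1"] conjI ballI allI impI)
    obtain b where b: "lv b = m" using ex_level by blast
    have "tlv q m \<le> tlv z2 m" using lev_mono[OF qz2[OF b]] MM_lev[OF qM b] MM_lev[OF Fit_D(1)[OF fit2] b] by simp
    then show "E (Suc ?d) u - 1 < tlv z2 m" using tq Epos by simp
    fix a p e assume a: "a \<in> T n" and p: "S (z (h a)) p e = Some (g a)"
    have lha: "lv (h a) = m" using lh a by simp
    from qS[OF lha] p vz a have "S (L (z (h a))) p e = Some (q (h a))" by simp
    from letter_S[OF this] lLz[OF lha] letter_mono qz2[OF lha]
    show "letter (z2 (h a)) (E (Suc ?d) u - 1) p e" by metis
  qed
  ultimately show ?thesis by blast
qed

text \<open>The letters at position \<open>j\<close> of the values of \<open>z\<close> reproduce every one-step extension that is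
  available after \<open>z\<close>; this makes the positions below the level of \<open>z\<close> a sufficient finite
  alphabet for the Hales-Jewett argument.\<close>

lemma ex_absorbing:
  assumes b: "base m H" and can_skip: "can_skip m" and U: "U \<in> R m"
  shows "\<exists>z k. Fit m (seg U 0 k) z \<and> 0 < tlv z m \<and>
    (\<forall>z1 g h. Op m U z1 \<longrightarrow> (\<forall>b\<in>T m. le (z b) (z1 b)) \<longrightarrow> h \<in> H \<longrightarrow> g \<in> MM n \<longrightarrow>
      tlv g n = Suc (tlv z1 m) \<longrightarrow> (\<forall>a\<in>T n. g a \<in> lift1 z1 {h a}) \<longrightarrow>
      (\<exists>j<tlv z m. \<forall>a\<in>T n. \<forall>p c. S (z1 (h a)) p c = Some (g a) \<longrightarrow> letter (z (h a)) j p c))"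
proof -
  let ?Ty = "T n \<rightarrow>\<^sub>E T (Suc m)"
  \<comment> \<open>A choice is coded by successors of \<open>h a\<close> instead of
    \<open>z (h a)\<close>: the labels are the same, but the codes for all \<open>z\<close> live in
    one finite function space.\<close>
  define C where "C z = {\<tau> \<in> ?Ty. \<exists>h\<in>H. (\<forall>a\<in>T n. le (h a) (\<tau> a)) \<and>
    (\<exists>j<tlv z m. \<forall>a\<in>T n. \<forall>p c. S (h a) p c = Some (\<tau> a) \<longrightarrow> letter (z (h a)) j p c)}" for z
  have fin: "finite ?Ty" by (rule finite_PiE) (rule finite_T)+
  have C_Ty: "C z \<subseteq> ?Ty" for z unfolding C_def by (rule Collect_restrict)
  have finC: "finite (C z)" for z using finite_subset[OF C_Ty fin] .
  have lh: "lv (h a) = m" if "h \<in> H" "lv a = n" for h a using base_D(4)[OF b that] .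
  have C_mono: "C z \<subseteq> C z'" if z: "z \<in> MM m" "z' \<in> MM m" and le: "\<forall>b\<in>T m. le (z b) (z' b)" for z z'
  proof
    obtain b0 where b0: "lv b0 = m" using ex_level by blast
    have tl: "tlv z m \<le> tlv z' m"
      using lev_mono[of "z b0" "z' b0"] le b0 MM_lev[OF z(1) b0] MM_lev[OF z(2) b0] by simp
    fix \<tau> assume "\<tau> \<in> C z"
    then obtain h j where 1: "\<tau> \<in> ?Ty" "h \<in> H" "\<forall>a\<in>T n. le (h a) (\<tau> a)" "j < tlv z m"
      "\<forall>a\<in>T n. \<forall>p c. S (h a) p c = Some (\<tau> a) \<longrightarrow> letter (z (h a)) j p c" unfolding C_def by blast
    have "letter (z' (h a)) j p c" if "a \<in> T n" "S (h a) p c = Some (\<tau> a)" for a p c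
      using letter_mono[OF 1(5)[rule_format, OF that]] le lh[OF 1(2)] that(1) by simp
    moreover have "j < tlv z' m" using 1(4) tl by simp
    ultimately show "\<tau> \<in> C z'" unfolding C_def using 1(1-3) by blast
  qed
  let ?P = "\<lambda>z. Op m U z \<and> 0 < tlv z m"
  \<comment> \<open>One step before the entry makes the level positive even for
    \<open>m = 0\<close>; the alphabet of levels must not be empty.\<close>
  have "\<exists>z. ?P z"
  proof -
    from FS_exists[OF can_skip U, of 1] obtain f where f: "FS m (seg U 0 1) f" by blast
    let ?u = "U 1" and ?c = "cut m U 1"
    have e: "endl m (seg U 0 1) = ?c" "chain m (seg U 0 1)" using cut_seg[OF U, of 0 1] by auto
    have u: "?u \<in> A ?c" by (rule R_A[OF U])
    have fit: "Fit m (seg U 0 1 @ [?u]) (K ?c ?u \<circ> f)" using Fit_comp[OF f e(2)] Fit_K[OF u] e(1) by simp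
    have "seg U 0 1 @ [?u] = seg U 0 (Suc 1)" by (simp add: seg_Suc)
    with fit have "Op m U (K ?c ?u \<circ> f)" unfolding Op_def by metis
    moreover have "0 < tlv (K ?c ?u \<circ> f) m"
    proof -
      have "0 < ?c" using cut_less[OF U, of 0 1] by simp
      also have "?c \<le> tlv (K ?c ?u) ?c" by (rule MM_tl_ge[OF K_A(1)[OF u]])
      also have "\<dots> = tlv (K ?c ?u \<circ> f) m"
        using tl_comp[OF MM_M[OF K_A(1)[OF u]] MM_M[OF FS_D(1)[OF f]]] FS_D(2)[OF f] e(1) by simp
      finally show ?thesis .
    qed
    ultimately show ?thesis by blast
  qed
  then obtain z0 where z0: "?P z0" by blast
  have bound: "\<forall>z. ?P z \<longrightarrow> card (C z) < Suc (card ?Ty)"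
    using card_mono[OF fin C_Ty] by (simp add: less_Suc_eq_le)
  \<comment> \<open>\<open>C z\<close> grows with \<open>z\<close>, so a \<open>z\<close> displaying
    the largest number of choices displays all that any extension displays.\<close>
  from ex_has_greatest_nat[of ?P z0 "\<lambda>z. card (C z)", OF z0 bound]
  obtain z where z: "Op m U z" "0 < tlv z m" and max: "\<And>z'. ?P z' \<Longrightarrow> card (C z') \<le> card (C z)" by blast
  note zM = Op_MM[OF z(1)]
  have main: "\<exists>j<tlv z m. \<forall>a\<in>T n. \<forall>p c. S (z1 (h a)) p c = Some (g a) \<longrightarrow> letter (z (h a)) j p c"
    if z1: "Op m U z1" "\<forall>b\<in>T m. le (z b) (z1 b)" and h: "h \<in> H" and g: "g \<in> MM n"
      "tlv g n = Suc (tlv z1 m)" "\<forall>a\<in>T n. g a \<in> lift1 z1 {h a}" for z1 g h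
  proof -
    note z1M = Op_MM[OF z1(1)]
    obtain b0 where b0: "lv b0 = m" using ex_level by blast
    have tl1: "tlv z m \<le> tlv z1 m"
      using lev_mono[of "z b0" "z1 b0"] z1(2) b0 MM_lev[OF zM b0] MM_lev[OF z1M b0] by simp
    from z1(1) obtain k where k: "Fit m (seg U 0 k) z1" unfolding Op_def by blast
    have pos1: "0 < tlv z1 m" using tl1 z(2) by simp
    have hh: "h \<in> MM n" "tlv h n = m" using base_D(2,3)[OF b h] .
    from extend_type[OF U base_D(1)[OF b] k pos1 hh g(1,2)] g(3) obtain z2 j where
      z2: "Op m U z2" "\<forall>b\<in>T m. le (z1 b) (z2 b)" and j: "j < tlv z2 m"
      "\<forall>a\<in>T n. \<forall>p c. S (z1 (h a)) p c = Some (g a) \<longrightarrow> letter (z2 (h a)) j p c" by blast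
    note z2M = Op_MM[OF z2(1)]
    have "\<forall>a\<in>T n. \<exists>x. \<exists>p q. S (h a) p q = Some x \<and> S (z1 (h a)) p q = Some (g a)"
      using g(3) unfolding lift1_def by blast
    from bchoice[OF this] obtain \<sigma> where
      sig: "\<forall>a\<in>T n. \<exists>p q. S (h a) p q = Some (\<sigma> a) \<and> S (z1 (h a)) p q = Some (g a)" by blast
    define \<tau> where "\<tau> = restrict \<sigma> (T n)"
    have tau: "\<exists>p q. S (h a) p q = Some (\<tau> a) \<and> S (z1 (h a)) p q = Some (g a)" if "a \<in> T n" for a
      using sig that unfolding \<tau>_def by simp
    have tauTy: "\<tau> \<in> ?Ty"
    proof -
      have "\<sigma> a \<in> T (Suc m)" if "a \<in> T n" for a
        using bspec[OF sig that] S_lev lh[OF h] that by fastforce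
      then show ?thesis unfolding \<tau>_def by (simp add: restrict_PiE_iff)
    qed
    have tau_le: "le (h a) (\<tau> a)" if "a \<in> T n" for a using tau[OF that] S_le by blast
    have conv: "S (h a) p q = Some (\<tau> a) \<longleftrightarrow> S (z1 (h a)) p q = Some (g a)" if "a \<in> T n" for a p q
      using tau[OF that] S_inj by metis
    have t2: "\<tau> \<in> C z2" unfolding C_def using tauTy h tau_le j conv by blast
    have le2: "\<forall>b\<in>T m. le (z b) (z2 b)" using z1(2) z2(2) le_trans by blast
    have "tlv z1 m \<le> tlv z2 m"
      using lev_mono[of "z1 b0" "z2 b0"] z2(2) b0 MM_lev[OF z1M b0] MM_lev[OF z2M b0] by simp
    then have "?P z2" using z2(1) pos1 by simp
    from card_seteq[OF finC C_mono[OF zM z2M le2] max[OF this]] t2 have "\<tau> \<in> C z" by simp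
    then obtain h' i where h': "h' \<in> H" "\<forall>a\<in>T n. le (h' a) (\<tau> a)" and i: "i < tlv z m"
      "\<forall>a\<in>T n. \<forall>p c. S (h' a) p c = Some (\<tau> a) \<longrightarrow> letter (z (h' a)) i p c" unfolding C_def by blast
    have "h' a = h a" if "a \<in> T n" for a
      using trunc_eq[of "h' a" "\<tau> a" m] trunc_eq[of "h a" "\<tau> a" m] h'(2) tau_le lh[OF h'(1)] lh[OF h] that by simp
    with i conv show ?thesis by (intro exI[of _ i]) simp
  qed
  from z(1) obtain k where "Fit m (seg U 0 k) z" unfolding Op_def by blast
  with z(2) main show ?thesis by blast
qed

text \<open>A word over the positions below the level of \<open>z\<close> acts by copying the letters at these positions.
  Along a left-variable line of words with constant colour \<open>f\<close>, letting the variable copy the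
  letter just chosen covers all possible choices at once.\<close>

lemma two_steps:
  assumes b: "base m H" and can_skip: "can_skip m" and L: "large m H U"
  shows "\<exists>z k V. Fit m (seg U 0 k) z \<and> good H z \<and> Op (cut m U k) (shift U k) V \<and> good (Succ m H z) V"
proof -
  have U: "U \<in> R m" using L unfolding large_def by blast
  from ex_absorbing[OF b can_skip U] obtain z k0 where z: "Fit m (seg U 0 k0) z" "0 < tlv z m" and
    abs: "\<And>z1 g h. Op m U z1 \<Longrightarrow> (\<forall>b\<in>T m. le (z b) (z1 b)) \<Longrightarrow> h \<in> H \<Longrightarrow> g \<in> MM n \<Longrightarrow>
      tlv g n = Suc (tlv z1 m) \<Longrightarrow> (\<forall>a\<in>T n. g a \<in> lift1 z1 {h a}) \<Longrightarrow>
      (\<exists>j<tlv z m. \<forall>a\<in>T n. \<forall>p c. S (z1 (h a)) p c = Some (g a) \<longrightarrow> letter (z (h a)) j p c)" by blast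
  note zM = Fit_D(1)[OF z(1)]
  define nl where "nl = tlv z m"
  \<comment> \<open>\<open>Y\<close> starts with \<open>z\<close>, so every state traversing a
    nonempty part of \<open>Y\<close> lies above the values of \<open>z\<close> and retains their
    letters.\<close>
  define Y where "Y = app [rs z m] (shift U k0)"
  have YU: "sub m Y U"
  proof -
    have "fits m [rs z m] (seg U 0 k0)" using z(1) unfolding Fit_def by simp
    then show ?thesis unfolding Y_def using sub_refl[OF shift_R[OF U, of k0]] U by (rule sub_app)
  qed
  note YR = sub_R(1)[OF YU]
  have Y0: "Y 0 = rs z m" unfolding Y_def by simp
  have cut1: "cut m Y 1 = Suc nl" by (simp add: Y0 nl_def)
  from syndetic[OF b can_skip large_sub[OF L YU]] obtain k where k: "1 \<le> k" and
    synd: "\<And>v. Op (cut m Y k) (shift Y k) v \<Longrightarrow> \<exists>f. FS m (seg Y 0 k) f \<and> good H (v \<circ> f)" by blast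
  define c where "c = cut m Y k"
  define W where "W = shift Y k"
  have WR: "W \<in> R c" unfolding W_def c_def by (rule shift_R[OF YR])
  have lc: "nl < c" using cut_le[OF YR k] cut1 c_def by simp
  have ek: "endl m (seg Y 0 k) = c" "chain m (seg Y 0 k)" using cut_seg[OF YR, of 0 k] c_def by auto
  have zf: "le (z b) (f b)" if f: "FS m (seg Y 0 k) f" and b: "b \<in> T m" for f b
  proof -
    have s: "seg Y 0 k = Y 0 # seg Y 1 k"
      using seg_append[of 0 1 k Y] k by (simp add: seg_def)
    let ?e = "E m (rs z m)"
    have ch: "chain ?e (seg Y 1 k)" using ek(2) unfolding s Y0 by simp
    note Kz = K_rs[OF zM]
    have zA: "rs z m \<in> A m" by (rule rs_A[OF zM])
    have "f b \<in> lifts ?e (seg Y 1 k) (lift1 (K m (rs z m)) (T m))" using FS_D(3)[OF f b] unfolding s Y0 by simp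
    then have t: "trunc (f b) ?e \<in> lift1 (K m (rs z m)) (T m)"
      using lifts_iff[OF ch lift1_K_T[OF zA order_refl]] by blast
    then obtain b' where b': "b' \<in> T m" "trunc (f b) ?e \<in> lift1 (K m (rs z m)) {b'}" using lift1_UN by blast
    have le1: "le (trunc (f b) ?e) (f b)"
      using trunc(1)[of ?e "f b"] FS_D(4)[OF f, of b] b ek endl_ge[OF ch] s Y0 by simp
    have "le b' (f b)" using lift1_single(3)[OF Kz(1) b'] le1 le_trans by blast
    then have "b' = b" using trunc_eq[of b' "f b" m] trunc_eq[OF MM_ge[OF FS_D(1)[OF f]], of b m] b b' by simp
    then have "le (z b) (trunc (f b) ?e)" using lift1_single(2)[OF Kz(1) b'] Kz(2)[of b] b by simp
    then show ?thesis using le1 le_trans by blast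
  qed
  \<comment> \<open>Copying along \<open>w\<close> yields only a state; the entry \<open>W i\<close>
    behind it, with \<open>i\<close> the length of \<open>w\<close>, completes a fitted map.\<close>
  define vw where "vw i w = K (cut c W i) (W i) \<circ> copy_word c W w" for i w
  have seg0: "endl c (seg W 0 i) = cut c W i" "chain c (seg W 0 i)" for i
    using cut_seg[OF WR, of 0 i] by auto
  have fitvw: "Fit c (seg W 0 (Suc (length w))) (vw (length w) w)" if w: "set w \<subseteq> {..<c}" for w
  proof -
    from Fit_comp[OF FS_copy_word[OF WR w] seg0(2)] Fit_K[OF R_A[OF WR, of "length w"]]
    show ?thesis unfolding vw_def by (simp add: seg0 seg_Suc)
  qed
  have "\<exists>f. FS m (seg Y 0 k) f \<and> good H (vw (length w) w \<circ> f)" if w: "set w \<subseteq> {..<nl}" for w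
  proof -
    have "set w \<subseteq> {..<c}" using w lc by auto
    from fitvw[OF this] show ?thesis
      by (intro synd[folded c_def W_def]) (auto simp: Op_def simp del: seg_simps)
  qed
  then have "\<forall>w. \<exists>f. set w \<subseteq> {..<nl} \<longrightarrow> FS m (seg Y 0 k) f \<and> good H (vw (length w) w \<circ> f)" by blast
  from choice[OF this] obtain f where f: "\<And>w. set w \<subseteq> {..<nl} \<Longrightarrow> FS m (seg Y 0 k) (f w)"
    "\<And>w. set w \<subseteq> {..<nl} \<Longrightarrow> good H (vw (length w) w \<circ> f w)" by blast
  \<comment> \<open>Goodness sees the prefix only through its values on level \<open>m\<close>,
    which lie on one finite level; this makes the colouring finite.\<close>
  define col where "col w = restrict (f w) (T m)" for w
  have "finite (col ` {w. set w \<subseteq> {..<nl}})"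
  proof (rule finite_subset)
    show "col ` {w. set w \<subseteq> {..<nl}} \<subseteq> T m \<rightarrow>\<^sub>E T c"
      using FS_D(4)[OF f(1)] ek by (auto simp: col_def)
    show "finite (T m \<rightarrow>\<^sub>E T c)" by (rule finite_PiE) (rule finite_T)+
  qed
  with z(2) left_variable_line[of nl col] obtain w v where w: "set w \<subseteq> {..<nl}" and v: "set v \<subseteq> vletters nl"
    and col: "\<And>a. a < nl \<Longrightarrow> col (w @ a # fill a v) = col w" unfolding nl_def by blast
  define t where "t = length w"
  define v0 where "v0 = vw t w"
  note fw = f(1)[OF w]
  have wc: "set w \<subseteq> {..<c}" using w lc by auto
  note fit0 = fitvw[OF wc, folded t_def, folded v0_def]
  define z1 where "z1 = v0 \<circ> f w"
  have z1good: "good H z1" using f(2)[OF w] unfolding z1_def v0_def t_def .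
  have segYW: "seg Y 0 k @ seg W 0 i = seg Y 0 (k + i)" for i
    unfolding W_def using seg_append[of 0 k "k + i" Y] by simp
  have z1fit: "Fit m (seg Y 0 (k + Suc t)) z1"
    using Fit_comp[OF fw ek(2), of "seg W 0 (Suc t)" v0] fit0 unfolding segYW ek(1) z1_def by blast
  define q where "q = tlv z1 m"
  define c2 where "c2 = cut c W (Suc t)"
  define W2 where "W2 = shift W (Suc t)"
  have W2R: "W2 \<in> R c2" unfolding W2_def c2_def by (rule shift_R[OF WR])
  have c2Y: "cut m Y (k + Suc t) = c2" unfolding c2_def c_def W_def by (simp only: cut_shift)
  have q: "Suc q = c2" unfolding q_def
    using Fit_D(3)[OF z1fit] cut_seg(1)[OF YR, of 0 "k + Suc t"] c2Y by simp
  have cc2: "c < c2" unfolding c2_def using cut_less[OF WR, of 0 "Suc t"] by simp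
  \<comment> \<open>\<open>q\<close> is the level at which an extension \<open>g\<close> leaves
    \<open>z1\<close>. Copying position \<open>q\<close> repeats the label just chosen, whichever
    \<open>g\<close> it was, so \<open>V\<close> does not depend on \<open>g\<close>.\<close>
  define V where "V = K (cut c2 W2 (length v)) (W2 (length v)) \<circ> copy_word c2 W2 (fill q v)"
  have vl: "set v \<subseteq> vletters c2" using v lc cc2 by (auto simp: vletters_def)
  have sbq: "set (fill q v) \<subseteq> {..<c2}" using fill_letters[OF vl, of q] q by simp
  have VOp: "Op c2 W2 V"
  proof -
    have s: "endl c2 (seg W2 0 i) = cut c2 W2 i" "chain c2 (seg W2 0 i)" for i
      using cut_seg[OF W2R, of 0 i] by auto
    have F: "FS c2 (seg W2 0 (length v)) (copy_word c2 W2 (fill q v))" using FS_copy_word[OF W2R sbq] by simp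
    from Fit_comp[OF F s(2)] Fit_K[OF R_A[OF W2R, of "length v"]]
    have "Fit c2 (seg W2 0 (length v) @ [W2 (length v)]) V" unfolding V_def by (simp add: s)
    then have "Fit c2 (seg W2 0 (Suc (length v))) V" by (simp add: seg_Suc)
    then show ?thesis unfolding Op_def by blast
  qed
  from z1fit have "fit m (seg Y 0 (k + Suc t)) (rs z1 m)" unfolding Fit_def by blast
  from sub_fit[OF YU this] obtain k1 where k1: "cut m U k1 = cut m Y (k + Suc t)"
    "fit m (seg U 0 k1) (rs z1 m)" by blast
  have z1U: "Fit m (seg U 0 k1) z1" unfolding Fit_def using k1(2) Fit_D(1)[OF z1fit] by blast
  have "sub c2 W2 (shift U k1)"
    using sub_shift[OF YU k1(1)] k1(1) c2Y unfolding W2_def W_def by simp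
  from Op_mono[OF this VOp] have VU: "Op (cut m U k1) (shift U k1) V" using k1(1) c2Y by simp
  have zz1: "\<forall>b\<in>T m. le (z b) (z1 b)"
  proof
    fix b assume b: "b \<in> T m"
    have "lv (f w b) = c" using FS_D(4)[OF fw] b ek by simp
    from MM_ge[OF Fit_D(1)[OF fit0] this] zf[OF fw b] show "le (z b) (z1 b)"
      unfolding z1_def using le_trans by auto
  qed
  have "good (Succ m H z1) V"
    unfolding good_def
  proof
    fix g assume "g \<in> Succ m H z1"
    then obtain h where g: "g \<in> MM n" "tlv g n = Suc (tlv z1 m)" and h: "h \<in> H"
      "\<forall>a\<in>T n. g a \<in> lift1 z1 {h a}" unfolding Succ_def by blast
    have "Op m U z1" unfolding Op_def using z1U by blast
    from abs[OF this zz1 h(1) g h(2)] obtain j where j: "j < nl"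
      "\<forall>a\<in>T n. \<forall>p c. S (z1 (h a)) p c = Some (g a) \<longrightarrow> letter (z (h a)) j p c" unfolding nl_def by blast
    let ?w = "w @ j # fill j v"
    have w': "set ?w \<subseteq> {..<nl}" using w j(1) fill_letters[OF v j(1)] by auto
    have lenw: "length ?w = Suc t + length v" by (simp add: t_def)
    note f' = f(1)[OF w']
    have hM: "h \<in> MM n" using base_D(2)[OF b h(1)] .
    have lh: "lv (h a) = m" if "lv a = n" for a using base_D(4)[OF b h(1) that] .
    \<comment> \<open>Position \<open>j\<close> displays the choice \<open>g\<close>, so copying it
      after \<open>w\<close> reaches \<open>g a\<close> itself, and from there \<open>j\<close> and
      \<open>q\<close> show the same label. The constant colour lets \<open>f ?w\<close> agree with
      \<open>f w\<close> at \<open>h a\<close>. So \<open>V (g a)\<close> is the value of an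
      operation known to be good.\<close>
    have "V (g a) = vw (length ?w) ?w (f ?w (h a))" if a: "a \<in> T n" for a
    proof -
      have ha: "h a \<in> T m" using lh a by simp
      have feq: "f ?w (h a) = f w (h a)"
        using fun_cong[OF col[OF j(1)], of "h a"] ha unfolding col_def by simp
      let ?b = "copy_word c W w (f w (h a))"
      let ?c = "cut c W t"
      have F: "FS c (seg W 0 t) (copy_word c W w)" using FS_copy_word[OF WR wc] by (simp add: t_def)
      have lf0: "lv (f w (h a)) = c" using FS_D(4)[OF fw] ha ek by simp
      have lb: "lv ?b = ?c" using FS_D(4)[OF F lf0] seg0 by simp
      have leb: "le (z (h a)) ?b" using le_trans[OF zf[OF fw ha] MM_ge[OF FS_D(1)[OF F] lf0]] .
      have z1h: "z1 (h a) = K ?c (W t) ?b" by (simp add: z1_def v0_def vw_def)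
      from h(2) a obtain p e where p: "S (z1 (h a)) p e = Some (g a)" unfolding lift1_def by blast
      with j(2) a have lz: "letter (z (h a)) j p e" by blast
      have uA: "W t \<in> A ?c" by (rule R_A[OF WR])
      have cc: "c \<le> ?c" using cut_le[OF WR, of 0 t] by simp
      have jc: "j < ?c" using j(1) lc cc by simp
      from copy_step(3)[OF uA jc lb letter_mono[OF lz leb]] p z1h have ga: "copy_step ?c (W t) j ?b = g a" by simp
      have W2cut: "E ?c (W t) = c2" "shift (shift W t) 1 = W2" unfolding c2_def W2_def by simp_all
      have "copy_word c W ?w (f w (h a)) = copy_word ?c (shift W t) (j # fill j v) ?b"
        unfolding copy_word_append t_def by simp
      also have "shift W t 0 = W t" using shift_apply[of W t 0] by simp
      then have "copy_word ?c (shift W t) (j # fill j v) ?b = copy_word c2 W2 (fill j v) (g a)"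
        using W2cut ga by simp
      also have "\<dots> = copy_word c2 W2 (fill q v) (g a)"
      proof (rule copy_word_letters[OF W2R vl])
        show "j < c2" "q < c2" using jc cc2 j(1) lc q by auto
        have lz1: "lv (z1 (h a)) = q" using MM_lev[OF Fit_D(1)[OF z1fit]] lh a q_def by simp
        show "lv (g a) = c2" using S_lev[OF p] lz1 q by simp
        show "letter (g a) q p e" using letter_S[OF p] lz1 by simp
        have "le (z (h a)) (g a)" using le_trans[OF _ S_le[OF p]] zz1 ha by blast
        then show "letter (g a) j p e" using letter_mono[OF lz] by blast
      qed
      finally have e1: "copy_word c W ?w (f w (h a)) = copy_word c2 W2 (fill q v) (g a)" .
      have "cut c2 W2 (length v) = cut c W (length ?w)" "W2 (length v) = W (length ?w)"
        unfolding lenw c2_def W2_def by (rule cut_shift, rule shift_apply)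
      then show ?thesis unfolding vw_def V_def feq using e1 by simp
    qed
    then have "rs (V \<circ> g) n = rs (vw (length ?w) ?w \<circ> f ?w \<circ> h) n"
    proof (intro rs_eqI)
      have gc: "n \<le> c2" using base_D(1)[OF b] g(2) q q_def MM_tl_ge[OF g(1)] by simp
      show "V \<circ> g \<in> MM n" using MM_comp[OF Op_MM[OF VOp] g(1) gc] .
      have "set ?w \<subseteq> {..<c}" using w' lc by auto
      from Fit_comp[OF f' ek(2)] fitvw[OF this] ek(1)
      have "Fit m (seg Y 0 k @ seg W 0 (Suc (length ?w))) (vw (length ?w) ?w \<circ> f ?w)" by simp
      from MM_comp[OF Fit_D(1)[OF this] hM base_D(1)[OF b]]
      show "vw (length ?w) ?w \<circ> f ?w \<circ> h \<in> MM n" .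
    qed simp
    moreover have "rs (vw (length ?w) ?w \<circ> f ?w \<circ> h) n \<in> X" using f(2)[OF w'] h(1) unfolding good_def by blast
    ultimately show "rs (V \<circ> g) n \<in> X" by simp
  qed
  with z1U z1good VU show ?thesis by blast
qed

text \<open>Otherwise a fusion would remove all operations continuing any member of the set, contrary to
  \<open>two_steps\<close>.\<close>

lemma large_step:
  assumes b: "base m H" and can_skip: "can_skip m" and L: "large m H U"
  shows "\<exists>z k W. Fit m (seg U 0 k) z \<and> good H z \<and> sub (cut m U k) W (shift U k) \<and>
    large (cut m U k) (Succ m H z) W"
proof (rule ccontr)
  assume neg: "\<not> ?thesis"
  have U: "U \<in> R m" using L unfolding large_def by blast
  \<comment> \<open>Only lists of one entry are constrained; \<open>diagonal\<close> treats the
    others vacuously.\<close>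
  let ?P = "\<lambda>y W. \<forall>e. y = [e] \<longrightarrow> good H (K m e) \<longrightarrow> \<not> (\<exists>V. Op (endl m y) W V \<and> good (Succ m H (K m e)) V)"
  have "\<exists>U'. sub m U' U \<and> (\<forall>y k. fits m y (seg U' 0 k) \<longrightarrow> ?P y (shift U' k))"
  proof (rule diagonal[OF U])
    fix y c W W' assume "?P y W" "sub c W' W" "c = endl m y"
    then show "?P y W'" using Op_mono by blast
  next
    fix y k W assume y: "fits m y (seg U 0 k)" and W: "sub (cut m U k) W (shift U k)"
    have c: "cut m U k = endl m y" using fits_seg_cut[OF U y] .
    show "\<exists>W'. sub (cut m U k) W' W \<and> ?P y W'"
    proof (cases "\<exists>e. y = [e] \<and> good H (K m e)")
      case True
      then obtain e where e: "y = [e]" "good H (K m e)" by blast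
      have eA: "e \<in> A m" and fe: "fit m (seg U 0 k) e" using y e(1) fit_A by auto
      have "Fit m (seg U 0 k) (K m e)" unfolding Fit_def using K_A(1,2)[OF eA] fe by simp
      with neg e(2) W have "\<not> large (cut m U k) (Succ m H (K m e)) W" by blast
      then obtain W' where "sub (cut m U k) W' W"
        "\<not> (\<exists>V. Op (cut m U k) W' V \<and> good (Succ m H (K m e)) V)"
        unfolding large_def using sub_R(1)[OF W] by blast
      then show ?thesis unfolding c e(1) by blast
    next
      case False
      then show ?thesis using sub_refl[OF sub_R(1)[OF W]] by blast
    qed
  qed
  then obtain U' where U': "sub m U' U" "\<And>y k. fits m y (seg U' 0 k) \<Longrightarrow> ?P y (shift U' k)" by blast
  from two_steps[OF b can_skip large_sub[OF L U'(1)]] obtain z k V where z: "Fit m (seg U' 0 k) z" "good H z"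
    and V: "Op (cut m U' k) (shift U' k) V" "good (Succ m H z) V" by blast
  note zM = Fit_D(1)[OF z(1)]
  let ?e = "rs z m"
  have fe: "fits m [?e] (seg U' 0 k)" using z(1) unfolding Fit_def by simp
  have agree: "z a = K m ?e a" if "a \<in> T m" for a using K_rs(2)[OF zM, of a] that by simp
  have "good H (K m ?e)" using good_cong[OF b zM K_rs(1)[OF zM] agree] z(2) by blast
  moreover have "Succ m H z = Succ m H (K m ?e)" using Succ_cong[OF b zM K_rs(1)[OF zM] agree] .
  moreover have "cut m U' k = endl m [?e]" using fits_seg_cut[OF sub_R(1)[OF U'(1)] fe] .
  ultimately show False using U'(2)[OF fe] V by metis
qed

end

text \<open>If level \<open>n\<close> cannot be moved by one, \<open>truncate\<close> shows that it
  cannot be moved at all, leaving a single entry. Otherwise some subtree has no first entry in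
  \<open>X\<close>, or iterating \<open>large_step\<close> builds a subtree whose entries carry all
  preceding states into \<open>X\<close>.\<close>

lemma pigeonhole_nodes:
  assumes U: "U \<in> R n"
  shows "\<exists>U'. sub n U' U \<and> (op n U' \<subseteq> X \<or> op n U' \<inter> X = {})"
proof (cases "can_skip n")
  case False
  have triv: "u = rs id n" if "u \<in> A n" for u
  proof -
    from that obtain F where F: "F \<in> MM n" "u = rs F n" using A_iff by blast
    have "tlv F n = n"
    proof (rule ccontr)
      assume "tlv F n \<noteq> n"
      then have "Suc n \<le> tlv F n" using MM_tl_ge[OF F(1)] by simp
      with truncate[OF F(1), of "Suc n"] False show False unfolding can_skip_def by auto
    qed
    then show ?thesis unfolding F(2) using MM_eq_level[OF F(1)] by (intro rs_eqI[OF F(1) MM_idI]) simp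
  qed
  have "op n U \<subseteq> {rs id n}" using triv fit_A unfolding op_def by blast
  then have "op n U \<subseteq> X \<or> op n U \<inter> X = {}" by blast
  with sub_refl[OF U] show ?thesis by blast
next
  case can_skip: True
  \<comment> \<open>Initial states fix level \<open>n\<close> but may move higher nodes; the
    restriction to level \<open>n\<close> does not see the difference.\<close>
  define H0 where "H0 = {h \<in> MM n. tlv h n = n}"
  have b0: "base n n H0" unfolding base_def H0_def by simp
  have good0: "good n X H0 v \<longleftrightarrow> rs v n \<in> X" if v: "v \<in> MM n" for v
  proof -
    have "rs (v \<circ> h) n = rs v n" if "h \<in> H0" for h
    proof (rule rs_eqI)
      show "v \<circ> h \<in> MM n" using MM_comp[OF v, of h n] that unfolding H0_def by simp
      show "(v \<circ> h) a = v a" if "a \<in> T n" for a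
        using MM_eq_level[of h n a] \<open>h \<in> H0\<close> that unfolding H0_def by simp
    qed (rule v)
    moreover have "id \<in> H0" unfolding H0_def using MM_idI by simp
    ultimately show ?thesis unfolding good_def by auto
  qed
  have op_Op: "\<exists>v. Op n U' v \<and> e = rs v n" if "e \<in> op n U'" for e U'
  proof -
    from that obtain k where k: "fit n (seg U' 0 k) e" unfolding op_def by blast
    have "Fit n (seg U' 0 k) (K n e)" unfolding Fit_def using K_A(1,2)[OF fit_A[OF k]] k by simp
    then show ?thesis unfolding Op_def using K_A(2)[OF fit_A[OF k]] by metis
  qed
  show ?thesis
  proof (cases "large n X n H0 U")
    case False
    then obtain U' where U': "sub n U' U" "\<And>v. Op n U' v \<Longrightarrow> \<not> good n X H0 v"
      unfolding large_def using U by blast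
    have "op n U' \<inter> X = {}" using op_Op U'(2) good0 Op_MM by blast
    with U'(1) show ?thesis by blast
  next
    case True
    let ?Q = "\<lambda>m H W. large n X m H W \<and> base n m H \<and> can_skip m"
    let ?T = "\<lambda>m H u H'. \<exists>z\<in>MM m. u = rs z m \<and> good n X H z \<and> H' = Succ n m H z"
    have "\<exists>U' f. sub n U' U \<and> f 0 = H0 \<and>
      (\<forall>k. ?T (cut n U' k) (f k) (U' k) (f (Suc k)) \<and>
        (\<exists>W. ?Q (cut n U' k) (f k) W \<and> sub (cut n U' k) (shift U' k) W))"
    proof (rule fusion)
      show "?Q n H0 U" "U \<in> R n" using True b0 can_skip U by auto
      fix m H W assume Q: "?Q m H W" and W: "W \<in> R m"
      then obtain z k W' where z: "Fit m (seg W 0 k) z" "good n X H z" "sub (cut m W k) W' (shift W k)"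
        "large n X (cut m W k) (Succ n m H z) W'" using large_step by blast
      note zM = Fit_D(1)[OF z(1)]
      have c: "cut m W k = Suc (tlv z m)" using Fit_D(3)[OF z(1)] cut_seg(1)[OF W, of 0 k] by simp
      have "base n (cut m W k) (Succ n m H z)" unfolding c using Succ_base[OF _ zM] Q by blast
      moreover have "can_skip (cut m W k)" unfolding c by (rule can_skip_pos) simp
      moreover have "fit m (seg W 0 k) (rs z m)" using z(1) unfolding Fit_def by blast
      ultimately show "\<exists>u k H' W'. fit m (seg W 0 k) u \<and> sub (cut m W k) W' (shift W k) \<and>
         ?Q (cut m W k) H' W' \<and> ?T m H u H'" using z zM by blast
    qed
    then obtain U' f where U': "sub n U' U" "f 0 = H0"
      and T: "\<And>k. ?T (cut n U' k) (f k) (U' k) (f (Suc k))"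
      and bs: "\<And>k. base n (cut n U' k) (f k)" by blast
    note UR = sub_R(1)[OF U'(1)]
    have e: "endl n (seg U' 0 k) = cut n U' k" "chain n (seg U' 0 k)" for k
      using cut_seg[OF UR, of 0 k] by auto
    \<comment> \<open>Every state along \<open>U'\<close> lies in the set maintained by the fusion,
      since \<open>Succ\<close> collects all choices of successors allowed by the lift.\<close>
    have mem: "h \<in> f k" if "FS n (seg U' 0 k) h" for h k
      using that
    proof (induction k arbitrary: h)
      case 0
      then show ?case using FS_D(1,2)[OF 0] U'(2) unfolding H0_def by simp
    next
      case (Suc k)
      let ?c = "cut n U' k"
      note uA = R_A[OF UR, of k]
      from FS_snoc[of "U' k" n "seg U' 0 k" h] uA e Suc.prems obtain h' where
        h': "FS n (seg U' 0 k) h'" "\<forall>a\<in>T n. h a \<in> lift1 (K ?c (U' k)) {h' a}" by (auto simp: seg_Suc)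
      note h'f = Suc.IH[OF h'(1)]
      from T[of k] obtain z where z: "z \<in> MM ?c" "U' k = rs z ?c" "f (Suc k) = Succ n ?c (f k) z" by blast
      have "lift1 (K ?c (U' k)) {h' a} = lift1 z {h' a}" if "a \<in> T n" for a
        using FS_D(4)[OF h'(1), of a] e that K_rs(2)[OF z(1), of "h' a"] z(2) by (intro lift1_cong) simp
      moreover have "tlv h n = Suc (tlv z ?c)" using FS_D(2)[OF Suc.prems] e[of "Suc k"] z(2) by simp
      ultimately show ?case unfolding z(3) Succ_def using FS_D(1)[OF Suc.prems] h'(2) h'f by auto
    qed
    have "op n U' \<subseteq> X"
    proof
      fix x assume "x \<in> op n U'"
      then obtain v where v: "Op n U' v" "x = rs v n" using op_Op by blast
      then obtain j where j: "Fit n (seg U' 0 j) v" unfolding Op_def by blast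
      then have "j \<noteq> 0" using fit_Nil unfolding Fit_def by (intro notI) simp
      then obtain k where k: "j = Suc k" by (cases j) auto
      let ?c = "cut n U' k"
      from Fit_snoc[of "U' k" n "seg U' 0 k" v] R_A[OF UR, of k] e j k obtain h where
        h: "FS n (seg U' 0 k) h" "\<forall>a\<in>T n. v a = K ?c (U' k) (h a)" by (auto simp: seg_Suc)
      note hf = mem[OF h(1)]
      from T[of k] obtain z where z: "z \<in> MM ?c" "U' k = rs z ?c" "good n X (f k) z" by blast
      have "rs v n = rs (z \<circ> h) n"
      proof (rule rs_eqI)
        show "v \<in> MM n" by (rule Fit_D(1)[OF j])
        show "z \<circ> h \<in> MM n" using MM_comp[OF z(1) FS_D(1)[OF h(1)]] cut_le[OF UR, of 0 k] by simp
        fix a assume a: "a \<in> T n"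
        have "lv (h a) = ?c" using FS_D(4)[OF h(1), of a] e a by simp
        then show "v a = (z \<circ> h) a" using h(2) a K_rs(2)[OF z(1), of "h a"] z(2) by simp
      qed
      with z(3) hf show "x \<in> X" unfolding good_def v(2) by auto
    qed
    with U'(1) show ?thesis by blast
  qed
qed

sublocale ramsey_system A E fit
  by unfold_locales (rule pigeonhole_nodes)

end

section \<open>The space of fat subtrees\<close>

context SM_tree
begin

section \<open>Cuts, lifts and the order of fat subtrees in the abstract setting\<close>

lemma is_cut_iff: "is_cut le M h u c \<longleftrightarrow>
    c 0 = 0 \<and> (\<forall>l. enat l < h \<longrightarrow> u l \<in> A (c l) \<and> c (Suc l) = E (c l) (u l))"
proof -
  have "0 < d \<and> u l \<in> AMnkm le M (c l) 1 (d - 1) \<longleftrightarrow> u l \<in> A (c l) \<and> d = E (c l) (u l)" for l d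
    by (auto simp: AMnkm_def A_def E_def)
  then show ?thesis unfolding is_cut_def by simp
qed

lemma is_cut_cut:
  assumes "is_cut le M h u c"
  shows "enat l \<le> h \<Longrightarrow> c l = cut 0 u l"
proof (induction l)
  case 0
  then show ?case using assms is_cut_iff by simp
next
  case (Suc l)
  then have "enat l < h" using Suc_ile_eq by blast
  then have "c (Suc l) = E (c l) (u l)" "c l = cut 0 u l" using assms is_cut_iff Suc.IH by auto
  then show ?case by simp
qed

lemma fat_iff: "fat le M h u \<longleftrightarrow> (\<forall>l. enat l < h \<longrightarrow> u l \<in> A (cut 0 u l))"
proof
  assume "fat le M h u"
  then obtain c where c: "is_cut le M h u c" unfolding fat_def by blast
  show "\<forall>l. enat l < h \<longrightarrow> u l \<in> A (cut 0 u l)"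
  proof (intro allI impI)
    fix l assume l: "enat l < h"
    then have "c l = cut 0 u l" using is_cut_cut[OF c] by simp
    with c l is_cut_iff show "u l \<in> A (cut 0 u l)" by metis
  qed
next
  assume "\<forall>l. enat l < h \<longrightarrow> u l \<in> A (cut 0 u l)"
  then have "is_cut le M h u (cut 0 u)" unfolding is_cut_iff by simp
  then show "fat le M h u" unfolding fat_def by blast
qed

lemma cutf_eq: "fat le M h u \<Longrightarrow> enat l \<le> h \<Longrightarrow> cutf le M h u l = cut 0 u l"
  unfolding fat_def cutf_def by (erule is_cut_cut[OF someI_ex])

lemma Rset_eq: "Rset le M = R 0"
  unfolding Rset_def R_def fat_iff by simp

lemma chain_nth: "chain n xs \<longleftrightarrow> (\<forall>l<length xs. xs ! l \<in> A (endl n (take l xs)))"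
proof (induction xs arbitrary: n)
  case (Cons x xs)
  show ?case unfolding chain.simps Cons.IH
    by (auto simp: less_Suc_eq_0_disj all_conj_distrib)
qed simp

lemma cut_nth: "l \<le> length xs \<Longrightarrow> cut n (nth xs) l = endl n (take l xs)"
  by (induction l) (simp_all add: take_Suc_conv_app_nth)

lemma fat_list: "fat le M (enat (length xs)) (nth xs) \<longleftrightarrow> chain 0 xs"
  unfolding fat_iff chain_nth by (simp add: cut_nth)

lemma ARset_eq: "ARset le M = {xs. chain 0 xs}"
  unfolding ARset_def fat_list ..

lemma liftd_eq:
  assumes "\<And>i. l \<le> i \<Longrightarrow> i < l + d \<Longrightarrow> u i \<in> A (c i) \<and> c (Suc i) = E (c i) (u i)" "Y \<subseteq> T (c l)"
  shows "liftd le M u c Y l d = lifts (c l) (seg u l (l + d)) Y"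
  using assms
proof (induction d arbitrary: l Y)
  case (Suc d)
  have u: "u l \<in> A (c l)" "c (Suc l) = E (c l) (u l)" using Suc.prems(1)[of l] by auto
  have "canon le M (u l) (c l) ` succs le Y = lift1 (K (c l) (u l)) Y" by (rule canon_succs[OF u(1) Suc.prems(2)])
  then have "liftd le M u c Y l (Suc d) = liftd le M u c (lift1 (K (c l) (u l)) Y) (Suc l) d" by simp
  also have "\<dots> = lifts (c (Suc l)) (seg u (Suc l) (Suc l + d)) (lift1 (K (c l) (u l)) Y)"
    using lift1_K_T[OF u(1) Suc.prems(2)] u(2) Suc.prems(1) by (intro Suc.IH) auto
  also have "\<dots> = lifts (c l) (u l # seg u (Suc l) (Suc l + d)) Y" using u(2) by simp
  also have "u l # seg u (Suc l) (Suc l + d) = seg u l (l + Suc d)"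
    using seg_append[of l "Suc l" "l + Suc d" u] by (simp add: seg_def)
  finally show ?case .
qed simp

lemma LiftL_eq:
  assumes "fat le M h u" "l \<le> k" "enat k \<le> h"
  shows "LiftL le M u (cutf le M h u) l k = lifts (cut 0 u l) (seg u l k) (T (cut 0 u l))"
proof -
  have le: "enat i < h" if "i < k" for i using that assms(3) by (metis enat_ord_simps(2) order_less_le_trans)
  have c: "cutf le M h u i = cut 0 u i" if "i \<le> k" for i
    using that assms(3) by (intro cutf_eq[OF assms(1)]) (metis enat_ord_simps(1) order_trans)
  have "liftd le M u (cutf le M h u) (T (cutf le M h u l)) l (k - l) =
      lifts (cutf le M h u l) (seg u l (l + (k - l))) (T (cutf le M h u l))"
  proof (rule liftd_eq)
    fix i assume "l \<le> i" "i < l + (k - l)"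
    then have i: "i < k" by simp
    then show "u i \<in> A (cutf le M h u i) \<and> cutf le M h u (Suc i) = E (cutf le M h u i) (u i)"
      using c[of i] c[of "Suc i"] assms(1) le[OF i] unfolding fat_iff by simp
  qed simp
  then show ?thesis unfolding LiftL_def Lift_def using assms(2) c[of l] by simp
qed

lemma lift1_nonempty: "u \<in> A n \<Longrightarrow> lift1 (K n u) (T n) \<noteq> {}"
proof -
  assume u: "u \<in> A n"
  obtain s where s: "lv s = Suc n" using ex_level by blast
  have "s \<in> succs le (T n)" unfolding succs_def immsucc_iff using trunc[of n s] s by auto
  with canon_succs[OF u order_refl] show ?thesis by blast
qed

lemma sub_of_fat_le:
  assumes V: "V \<in> R 0" and U: "U \<in> R 0" and le: "fat_le le M (\<infinity>, V) (\<infinity>, U)"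
  shows "sub 0 V U"
  unfolding sub_def
proof (intro conjI allI V U)
  fix l
  have fV: "fat le M \<infinity> V" and fU: "fat le M \<infinity> U" using V U unfolding fat_iff R_def by auto
  from le obtain \<phi> where phi: "\<phi> l \<le> \<phi> (Suc l)" "cutf le M \<infinity> V l = cutf le M \<infinity> U (\<phi> l)"
    "LiftL le M V (cutf le M \<infinity> V) l (Suc l) \<subseteq> LiftL le M U (cutf le M \<infinity> U) (\<phi> l) (\<phi> (Suc l))"
    unfolding fat_le_def Let_def by auto
  let ?c = "cut 0 V l" and ?k = "\<phi> l" and ?k' = "\<phi> (Suc l)"
  have c: "cut 0 U ?k = ?c" using phi(2) cutf_eq[OF fV] cutf_eq[OF fU] by simp
  have uA: "V l \<in> A ?c" by (rule R_A[OF V])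
  have ch: "chain ?c (seg U ?k ?k')" using cut_seg(2)[OF U phi(1)] c by simp
  have "lifts ?c (seg V l (Suc l)) (T ?c) \<subseteq> lifts ?c (seg U ?k ?k') (T ?c)"
    using phi(3) LiftL_eq[OF fV, of l "Suc l"] LiftL_eq[OF fU phi(1)] c by simp
  then have inc: "lift1 (K ?c (V l)) (T ?c) \<subseteq> lifts ?c (seg U ?k ?k') (T ?c)" by (simp add: seg_Suc)
  \<comment> \<open>The order compares lifts only as sets of nodes; a common node shows that both
    end on the same level.\<close>
  obtain y where y: "y \<in> lift1 (K ?c (V l)) (T ?c)" using lift1_nonempty[OF uA] by blast
  have "y \<in> T (E ?c (V l))" using lift1_K_T[OF uA order_refl] y by blast
  moreover have "y \<in> T (endl ?c (seg U ?k ?k'))" using lifts_T[OF ch order_refl] inc y by blast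
  ultimately have "E ?c (V l) = endl ?c (seg U ?k ?k')" by simp
  with inc ch uA have "fit ?c (seg U ?k ?k') (V l)" unfolding fit_def by blast
  with c show "\<exists>k k'. cut 0 U k = ?c \<and> fit ?c (seg U k k') (V l)" by blast
qed

lemma cut_cong: "(\<And>i. i < l \<Longrightarrow> x i = y i) \<Longrightarrow> cut n x l = cut n y l"
  by (induction l) auto

lemma fat_le_of_sub:
  assumes sub: "sub 0 V U" and x: "\<And>l. enat l < h \<Longrightarrow> x l = V l"
  shows "fat_le le M (h, x) (\<infinity>, U)"
proof -
  note R = sub_R[OF sub]
  have cx: "cut 0 x l = cut 0 V l" if "enat l \<le> h" for l
  proof (rule cut_cong)
    fix i assume "i < l"
    then have "enat i < h" using that by (metis enat_ord_simps(2) order_less_le_trans)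
    then show "x i = V i" by (rule x)
  qed
  have fU: "fat le M \<infinity> U" using R(2) unfolding fat_iff R_def by auto
  have fx: "fat le M h x" unfolding fat_iff using cx x R_A[OF R(1)] by simp
  have "\<forall>l. \<exists>k. cut 0 U k = cut 0 V l" using sub_fits[OF sub] by blast
  then obtain \<phi> where phi: "\<And>l. cut 0 U (\<phi> l) = cut 0 V l" by metis
  show ?thesis
    unfolding fat_le_def Let_def fst_conv snd_conv
  proof (intro exI[of _ \<phi>] conjI allI impI)
    fix l
    show "enat (\<phi> l) \<le> \<infinity>" by simp
    assume l: "enat l < h"
    then have l': "enat (Suc l) \<le> h" by (simp add: Suc_ile_eq)
    have "cut 0 U (\<phi> l) \<le> cut 0 U (\<phi> (Suc l))"
      unfolding phi using cut_le[OF R(1), of l "Suc l"] by simp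
    then show mono: "\<phi> l \<le> \<phi> (Suc l)" unfolding cut_le_iff[OF R(2)] .
    show "cutf le M h x l = cutf le M \<infinity> U (\<phi> l)"
      using cutf_eq[OF fx, of l] cutf_eq[OF fU] cx[of l] l phi by simp
    from sub obtain k k' where k: "cut 0 U k = cut 0 V l" "fit (cut 0 V l) (seg U k k') (V l)"
      unfolding sub_def by blast
    have kphi: "k = \<phi> l" using k(1) phi cut_inj[OF R(2)] by metis
    have "k < k'" by (rule fit_seg_less[OF k(2)])
    then have "cut 0 U k' = cut 0 V (Suc l)"
      using fit_end[OF k(2)] cut_seg(1)[OF R(2), of k k'] k(1) by simp
    then have k'phi: "k' = \<phi> (Suc l)" using phi cut_inj[OF R(2)] by metis
    have "LiftL le M x (cutf le M h x) l (Suc l) = lift1 (K (cut 0 V l) (V l)) (T (cut 0 V l))"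
      using LiftL_eq[OF fx _ l', of l] cx[of l] l x[OF l] by (simp add: seg_Suc)
    also have "\<dots> \<subseteq> lifts (cut 0 V l) (seg U k k') (T (cut 0 V l))" using k(2) unfolding fit_def by blast
    also have "\<dots> = LiftL le M U (cutf le M \<infinity> U) (\<phi> l) (\<phi> (Suc l))"
      using LiftL_eq[OF fU mono] phi unfolding kphi k'phi by simp
    finally show "LiftL le M x (cutf le M h x) l (Suc l) \<subseteq> LiftL le M U (cutf le M \<infinity> U) (\<phi> l) (\<phi> (Suc l))" .
  qed
qed

section \<open>Basic open sets and depth\<close>

lemma basic_iff:
  assumes "U \<in> R 0"
  shows "V \<in> basic le M x U \<longleftrightarrow> sub 0 V U \<and> (\<forall>i<length x. x ! i = V i)"
  unfolding basic_def Rset_eq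
  using sub_of_fat_le[OF _ assms, of V] fat_le_of_sub[of V U \<infinity> V] sub_R(1)[of 0 V U] by auto

lemma prefix_app: "(\<forall>i<length x. x ! i = V i) \<Longrightarrow> app x (shift V (length x)) = V"
  "(\<forall>i<length x. x ! i = V i) \<Longrightarrow> seg V 0 (length x) = x"
  by (rule ext, simp add: app_def shift_def) (rule nth_equalityI, simp_all add: seg_def)

lemma basic_below:
  assumes V: "V \<in> basic le M x U'" and U': "U' \<in> R 0" "cut 0 U' d = endl 0 x"
  shows "sub (endl 0 x) (shift V (length x)) (shift U' d)" "app x (shift V (length x)) = V"
proof -
  from V have V': "sub 0 V U'" "\<forall>i<length x. x ! i = V i" using basic_iff[OF U'(1)] by auto
  show "app x (shift V (length x)) = V" using prefix_app(1)[OF V'(2)] .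
  have "cut 0 V (length x) = endl 0 x"
    using cut_seg(1)[OF sub_R(1)[OF V'(1)], of 0 "length x"] prefix_app(2)[OF V'(2)] by simp
  then show "sub (endl 0 x) (shift V (length x)) (shift U' d)"
    using sub_shift[OF V'(1), of d "length x"] U'(2) by simp
qed

text \<open>A member of the basic set extends \<open>x\<close> and lies below \<open>U\<close>, so
  the end of \<open>x\<close> is a cut level of \<open>U\<close>, at an index unique by
  \<open>cut_inj\<close>.\<close>

lemma basic_depth:
  assumes x: "chain 0 x" and U: "U \<in> R 0" and ne: "basic le M x U \<noteq> {}"
  obtains d where "depth le M x U = enat d" "cut 0 U d = endl 0 x"
proof -
  from ne obtain V where V: "sub 0 V U" "\<forall>i<length x. x ! i = V i" using basic_iff[OF U] by blast
  have fle: "fat_le le M (enat (length x), nth x) (\<infinity>, U)"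
    by (rule fat_le_of_sub[OF V(1)]) (use V(2) in simp)
  have seg: "seg V 0 (length x) = x" by (rule prefix_app(2)[OF V(2)])
  have "cut 0 V (length x) = endl 0 x" using cut_seg(1)[OF sub_R(1)[OF V(1)], of 0 "length x"] seg by simp
  with sub_fits[OF V(1), of "length x"] obtain d where d: "cut 0 U d = endl 0 x" by auto
  have fU: "fat le M \<infinity> U" using U unfolding fat_iff R_def by auto
  have "cutf le M (enat (length x)) (nth x) (length x) = endl 0 x"
    using cutf_eq[of "enat (length x)" "nth x" "length x"] x fat_list cut_nth[of "length x" x 0] by simp
  moreover have "(THE n. cutf le M \<infinity> U n = endl 0 x) = d"
  proof (rule the_equality)
    show "cutf le M \<infinity> U d = endl 0 x" using d cutf_eq[OF fU, of d] by simp
    fix i assume "cutf le M \<infinity> U i = endl 0 x"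
    then show "i = d" using d cutf_eq[OF fU, of i] cut_inj[OF U, of i d] by simp
  qed
  ultimately have "depth le M x U = enat d" unfolding depth_def using fle by simp
  with d that show thesis by blast
qed

text \<open>Keeping the first \<open>d\<close> entries of \<open>U\<close> and thinning only the
  tail stays in the prescribed neighbourhood; the stem \<open>x\<close> is put in front of the same
  tail.\<close>

lemma ex_basic_n:
  assumes U: "U \<in> R 0" and d: "cut 0 U d = endl 0 x" and W: "sub (endl 0 x) W (shift U d)"
  shows "\<exists>U'\<in>basic_n le M (enat d) U. \<forall>V\<in>basic le M x U'. \<exists>V'. sub (endl 0 x) V' W \<and> V = app x V'"
proof -
  let ?s = "seg U 0 d"
  let ?U = "app ?s W"
  have s: "endl 0 ?s = endl 0 x" "chain 0 ?s" using cut_seg[OF U, of 0 d] d by auto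
  have UU: "sub 0 ?U U" using sub_app[OF fits_refl[OF s(2)] _ U] W d by simp
  have "?U \<in> basic le M ?s U" using UU by (simp add: basic_iff[OF U] app_nth)
  then have 1: "?U \<in> basic_n le M (enat d) U" unfolding basic_n_def by (simp add: seg_def)
  have c: "cut 0 ?U d = endl 0 x" using cut_app[OF s(2), of W] sub_R(1)[OF W] s(1) by simp
  have sh: "shift ?U d = W" using app_simps(4)[of ?s W] by simp
  have "\<exists>V'. sub (endl 0 x) V' W \<and> V = app x V'" if "V \<in> basic le M x ?U" for V
    using basic_below[OF that sub_R(1)[OF UU] c] unfolding sh by metis
  with 1 show ?thesis by blast
qed

lemma ex_basic_n_depth:
  assumes x: "x \<in> ARset le M" and U: "U \<in> Rset le M" and ne: "basic le M x U \<noteq> {}"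
    and Q: "\<And>U. U \<in> R (endl 0 x) \<Longrightarrow> \<exists>W. sub (endl 0 x) W U \<and> Q W"
  obtains U' W where "U' \<in> basic_n le M (depth le M x U) U" "Q W"
    "\<forall>V\<in>basic le M x U'. \<exists>V'. sub (endl 0 x) V' W \<and> V = app x V'"
proof -
  have x': "chain 0 x" and UR: "U \<in> R 0" using x U by (simp_all add: ARset_eq Rset_eq)
  from basic_depth[OF x' UR ne] obtain d where d: "depth le M x U = enat d" "cut 0 U d = endl 0 x" .
  have "shift U d \<in> R (endl 0 x)" using shift_R[OF UR, of d] d by simp
  from Q[OF this] obtain W where W: "sub (endl 0 x) W (shift U d)" "Q W" by blast
  from ex_basic_n[OF UR d(2) W(1)] obtain U' where "U' \<in> basic_n le M (enat d) U"
    "\<forall>V\<in>basic le M x U'. \<exists>V'. sub (endl 0 x) V' W \<and> V = app x V'" ..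
  with W(2) show thesis unfolding d(1)[symmetric] by (intro that)
qed

lemma homogenized_Ramsey:
  assumes "homogenized Y"
  shows "Ramsey le M Y"
  unfolding Ramsey_def
proof (intro ballI impI)
  fix x U assume xU: "x \<in> ARset le M" "U \<in> Rset le M" "basic le M x U \<noteq> {}"
  let ?Q = "\<lambda>W. stays Y x W \<or> avoids Y x W"
  have "\<exists>W. sub (endl 0 x) W U \<and> ?Q W" if "U \<in> R (endl 0 x)" for U
    using assms xU(1) that unfolding homogenized_def ARset_eq by simp
  from ex_basic_n_depth[OF xU this] obtain U' W where U': "U' \<in> basic_n le M (depth le M x U) U"
    and W: "?Q W" and V: "\<forall>V\<in>basic le M x U'. \<exists>V'. sub (endl 0 x) V' W \<and> V = app x V'" .
  have "basic le M x U' \<subseteq> Y \<or> basic le M x U' \<inter> Y = {}"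
  proof (cases "stays Y x W")
    case True
    then have "V \<in> Y" if "V \<in> basic le M x U'" for V using bspec[OF V that] by blast
    then show ?thesis by blast
  next
    case False
    with W have "V \<notin> Y" if "V \<in> basic le M x U'" for V using bspec[OF V that] by blast
    then show ?thesis by blast
  qed
  then show "\<exists>U'\<in>basic_n le M (depth le M x U) U. basic le M x U' \<subseteq> Y \<or> basic le M x U' \<inter> Y = {}"
    by (rule bexI[OF _ U'])
qed

lemma avoidable_Ramsey_null:
  assumes "avoidable Y"
  shows "Ramsey_null le M Y"
  unfolding Ramsey_null_def
proof (intro ballI impI)
  fix x U assume xU: "x \<in> ARset le M" "U \<in> Rset le M" "basic le M x U \<noteq> {}"
  let ?Q = "\<lambda>W. avoids Y x W"
  have "\<exists>W. sub (endl 0 x) W U \<and> ?Q W" if "U \<in> R (endl 0 x)" for U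
    using assms xU(1) that unfolding avoidable_def ARset_eq by simp
  from ex_basic_n_depth[OF xU this] obtain U' W where U': "U' \<in> basic_n le M (depth le M x U) U"
    and W: "?Q W" and V: "\<forall>V\<in>basic le M x U'. \<exists>V'. sub (endl 0 x) V' W \<and> V = app x V'" .
  have "V \<notin> Y" if "V \<in> basic le M x U'" for V using bspec[OF V that] W by blast
  then have "basic le M x U' \<inter> Y = {}" by blast
  then show "\<exists>U'\<in>basic_n le M (depth le M x U) U. basic le M x U' \<inter> Y = {}" by (rule bexI[OF _ U'])
qed

section \<open>The Ellentuck topology, nowhere dense and meager sets\<close>

abbreviation Top where "Top \<equiv> Ellentuck le M"

lemma openin_basic: "chain 0 x \<Longrightarrow> U \<in> R 0 \<Longrightarrow> openin Top (basic le M x U)"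
  unfolding Ellentuck_def ARset_eq Rset_eq by (intro topology_generated_by_Basis) blast

text \<open>Induction over the generation of the topology. For an intersection the two accepting
  initial segments are lengthened to a common one; a basic set accepts its own stem.\<close>

lemma openin_ellentuck_open:
  assumes "openin Top G"
  shows "ellentuck_open G"
proof -
  have "generate_topology_on {basic le M x U | x U. x \<in> ARset le M \<and> U \<in> Rset le M} G"
    using assms unfolding Ellentuck_def openin_topology_generated_by_iff .
  then show ?thesis
  proof induction
    case Empty
    show ?case by (simp add: ellentuck_open_def)
  next
    case (Int a b)
    show ?case
      unfolding ellentuck_open_def
    proof (intro ballI impI)
      fix V assume V: "V \<in> a \<inter> b" "V \<in> R 0"
      with Int.IH obtain i j where "accepts a (seg V 0 i) (shift V i)" "accepts b (seg V 0 j) (shift V j)"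
        unfolding ellentuck_open_def by blast
      with accepts_extend[OF V(2), of a i "max i j"] accepts_extend[OF V(2), of b j "max i j"]
      show "\<exists>k. accepts (a \<inter> b) (seg V 0 k) (shift V k)"
        unfolding accepts_def by (intro exI[of _ "max i j"]) simp
    qed
  next
    case (UN K)
    show ?case
      unfolding ellentuck_open_def
    proof (intro ballI impI)
      fix V assume "V \<in> \<Union>K" "V \<in> R 0"
      then obtain k where "k \<in> K" "V \<in> k" by blast
      with UN.IH \<open>V \<in> R 0\<close> obtain i where "accepts k (seg V 0 i) (shift V i)"
        unfolding ellentuck_open_def by blast
      with \<open>k \<in> K\<close> have "accepts (\<Union>K) (seg V 0 i) (shift V i)" unfolding accepts_def by blast
      then show "\<exists>i. accepts (\<Union>K) (seg V 0 i) (shift V i)" ..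
    qed
  next
    case (Basis s)
    then obtain x U where s: "s = basic le M x U" and U: "U \<in> R 0" unfolding Rset_eq by blast
    show ?case
      unfolding ellentuck_open_def
    proof (intro ballI impI)
      fix V assume V: "V \<in> s" "V \<in> R 0"
      then have V': "sub 0 V U" "\<forall>i<length x. x ! i = V i" using basic_iff[OF U] s by auto
      note sg = prefix_app(2)[OF V'(2)]
      have e: "endl 0 (seg V 0 (length x)) = cut 0 V (length x)" "chain 0 (seg V 0 (length x))"
        using cut_seg[OF V(2), of 0 "length x"] by auto
      have "app (seg V 0 (length x)) W \<in> s" if W: "sub (endl 0 (seg V 0 (length x))) W (shift V (length x))" for W
      proof -
        have "sub 0 (app (seg V 0 (length x)) W) V"
          using sub_app[OF fits_refl[OF e(2)] _ V(2)] W e(1) by simp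
        from sub_trans[OF this V'(1)] show ?thesis unfolding s basic_iff[OF U] sg by (simp add: app_nth)
      qed
      then show "\<exists>k. accepts s (seg V 0 k) (shift V k)" unfolding accepts_def by blast
    qed
  qed
qed

lemma topspace_Top: "topspace Top = R 0"
proof
  show "topspace Top \<subseteq> R 0"
    unfolding Ellentuck_def topology_generated_by_topspace by (auto simp: basic_def Rset_eq)
  show "R 0 \<subseteq> topspace Top"
  proof
    fix V assume V: "V \<in> R 0"
    then have "V \<in> basic le M [] V" using sub_refl by (simp add: basic_iff)
    with openin_subset[OF openin_basic[of "[]" V]] V show "V \<in> topspace Top" by auto
  qed
qed

text \<open>The complement of the closure is open, hence homogenized, and exchanging the
  alternatives homogenizes the closure. A basic set inside the closure would lie in its empty
  interior, so only avoidance remains.\<close>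

lemma nowhere_dense_avoidable:
  assumes "nowhere_dense Top N"
  shows "avoidable N"
proof -
  let ?C = "Top closure_of N"
  have N: "N \<subseteq> topspace Top" and int: "Top interior_of ?C = {}"
    using assms unfolding nowhere_dense_def by auto
  have "openin Top (topspace Top - ?C)" by (rule openin_diff[OF openin_topspace closedin_closure_of])
  then have "homogenized (topspace Top - ?C)" by (rule open_homogenized[OF openin_ellentuck_open])
  moreover have "app x V \<in> topspace Top - ?C \<longleftrightarrow> app x V \<notin> ?C"
    if "chain 0 x" "sub (endl 0 x) V U" for x V U
    using app_R[OF that(1) sub_R(1)[OF that(2)]] topspace_Top by simp
  ultimately have hom: "homogenized ?C" unfolding homogenized_def by metis
  have "avoidable ?C"
  proof (rule avoidable_nowhere_dense[OF hom], rule ccontr)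
    fix x U assume x: "chain 0 x" and U: "U \<in> R (endl 0 x)"
      and neg: "\<not> (\<exists>V. sub (endl 0 x) V U \<and> app x V \<notin> ?C)"
    have xU: "app x U \<in> R 0" by (rule app_R[OF x U])
    have "basic le M x (app x U) \<subseteq> ?C"
    proof
      fix V assume "V \<in> basic le M x (app x U)"
      from basic_below[OF this xU cut_app[OF x U]] neg show "V \<in> ?C" by (metis app_simps(4))
    qed
    then have "basic le M x (app x U) \<subseteq> Top interior_of ?C"
      by (rule interior_of_maximal[OF _ openin_basic[OF x xU]])
    moreover have "app x U \<in> basic le M x (app x U)" using sub_refl[OF xU] by (simp add: basic_iff[OF xU] app_nth)
    ultimately show False using int by blast
  qed
  then show ?thesis by (rule avoidable_subset) (rule closure_of_subset[OF N])
qed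

lemma meager_avoidable:
  assumes "meager Top Y"
  shows "avoidable Y"
proof -
  from assms obtain N :: "nat \<Rightarrow> (nat \<Rightarrow> ('a \<Rightarrow> 'a option)) set" where
    N: "\<And>i. nowhere_dense Top (N i)" "Y \<subseteq> (\<Union>i. N i)" unfolding meager_def by blast
  have "avoidable (\<Union>i. N i)" by (rule avoidable_Union) (rule nowhere_dense_avoidable[OF N(1)])
  then show ?thesis by (rule avoidable_subset) (rule N(2))
qed

lemma Baire_homogenized:
  assumes "Baire_property Top Y"
  shows "homogenized Y"
proof -
  from assms obtain G where G: "openin Top G" "meager Top ((Y - G) \<union> (G - Y))"
    unfolding Baire_property_def by blast
  from open_homogenized[OF openin_ellentuck_open[OF G(1)]] meager_avoidable[OF G(2)]
  show ?thesis by (rule homogenized_modulo_avoidable)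
qed

end

theorem mainTheorem9:
  fixes le :: "'a::countable \<Rightarrow> 'a \<Rightarrow> bool"
    and S :: "'a \<Rightarrow> 'a list \<Rightarrow> 'c \<Rightarrow> 'a option"
    and M :: "('a \<Rightarrow> 'a) set"
  assumes "is_SM_tree le S M"
  shows "(\<forall>X \<subseteq> Rset le M. Baire_property (Ellentuck le M) X \<longrightarrow> Ramsey le M X) \<and>
         (\<forall>X \<subseteq> Rset le M. meager (Ellentuck le M) X \<longrightarrow> Ramsey_null le M X)"
proof -
  interpret SM_tree le S M by (rule SM_tree.intro) (rule assms)
  show ?thesis
    using homogenized_Ramsey[OF Baire_homogenized] avoidable_Ramsey_null[OF meager_avoidable] by blast
qed

end
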